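(* Let $\alpha\in(0,1/2)$ be a prescribed constant. There is a constant $c>0$ depending only on $\alpha$ such that the following holds. Consider testing $H_0:\mu=0$ against $H_1:\mu\in K,\ \|\mu\|_2\ge\rho$, where $K\subset\mathbb{R}^d$ is a QCO set, from $N$ samples of $\mathcal N(\mu,\sigma^2\mathbf I_d)$ under the strong $\epsilon$-contamination model. If there exists a test whose type-I and type-II errors are both uniformly below $\alpha$, then necessarily $$\rho^2\ \ge\ c\,\sigma^2\max\left\{\frac{\sqrt{k_1^\star}}{N},\ \epsilon\sqrt{\frac{k_2^\star}{N}},\ \epsilon^2\right\},$$ where $k_1^\star=k_1^\star(K,\sigma,N)$ and $k_2^\star=k_2^\star(K,\sigma,N,\epsilon)$ are the first and second optimal dimensions.
   Context: QCO set: $K\subset\mathbb{R}^d$ is quadratically convex orthosymmetric if (1) $K$ is convex; (2) $K^2:=\{(\theta_1^2,\dots,\theta_d^2)^\top:\theta\in K\}$ is convex; (3) $\theta\in K$ implies $(\eta_1\theta_1,\dots,\eta_d\theta_d)^\top\in K$ for all $\eta_i\in\{-1,1\}$. Model: $\tilde{\mathbf X}=\{\tilde X_1,\dots,\tilde X_N\}$ are i.i.d. $\mathcal N(\mu,\sigma^2\mathbf I_d)$ with unknown $\mu\in K$ and known $\sigma>0$; $\mathbb{P}_\mu$ is the probability law when the mean is $\mu$. Strong $\epsilon$-contamination: $\epsilon\in[0,c_0)$ is known, with $c_0<1/2$ a fixed small constant. An adversary $\mathcal C$ with full knowledge of the true distribution (and of $K$) inspects $\tilde{\mathbf X}$ and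 replaces up to $\epsilon N$ of the samples by arbitrary values (possibly randomly); only $\mathbf X=\mathcal C(\tilde{\mathbf X})$ is observed, and the set of corrupted indices is unknown. A test is a $\{0,1\}$-valued measurable function $\phi$ of the observed data. Type-I error: $\sup_{\mathcal C}\mathbb{P}_0(\phi(\mathcal C(\tilde{\mathbf X}))=1)$. Type-II error: $\sup_{\mu\in K,\|\mu\|_2\ge\rho}\sup_{\mathcal C}\mathbb{P}_\mu(\phi(\mathcal C(\tilde{\mathbf X}))=0)$. The alternative set is understood to be nonempty. Kolmogorov $k$-width: $D_k(K)=\inf_{P\in\mathcal P_k}\sup_{\theta\in K}\|\theta-P\theta\|_2$, $\mathcal P_k$ being the set of orthogonal projections of rank $k$ in $\mathbb{R}^d$; $D_k(K)=\infty$ for $k<0$, $D_k(K)=0$ for $k>d$. Optimal dimensions: $k_1^\star=\max\{j:0\le j\le d,\ D_{j-1}(K)>\frac{j^{1/4}}{\sqrt N}\sigma\}$ and $k_2^\star=\max\{j:0\le j\le d,\ D_{j-1}(K)>\frac{j^{1/4}\sqrt\epsilon}{N^{1/4}}\sigma\}$. Standing assumption of the paper: $D_0(K)=\sup_{\theta\in K}\|\theta\|_2>\sigma/\sqrt N$, i.e. $k_1^\star\ge1$. *)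

theory Defs
  imports "HOL-Probability.Probability" "Jordan_Normal_Form.DL_Rank"
begin

text \<open>
  A vector in \<open>d\<close>-dimensional Euclidean space is a function that is \<open>undefined\<close> outside \<open>{..<d}\<close>,
  i.e. a point of \<open>Pi\<^sub>M {..<d} (\<lambda>_. borel)\<close>, and its Euclidean norm is \<open>L2_set \<theta> {..<d}\<close>. The dimension
  is a number rather than a type so that constants can be chosen uniformly in it.
\<close>

definition rvectors :: "nat \<Rightarrow> (nat \<Rightarrow> real) set" where
  "rvectors d = (\<Pi>\<^sub>E i\<in>{..<d}. UNIV)"

definition convex_vectors :: "nat \<Rightarrow> (nat \<Rightarrow> real) set \<Rightarrow> bool" where
  "convex_vectors d K \<longleftrightarrow>
     (\<forall>x\<in>K. \<forall>y\<in>K. \<forall>u\<ge>0. \<forall>v\<ge>0. u + v = 1 \<longrightarrow> (\<lambda>i\<in>{..<d}. u * x i + v * y i) \<in> K)"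

definition QCO :: "nat \<Rightarrow> (nat \<Rightarrow> real) set \<Rightarrow> bool" where
  "QCO d K \<longleftrightarrow>
     K \<subseteq> rvectors d \<and>
     convex_vectors d K \<and>
     convex_vectors d ((\<lambda>\<theta>. \<lambda>i\<in>{..<d}. (\<theta> i)\<^sup>2) ` K) \<and>
     (\<forall>\<theta>\<in>K. \<forall>\<eta>. (\<forall>i<d. \<eta> i \<in> {-1, 1}) \<longrightarrow> (\<lambda>i\<in>{..<d}. \<eta> i * \<theta> i) \<in> K)"

definition orthogonal_projections :: "nat \<Rightarrow> nat \<Rightarrow> real mat set" where
  "orthogonal_projections d k =
     {P \<in> carrier_mat d d. transpose_mat P = P \<and> P * P = P \<and> vec_space.rank d P = k}"

text \<open>The supremum is taken in the extended reals, since \<open>K\<close> may be unbounded.\<close>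

definition kolmogorov_width :: "nat \<Rightarrow> (nat \<Rightarrow> real) set \<Rightarrow> int \<Rightarrow> ereal" where
  "kolmogorov_width d K k =
     (if k < 0 then \<infinity>
      else if k > int d then 0
      else INF P\<in>orthogonal_projections d (nat k).
             SUP \<theta>\<in>K. ereal (L2_set (\<lambda>i. \<theta> i - (\<Sum>j<d. P $$ (i, j) * \<theta> j)) {..<d}))"

definition k1_star :: "nat \<Rightarrow> (nat \<Rightarrow> real) set \<Rightarrow> real \<Rightarrow> nat \<Rightarrow> nat" where
  "k1_star d K \<sigma> N =
     Max {j. j \<le> d \<and> kolmogorov_width d K (int j - 1) > ereal (real j powr (1/4) / sqrt (real N) * \<sigma>)}"

definition k2_star :: "nat \<Rightarrow> (nat \<Rightarrow> real) set \<Rightarrow> real \<Rightarrow> nat \<Rightarrow> real \<Rightarrow> nat" where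
  "k2_star d K \<sigma> N \<epsilon> =
     Max {j. j \<le> d \<and> kolmogorov_width d K (int j - 1) >
               ereal (real j powr (1/4) * sqrt \<epsilon> / real N powr (1/4) * \<sigma>)}"

definition data_space :: "nat \<Rightarrow> nat \<Rightarrow> (nat \<Rightarrow> nat \<Rightarrow> real) measure" where
  "data_space d N = Pi\<^sub>M {..<N} (\<lambda>_. Pi\<^sub>M {..<d} (\<lambda>_. borel))"

text \<open>The \<open>d\<close>-dimensional normal law with mean \<open>\<mu>\<close> and covariance matrix \<open>\<sigma>\<^sup>2 I\<close>, as the product of its
  one-dimensional marginals; the second argument of \<^const>\<open>normal_density\<close> is the standard deviation.\<close>

definition isotropic_normal :: "nat \<Rightarrow> (nat \<Rightarrow> real) \<Rightarrow> real \<Rightarrow> (nat \<Rightarrow> real) measure" where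
  "isotropic_normal d \<mu> \<sigma> = Pi\<^sub>M {..<d} (\<lambda>i. density lborel (normal_density (\<mu> i) \<sigma>))"

definition clean_law :: "nat \<Rightarrow> nat \<Rightarrow> real \<Rightarrow> (nat \<Rightarrow> real) \<Rightarrow> (nat \<Rightarrow> nat \<Rightarrow> real) measure" where
  "clean_law d N \<sigma> \<mu> = Pi\<^sub>M {..<N} (\<lambda>_. isotropic_normal d \<mu> \<sigma>)"

text \<open>An adversary is a probability kernel: having seen the whole clean data set \<open>x\<close>, it draws the
  observed data set, which differs from \<open>x\<close> in at most \<open>\<epsilon> N\<close> samples. Knowledge of \<open>\<mu>\<close>, \<open>K\<close> and the
  test is expressed by taking the supremum over adversaries inside the one over \<open>\<mu>\<close>.\<close>

definition adversaries ::
    "nat \<Rightarrow> nat \<Rightarrow> real \<Rightarrow> ((nat \<Rightarrow> nat \<Rightarrow> real) \<Rightarrow> (nat \<Rightarrow> nat \<Rightarrow> real) measure) set" where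
  "adversaries d N \<epsilon> =
     {C \<in> data_space d N \<rightarrow>\<^sub>M prob_algebra (data_space d N).
        \<forall>x\<in>space (data_space d N). AE y in C x. real (card {i\<in>{..<N}. y i \<noteq> x i}) \<le> \<epsilon> * real N}"

definition observed_law ::
    "nat \<Rightarrow> nat \<Rightarrow> real \<Rightarrow> (nat \<Rightarrow> real) \<Rightarrow>
     ((nat \<Rightarrow> nat \<Rightarrow> real) \<Rightarrow> (nat \<Rightarrow> nat \<Rightarrow> real) measure) \<Rightarrow> (nat \<Rightarrow> nat \<Rightarrow> real) measure" where
  "observed_law d N \<sigma> \<mu> C = bind (clean_law d N \<sigma> \<mu>) C"

definition tests :: "nat \<Rightarrow> nat \<Rightarrow> ((nat \<Rightarrow> nat \<Rightarrow> real) \<Rightarrow> nat) set" where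
  "tests d N = data_space d N \<rightarrow>\<^sub>M count_space {0, 1}"

definition type1_error :: "nat \<Rightarrow> nat \<Rightarrow> real \<Rightarrow> real \<Rightarrow> ((nat \<Rightarrow> nat \<Rightarrow> real) \<Rightarrow> nat) \<Rightarrow> ennreal" where
  "type1_error d N \<sigma> \<epsilon> \<phi> =
     (SUP C\<in>adversaries d N \<epsilon>.
        emeasure (observed_law d N \<sigma> (\<lambda>i\<in>{..<d}. 0) C) {x \<in> space (data_space d N). \<phi> x = 1})"

definition alternative :: "nat \<Rightarrow> (nat \<Rightarrow> real) set \<Rightarrow> real \<Rightarrow> (nat \<Rightarrow> real) set" where
  "alternative d K \<rho> = {\<mu> \<in> K. L2_set \<mu> {..<d} \<ge> \<rho>}"

definition type2_error ::
    "nat \<Rightarrow> nat \<Rightarrow> (nat \<Rightarrow> real) set \<Rightarrow> real \<Rightarrow> real \<Rightarrow> real \<Rightarrow> ((nat \<Rightarrow> nat \<Rightarrow> real) \<Rightarrow> nat) \<Rightarrow> ennreal" where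
  "type2_error d N K \<sigma> \<epsilon> \<rho> \<phi> =
     (SUP \<mu>\<in>alternative d K \<rho>. SUP C\<in>adversaries d N \<epsilon>.
        emeasure (observed_law d N \<sigma> \<mu> C) {x \<in> space (data_space d N). \<phi> x = 0})"

end

theory Submission
  imports Defs
begin

text \<open>
  If \<open>D\<^bsub>j-1\<^esub>(K)\<close> is large, then \<open>K\<close> contains a vector \<open>\<theta>\<close> of norm \<open>\<rho>\<close> whose squared entries are at most of
  order \<open>\<rho>\<^sup>2 / j\<close>. Draw the mean uniformly among the sign changes of \<open>\<theta>\<close>. The likelihood ratio of this
  mixture against the null has second moment \<open>V = \<Prod>\<^sub>l cosh (N \<theta>\<^sub>l\<^sup>2 / \<sigma>\<^sup>2)\<close>.

  Without contamination the test needs \<open>V - 1\<close> bounded below, which gives the first term. With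
  contamination, the adversary turns null data into data from the mixture, coupling the samples one
  after the other as well as possible given the past. By the chain rule for the relative entropy, which
  is at most \<open>ln V\<close>, the expected number of replaced samples is of order \<open>\<surd>(N ln V)\<close>, and the
  adversary succeeds if this is small compared with \<open>\<epsilon> N\<close>. The bound \<open>ln V \<le> N\<^sup>2 \<Sum>\<^sub>l \<theta>\<^sub>l\<^sup>4 / \<sigma>\<^sup>4\<close> gives the second
  term and \<open>ln V \<le> N \<rho>\<^sup>2 / \<sigma>\<^sup>2\<close>, valid for every vector of norm \<open>\<rho>\<close>, gives the third.
\<close>

section \<open>Kolmogorov widths of QCO sets\<close>

text \<open>Alternatives may be passed on uncorrupted, so only null data have to be disguised;
  averaging over signs is legitimate because orthosymmetry keeps every sign change in
  \<open>K\<close> with the same norm. Under the mixture the rows share one random mean and are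
  dependent, which is why they are coupled conditionally on the past. The conditional cost of a row
  is a total variation distance; Pinsker's inequality summed over \<open>N\<close> rows would
  produce the square root. Here that root is linearised by a free parameter \<open>\<delta>\<close>,
  fixed only in the final theorem. The coupling controls an expected number of replacements while
  the model imposes a hard limit; Markov's inequality bridges the gap. Spread vectors matter because
  \<open>ln V\<close> is bounded through the largest squared entry times the squared norm: an entry
  bound of order 1 / j cancels the square of the factor sqrt j in the squared width threshold.
  \<open>K\<close> may be neither closed nor bounded, so the extremal argument takes place in a
  compact closure of truncated squares.\<close>

lemma convex_vectorsD:
  "convex_vectors d K \<Longrightarrow> x \<in> K \<Longrightarrow> y \<in> K \<Longrightarrow> 0 \<le> u \<Longrightarrow> 0 \<le> v \<Longrightarrow> u + v = 1 \<Longrightarrow>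
    (\<lambda>i\<in>{..<d}. u * x i + v * y i) \<in> K"
  by (auto simp: convex_vectors_def)

text \<open>Averaging a point with its reflection in one coordinate shrinks that coordinate by any
  factor in [-1, 1] and fixes the others; the coordinates are treated one after the other.
  Truncating, rescaling and taking absolute values then stay inside \<open>K\<close>.\<close>

lemma QCO_solid:
  assumes K: "QCO d K" and x: "x \<in> K" and y: "y \<in> rvectors d"
    and le: "\<And>i. i < d \<Longrightarrow> \<bar>y i\<bar> \<le> \<bar>x i\<bar>"
  shows "y \<in> K"
proof -
  have conv: "convex_vectors d K"
    using K by (simp add: QCO_def)
  have sgn: "(\<lambda>i\<in>{..<d}. \<eta> i * p i) \<in> K" if "p \<in> K" "\<And>i. \<eta> i \<in> {-1, 1}" for p \<eta>
    using K that unfolding QCO_def by blast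
  have ext: "(\<lambda>i\<in>{..<d}. p i) = p" if "p \<in> rvectors d" for p
    using that unfolding rvectors_def by (auto simp: PiE_def extensional_restrict)
  have xr: "x \<in> rvectors d"
    using K x unfolding QCO_def by blast
  have "(\<lambda>i\<in>{..<d}. if i < m then y i else x i) \<in> K" if "m \<le> d" for m
    using that
  proof (induction m)
    case 0
    then show ?case using ext[OF xr] x by simp
  next
    case (Suc m)
    define z where "z = (\<lambda>i\<in>{..<d}. if i < m then y i else x i)"
    define z' where "z' = (\<lambda>i\<in>{..<d}. (if i = m then -1 else 1) * z i)"
    \<comment> \<open>If \<open>x m\<close> is 0 then so is \<open>y m\<close>, and division by zero
      yields \<open>t = 0\<close>; the identity \<open>t * x m = y m\<close> survives.\<close>
    define t where "t = y m / x m"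
    have m: "m < d" using Suc by simp
    have z: "z \<in> K" unfolding z_def by (rule Suc.IH) (use m in simp)
    have z': "z' \<in> K" unfolding z'_def by (rule sgn[OF z]) auto
    have t: "\<bar>t\<bar> \<le> 1" using le[OF m] by (auto simp: t_def abs_divide divide_le_eq_1)
    have tx: "t * x m = y m" using le[OF m] by (auto simp: t_def)
    have "(\<lambda>i\<in>{..<d}. (1 + t) / 2 * z i + (1 - t) / 2 * z' i) \<in> K"
      using t by (intro convex_vectorsD[OF conv] z z') (auto simp: field_simps)
    also have "(\<lambda>i\<in>{..<d}. (1 + t) / 2 * z i + (1 - t) / 2 * z' i)
      = (\<lambda>i\<in>{..<d}. if i < Suc m then y i else x i)"
      using tx by (intro restrict_ext) (auto simp: z_def z'_def field_simps less_Suc_eq)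
    finally show ?case .
  qed
  from this[of d] have "(\<lambda>i\<in>{..<d}. y i) \<in> K"
    by (simp add: restrict_def cong: if_cong)
  then show ?thesis using ext[OF y] by simp
qed

section \<open>Coordinate projections as competitors in the width\<close>

lemma rank_coordinate_projection:
  assumes S: "S \<subseteq> {..<d}"
  shows "vec_space.rank d (mat d d (\<lambda>(i, j). if i = j \<and> i \<in> S then 1 else (0::real))) = card S"
proof -
  interpret vec_space "TYPE(real)" d .
  define P where "P = mat d d (\<lambda>(i, j). if i = j \<and> i \<in> S then 1 else (0::real))"
  have P: "P \<in> carrier_mat d d" by (simp add: P_def)
  have col: "col P j = (if j \<in> S then unit_vec d j else 0\<^sub>v d)" if "j < d" for j
    using that by (intro eq_vecI) (auto simp: P_def unit_vec_def)
  have cols: "set (cols P) = col P ` {..<d}"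
    using P unfolding cols_def by auto
  define U :: "real vec set" where "U = unit_vec d ` S"
  have U: "U \<subseteq> set (cols P)"
    using S col unfolding cols U_def by force
  have U0: "set (cols P) \<subseteq> insert (0\<^sub>v d) U"
    using col unfolding cols U_def by auto
  have inj: "inj_on (unit_vec d :: nat \<Rightarrow> real vec) S"
    using S by (intro inj_onI) (auto simp: subset_eq)
  have "U \<subseteq> set (unit_vecs d)"
    using S by (auto simp: U_def unit_vecs_def)
  then have li: "lin_indpt U"
    using unit_vecs_basis unfolding basis_def by (meson subset_li_is_li)
  \<comment> \<open>The rank is the size of a maximal independent set of columns. A column outside
    \<open>U\<close> is zero, and no independent set contains the zero vector.\<close>
  have "maximal U (\<lambda>T. T \<subseteq> set (cols P) \<and> lin_indpt T)"
    unfolding maximal_def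
  proof (intro conjI allI impI)
    fix T assume T: "U \<subseteq> T \<and> T \<subseteq> set (cols P) \<and> lin_indpt T"
    have "T \<subseteq> carrier_vec d" using T cols_dim[of P] P by auto
    then have "0\<^sub>v d \<notin> T" using T vs_zero_lin_dep by blast
    then show "T = U" using T U0 by auto
  qed (use U li in auto)
  from rank_card_indpt[OF P this] show ?thesis
    using card_image[OF inj] by (simp add: P_def U_def)
qed

text \<open>A single projection bounds the infimum from above. Read backwards: a large width forces,
  for every coordinate set of that size, a vector of \<open>K\<close> with much mass off that
  set.\<close>

lemma kolmogorov_width_le_coordinate:
  assumes S: "S \<subseteq> {..<d}" and b: "\<And>\<theta>. \<theta> \<in> K \<Longrightarrow> (\<Sum>i\<in>{..<d} - S. (\<theta> i)\<^sup>2) \<le> b"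
  shows "kolmogorov_width d K (int (card S)) \<le> ereal (sqrt b)"
proof -
  define P where "P = mat d d (\<lambda>(i, j). if i = j \<and> i \<in> S then 1 else (0::real))"
  have cS: "card S \<le> d" using card_mono[OF _ S] by simp
  have "P * P = P"
  proof (rule eq_matI)
    fix i j assume "i < dim_row P" "j < dim_col P"
    then have ij: "i < d" "j < d" by (auto simp: P_def)
    have "(P * P) $$ (i, j) = (\<Sum>k\<in>{0..<d}. P $$ (i, k) * P $$ (k, j))"
      using ij by (simp add: P_def scalar_prod_def)
    also have "\<dots> = (\<Sum>k\<in>{0..<d}. if k = i then P $$ (i, j) else 0)"
      using ij by (intro sum.cong) (auto simp: P_def)
    finally show "(P * P) $$ (i, j) = P $$ (i, j)" using ij by simp
  qed (auto simp: P_def)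
  moreover have "transpose_mat P = P"
    by (intro eq_matI) (auto simp: P_def)
  ultimately have P: "P \<in> orthogonal_projections d (card S)"
    using rank_coordinate_projection[OF S]
    by (simp add: orthogonal_projections_def P_def)
  have "L2_set (\<lambda>i. \<theta> i - (\<Sum>j<d. P $$ (i, j) * \<theta> j)) {..<d} \<le> sqrt b" if "\<theta> \<in> K" for \<theta>
  proof -
    have "(\<Sum>j<d. P $$ (i, j) * \<theta> j) = (if i \<in> S then \<theta> i else 0)" if "i < d" for i
    proof -
      have "(\<Sum>j<d. P $$ (i, j) * \<theta> j) = (\<Sum>j<d. if j = i then (if i \<in> S then \<theta> i else 0) else 0)"
        using that by (intro sum.cong) (auto simp: P_def)
      then show ?thesis using that by simp
    qed
    then have "(\<Sum>i<d. (\<theta> i - (\<Sum>j<d. P $$ (i, j) * \<theta> j))\<^sup>2) = (\<Sum>i<d. if i \<in> S then 0 else (\<theta> i)\<^sup>2)"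
      by (intro sum.cong) auto
    also have "\<dots> = (\<Sum>i\<in>{..<d} - S. (\<theta> i)\<^sup>2)"
      by (intro sum.mono_neutral_cong_right) auto
    finally show ?thesis using b[OF that] by (simp add: L2_set_def)
  qed
  then have "(SUP \<theta>\<in>K. ereal (L2_set (\<lambda>i. \<theta> i - (\<Sum>j<d. P $$ (i, j) * \<theta> j)) {..<d})) \<le> ereal (sqrt b)"
    by (intro SUP_least) simp
  moreover have "(INF P\<in>orthogonal_projections d (card S).
      SUP \<theta>\<in>K. ereal (L2_set (\<lambda>i. \<theta> i - (\<Sum>j<d. P $$ (i, j) * \<theta> j)) {..<d}))
    \<le> (SUP \<theta>\<in>K. ereal (L2_set (\<lambda>i. \<theta> i - (\<Sum>j<d. P $$ (i, j) * \<theta> j)) {..<d}))"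
    by (rule INF_lower[OF P])
  ultimately show ?thesis
    using cS by (simp add: kolmogorov_width_def)
qed

lemma exists_spread_vector:
  assumes K: "QCO d K" "K \<noteq> {}" and j: "1 \<le> j" "j \<le> d" and a: "0 < a" and B: "0 \<le> B"
    and width: "kolmogorov_width d K (int j - 1) > ereal B"
    and \<beta>: "\<beta> < a * real j" "\<beta> \<le> B\<^sup>2"
  shows "\<exists>\<theta>\<in>K. \<beta> < (\<Sum>i<d. min ((\<theta> i)\<^sup>2) a)"
proof (rule ccontr)
  \<comment> \<open>The functional \<open>t \<mapsto> \<Sum>i<d. min (t i) a\<close> is concave on the squares of \<open>K\<close>. At a maximiser at most
    \<open>j - 1\<close> coordinates are saturated, and first-order optimality bounds the sum of all other squared
    coordinates over \<open>K\<close>, so projecting onto the saturated coordinates contradicts the width bound.\<close>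
  assume "\<not> ?thesis"
  then have F: "(\<Sum>i<d. min ((\<theta> i)\<^sup>2) a) \<le> \<beta>" if "\<theta> \<in> K" for \<theta>
    using that by force
  \<comment> \<open>Capping makes the squares bounded, whatever \<open>K\<close> is; setting them to
    0 beyond \<open>d\<close> gives total functions, to which the product topology on
    \<open>nat \<Rightarrow> real\<close> applies.\<close>
  define A where "A = (\<lambda>\<theta> i. if i < d then min ((\<theta> i)\<^sup>2) a else 0) ` K"
  define G where "G t = (\<Sum>i<d. t i)" for t :: "nat \<Rightarrow> real"
  have GA: "G t \<le> \<beta>" if "t \<in> A" for t
  proof -
    from that obtain \<theta> where \<theta>: "\<theta> \<in> K" and t: "t = (\<lambda>i. if i < d then min ((\<theta> i)\<^sup>2) a else 0)"
      by (auto simp: A_def)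
    show ?thesis using F[OF \<theta>] by (simp add: t G_def)
  qed
  \<comment> \<open>Tychonoff: a cube over all indices is compact, hence so is the closure of
    \<open>A\<close>. The maximum is attained there, but perhaps not in \<open>A\<close>
    itself.\<close>
  define Box where "Box = (\<Pi>\<^sub>E i\<in>(UNIV::nat set). {0..a})"
  have "compactin euclidean Box"
    unfolding Box_def euclidean_product_topology[symmetric]
    by (subst compactin_PiE) auto
  then have Box: "compact Box" by simp
  have coord: "continuous_on X (\<lambda>t. t i)" for X :: "(nat \<Rightarrow> real) set" and i
    by (rule continuous_on_subset[OF continuous_on_product_coordinates]) simp
  have "Box = (\<Inter>i. {t. 0 \<le> t i} \<inter> {t. t i \<le> a})"
    by (auto simp: Box_def PiE_UNIV_domain Pi_iff)
  then have "closed Box"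
    by (auto intro!: closed_INT closed_Int closed_Collect_le coord continuous_on_const)
  moreover have "A \<subseteq> Box"
    using a by (auto simp: A_def Box_def)
  ultimately have AB: "closure A \<subseteq> Box"
    by (rule closure_minimal[rotated])
  have cA: "compact (closure A)"
    using compact_Int_closed[OF Box closed_closure, of A] AB by (simp add: Int_absorb1)
  have contG: "continuous_on X G" for X
    unfolding G_def by (intro continuous_on_sum coord)
  have "closure A \<noteq> {}" using K(2) by (auto simp: A_def)
  from continuous_attains_sup[OF cA this contG]
  obtain t where t: "t \<in> closure A" and tmax: "\<And>s. s \<in> closure A \<Longrightarrow> G s \<le> G t" by blast
  have tB: "0 \<le> t i" "t i \<le> a" for i
    using subsetD[OF AB t] by (auto simp: Box_def PiE_UNIV_domain Pi_iff)
  have Gt: "G t \<le> \<beta>"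
  proof -
    have "closed {s. G s \<le> \<beta>}"
      by (intro closed_Collect_le contG continuous_on_const)
    then have "closure A \<subseteq> {s. G s \<le> \<beta>}"
      by (intro closure_minimal) (use GA in auto)
    then show ?thesis using t by auto
  qed
  \<comment> \<open>Moving the maximiser towards a square of \<open>K\<close> gains nothing. A point
    of \<open>A\<close> is the square of a vector of \<open>K\<close> by solidity, so the mixture is
    again a square by quadratic convexity; the inequality is closed in \<open>t'\<close> and thus
    passes to \<open>t\<close>.\<close>
  have improve: "(\<Sum>i<d. min ((1 - s) * t i + s * (\<theta> i)\<^sup>2) a) \<le> G t"
    if \<theta>: "\<theta> \<in> K" and s: "0 \<le> s" "s \<le> 1" for \<theta> s
  proof -
    have "(\<Sum>i<d. min ((1 - s) * t' i + s * (\<theta> i)\<^sup>2) a) \<le> G t" if "t' \<in> A" for t'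
    proof -
      from that obtain \<psi> where \<psi>: "\<psi> \<in> K" and t': "\<And>i. i < d \<Longrightarrow> t' i = min ((\<psi> i)\<^sup>2) a"
        by (auto simp: A_def)
      define \<zeta> where "\<zeta> = (\<lambda>i\<in>{..<d}. sqrt (t' i))"
      have \<zeta>: "\<zeta> \<in> K"
      proof (rule QCO_solid[OF K(1) \<psi>])
        show "\<bar>\<zeta> i\<bar> \<le> \<bar>\<psi> i\<bar>" if "i < d" for i
        proof -
          have "sqrt (t' i) \<le> sqrt ((\<psi> i)\<^sup>2)" using t'[OF that] by (intro real_sqrt_le_mono) simp
          moreover have "0 \<le> t' i" using t'[OF that] a by simp
          ultimately show ?thesis using that by (simp add: \<zeta>_def)
        qed
      qed (auto simp: \<zeta>_def rvectors_def)
      have sq: "(\<zeta> i)\<^sup>2 = t' i" if "i < d" for i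
        using that t'[OF that] a by (simp add: \<zeta>_def)
      have "convex_vectors d ((\<lambda>\<theta>. \<lambda>i\<in>{..<d}. (\<theta> i)\<^sup>2) ` K)"
        using K(1) by (simp add: QCO_def)
      then have "(\<lambda>i\<in>{..<d}. (1 - s) * (\<lambda>i\<in>{..<d}. (\<zeta> i)\<^sup>2) i + s * (\<lambda>i\<in>{..<d}. (\<theta> i)\<^sup>2) i)
          \<in> (\<lambda>\<theta>. \<lambda>i\<in>{..<d}. (\<theta> i)\<^sup>2) ` K"
        using \<theta> \<zeta> s by (intro convex_vectorsD imageI) auto
      then obtain \<xi> where \<xi>: "\<xi> \<in> K" and eq: "(\<lambda>i\<in>{..<d}. (1 - s) * (\<lambda>i\<in>{..<d}. (\<zeta> i)\<^sup>2) i + s * (\<lambda>i\<in>{..<d}. (\<theta> i)\<^sup>2) i)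
          = (\<lambda>i\<in>{..<d}. (\<xi> i)\<^sup>2)"
        by blast
      have \<xi>2: "(\<xi> i)\<^sup>2 = (1 - s) * t' i + s * (\<theta> i)\<^sup>2" if "i < d" for i
        using fun_cong[OF eq, of i] that sq[OF that] by simp
      have "(\<lambda>i. if i < d then min ((\<xi> i)\<^sup>2) a else 0) \<in> A"
        using \<xi> by (auto simp: A_def)
      then have "G (\<lambda>i. if i < d then min ((\<xi> i)\<^sup>2) a else 0) \<le> G t"
        using tmax closure_subset by blast
      then show ?thesis by (simp add: G_def \<xi>2)
    qed
    moreover have "closed {t'. (\<Sum>i<d. min ((1 - s) * t' i + s * (\<theta> i)\<^sup>2) a) \<le> G t}"
      by (intro closed_Collect_le continuous_on_sum continuous_on_min continuous_on_add
          continuous_on_mult coord continuous_on_const)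
    ultimately have "closure A \<subseteq> {t'. (\<Sum>i<d. min ((1 - s) * t' i + s * (\<theta> i)\<^sup>2) a) \<le> G t}"
      by (intro closure_minimal) auto
    then show ?thesis using t by auto
  qed
  define S where "S = {i. i < d \<and> t i = a}"
  have S: "S \<subseteq> {..<d}" by (auto simp: S_def)
  have split: "(\<Sum>i<d. f i) = (\<Sum>i\<in>S. f i) + (\<Sum>i\<in>{..<d} - S. f i)" for f :: "nat \<Rightarrow> real"
    using sum.subset_diff[OF S] by (simp add: add.commute)
  \<comment> \<open>For small \<open>s\<close> the cap is inactive off \<open>S\<close>, and on
    \<open>S\<close> at least \<open>(1 - s) * a\<close> remains. Comparing with the maximum, the
    terms \<open>(1 - s) * t i\<close> add up to \<open>(1 - s) * G t\<close>, and what is left,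
    divided by \<open>s\<close>, is the claim.\<close>
  have tail: "(\<Sum>i\<in>{..<d} - S. (\<theta> i)\<^sup>2) \<le> G t" if \<theta>: "\<theta> \<in> K" for \<theta>
  proof -
    have "eventually (\<lambda>s. \<forall>i\<in>{..<d} - S. (1 - s) * t i + s * (\<theta> i)\<^sup>2 < a) (at_right 0)"
    proof (intro eventually_ball_finite ballI)
      fix i assume i: "i \<in> {..<d} - S"
      then have "t i < a" using tB[of i] by (auto simp: S_def less_le)
      moreover have "((\<lambda>s. (1 - s) * t i + s * (\<theta> i)\<^sup>2) \<longlongrightarrow> (1 - 0) * t i + 0 * (\<theta> i)\<^sup>2) (at_right 0)"
        by (intro tendsto_intros)
      ultimately show "eventually (\<lambda>s. (1 - s) * t i + s * (\<theta> i)\<^sup>2 < a) (at_right 0)"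
        by (intro order_tendstoD) auto
    qed simp
    moreover have "eventually (\<lambda>s::real. 0 < s \<and> s < 1) (at_right 0)"
      unfolding eventually_at_right_field by (intro exI[of _ 1]) simp
    ultimately have "eventually (\<lambda>s. (\<forall>i\<in>{..<d} - S. (1 - s) * t i + s * (\<theta> i)\<^sup>2 < a) \<and> 0 < s \<and> s < 1) (at_right 0)"
      by eventually_elim auto
    then obtain s where s: "0 < s" "s < 1" and lt: "\<And>i. i \<in> {..<d} - S \<Longrightarrow> (1 - s) * t i + s * (\<theta> i)\<^sup>2 < a"
      using eventually_happens'[OF trivial_limit_at_right_real] by blast
    have "(1 - s) * G t + s * (\<Sum>i\<in>{..<d} - S. (\<theta> i)\<^sup>2)
        = (\<Sum>i\<in>S. (1 - s) * t i) + (\<Sum>i\<in>{..<d} - S. (1 - s) * t i + s * (\<theta> i)\<^sup>2)"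
      unfolding G_def split by (simp add: sum_distrib_left sum.distrib distrib_left)
    also have "\<dots> \<le> (\<Sum>i<d. min ((1 - s) * t i + s * (\<theta> i)\<^sup>2) a)"
      unfolding split
    proof (intro add_mono sum_mono)
      fix i assume "i \<in> S"
      then have "t i = a" by (simp add: S_def)
      then show "(1 - s) * t i \<le> min ((1 - s) * t i + s * (\<theta> i)\<^sup>2) a"
        using s a by (simp add: mult_left_le_one_le)
    next
      fix i assume "i \<in> {..<d} - S"
      from lt[OF this] show "(1 - s) * t i + s * (\<theta> i)\<^sup>2 \<le> min ((1 - s) * t i + s * (\<theta> i)\<^sup>2) a" by simp
    qed
    also have "\<dots> \<le> G t" using improve[OF \<theta>, of s] s by simp
    finally have "s * (\<Sum>i\<in>{..<d} - S. (\<theta> i)\<^sup>2) \<le> s * G t" by (simp add: algebra_simps)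
    then show ?thesis using s by simp
  qed
  have "a * real (card S) = (\<Sum>i\<in>S. t i)" by (simp add: S_def)
  also have "\<dots> \<le> G t" unfolding G_def by (intro sum_mono2 S) (auto simp: tB)
  finally have "a * real (card S) < a * real j" using Gt \<beta>(1) by linarith
  then have "card S \<le> j - 1" using a by simp
  moreover have "j - 1 \<le> card {..<d}" using j by simp
  \<comment> \<open>The width uses projections of rank exactly \<open>j - 1\<close>, so
    \<open>S\<close> is padded to that size; enlarging it only lowers the tail.\<close>
  ultimately obtain S' where S': "S \<subseteq> S'" "S' \<subseteq> {..<d}" "card S' = j - 1"
    using exists_subset_between[of S "j - 1" "{..<d}"] S by auto
  have "kolmogorov_width d K (int (card S')) \<le> ereal (sqrt \<beta>)"
  proof (rule kolmogorov_width_le_coordinate[OF S'(2)])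
    fix \<theta> assume "\<theta> \<in> K"
    have "(\<Sum>i\<in>{..<d} - S'. (\<theta> i)\<^sup>2) \<le> (\<Sum>i\<in>{..<d} - S. (\<theta> i)\<^sup>2)"
      using S' by (intro sum_mono2) auto
    then show "(\<Sum>i\<in>{..<d} - S'. (\<theta> i)\<^sup>2) \<le> \<beta>" using tail[OF \<open>\<theta> \<in> K\<close>] Gt by linarith
  qed
  also have "sqrt \<beta> \<le> B" using real_sqrt_le_mono[OF \<beta>(2)] B by simp
  finally show False using width S'(3) j by (simp add: of_nat_diff)
qed

lemma exists_spread_vector_norm:
  assumes K: "QCO d K" "K \<noteq> {}" and j: "1 \<le> j" "j \<le> d" and B: "0 \<le> B"
    and width: "kolmogorov_width d K (int j - 1) > ereal B"
    and c: "0 < c" "c \<le> 1" and \<rho>: "\<rho>\<^sup>2 < c * B\<^sup>2"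
  shows "\<exists>\<theta>\<in>K. (\<Sum>i<d. (\<theta> i)\<^sup>2) = \<rho>\<^sup>2 \<and> (\<forall>i<d. (\<theta> i)\<^sup>2 \<le> c * B\<^sup>2 / real j)"
proof -
  \<comment> \<open>With this cap \<open>a * real j\<close> equals \<open>c * B\<^sup>2\<close>,
    which exceeds \<open>\<rho>\<^sup>2\<close>; and \<open>c \<le> 1\<close> yields the other
    requirement \<open>\<rho>\<^sup>2 \<le> B\<^sup>2\<close>.\<close>
  define a where "a = c * B\<^sup>2 / real j"
  have "0 < c * B\<^sup>2" using \<rho> zero_le_power2[of \<rho>] by linarith
  then have a: "0 < a" using j by (simp add: a_def)
  have "c * B\<^sup>2 \<le> B\<^sup>2" using c by (simp add: mult_left_le_one_le)
  then obtain \<theta> where \<theta>: "\<theta> \<in> K" and gt: "\<rho>\<^sup>2 < (\<Sum>i<d. min ((\<theta> i)\<^sup>2) a)"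
    using exists_spread_vector[OF K j a B width, of "\<rho>\<^sup>2"] \<rho> j by (auto simp: a_def)
  define F where "F = (\<Sum>i<d. min ((\<theta> i)\<^sup>2) a)"
  \<comment> \<open>Shrinking the capped squares by \<open>l\<close> hits the norm exactly. Capping
    and shrinking only lower the entries, so solidity keeps the vector in \<open>K\<close>.\<close>
  define l where "l = \<rho>\<^sup>2 / F"
  have F: "0 < F" using gt zero_le_power2[of \<rho>] unfolding F_def by linarith
  have l: "0 \<le> l" "l \<le> 1" "l * F = \<rho>\<^sup>2" using F gt by (auto simp: l_def F_def)
  define \<xi> where "\<xi> = (\<lambda>i\<in>{..<d}. sqrt (l * min ((\<theta> i)\<^sup>2) a))"
  have sq: "(\<xi> i)\<^sup>2 = l * min ((\<theta> i)\<^sup>2) a" if "i < d" for i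
    using that l a by (simp add: \<xi>_def)
  have le: "l * min ((\<theta> i)\<^sup>2) a \<le> min ((\<theta> i)\<^sup>2) a" for i
    using l a by (intro mult_left_le_one_le) auto
  have "\<xi> \<in> K"
  proof (rule QCO_solid[OF K(1) \<theta>])
    show "\<bar>\<xi> i\<bar> \<le> \<bar>\<theta> i\<bar>" if "i < d" for i
      using sq[OF that] le[of i] by (simp add: abs_le_square_iff)
  qed (auto simp: \<xi>_def rvectors_def)
  moreover have "(\<Sum>i<d. (\<xi> i)\<^sup>2) = \<rho>\<^sup>2"
    using l(3) by (simp add: sq F_def sum_distrib_left)
  moreover have "(\<xi> i)\<^sup>2 \<le> a" if "i < d" for i
    using sq[OF that] le[of i] by simp
  ultimately show ?thesis unfolding a_def by blast
qed

section \<open>Coupling with a mixture in Hamming distance\<close>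

text \<open>A randomised rule: auxiliary noise \<open>m\<close> is drawn with a density depending on
  \<open>x\<close>, and \<open>G x m\<close> is returned. Probabilities of events are integrals of
  jointly measurable functions, whence measurability in \<open>x\<close>.\<close>

lemma measurable_density_distr_kernel:
  assumes M: "sigma_finite_measure M"
    and f[measurable]: "(\<lambda>(x, m). f x m) \<in> borel_measurable (X \<Otimes>\<^sub>M M)"
    and G[measurable]: "(\<lambda>(x, m). G x m) \<in> X \<Otimes>\<^sub>M M \<rightarrow>\<^sub>M Y"
    and one: "\<And>x. x \<in> space X \<Longrightarrow> (\<integral>\<^sup>+m. f x m \<partial>M) = 1"
  shows "(\<lambda>x. distr (density M (f x)) Y (G x)) \<in> X \<rightarrow>\<^sub>M prob_algebra Y"
proof (rule measurable_prob_algebra_generated[OF sets.sigma_sets_eq[symmetric] sets.Int_stable sets.space_closed])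
  interpret sigma_finite_measure M by fact
  fix x assume x[measurable]: "x \<in> space X"
  have [measurable]: "f x \<in> borel_measurable M" "G x \<in> M \<rightarrow>\<^sub>M Y"
    using measurable_compose[OF measurable_Pair1'[OF x] f] measurable_compose[OF measurable_Pair1'[OF x] G] by auto
  have "prob_space (density M (f x))"
    by (intro prob_spaceI) (simp add: emeasure_density one x cong: nn_integral_cong)
  then show "prob_space (distr (density M (f x)) Y (G x))"
    by (rule prob_space.prob_space_distr) simp
next
  interpret sigma_finite_measure M by fact
  fix A assume A[measurable]: "A \<in> sets Y"
  have "emeasure (distr (density M (f x)) Y (G x)) A = (\<integral>\<^sup>+m. f x m * indicator A (G x m) \<partial>M)" 
    if x: "x \<in> space X" for x
  proof -
    have [measurable]: "f x \<in> borel_measurable M" "G x \<in> M \<rightarrow>\<^sub>M Y"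
      using measurable_compose[OF measurable_Pair1'[OF x] f] measurable_compose[OF measurable_Pair1'[OF x] G] by auto
    show ?thesis
      by (simp add: emeasure_distr emeasure_density)
         (auto intro!: nn_integral_cong simp: indicator_def)
  qed
  then show "(\<lambda>x. emeasure (distr (density M (f x)) Y (G x)) A) \<in> borel_measurable X"
    by (subst measurable_cong) auto
qed simp

text \<open>Overwriting one coordinate by an independent copy preserves the product law, because the
  overwritten value integrates out to 1. In this form a row can be averaged without leaving the
  index set \<open>I\<close>.\<close>

lemma nn_integral_PiM_resample:
  assumes R: "prob_space R" and n: "n \<in> I" "finite I"
    and F[measurable]: "F \<in> borel_measurable (Pi\<^sub>M I (\<lambda>_. R))"
  shows "(\<integral>\<^sup>+x. F x \<partial>Pi\<^sub>M I (\<lambda>_. R)) = (\<integral>\<^sup>+x. \<integral>\<^sup>+w. F (x(n := w)) \<partial>R \<partial>Pi\<^sub>M I (\<lambda>_. R))"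
proof -
  interpret prob_space R by fact
  interpret product_sigma_finite "\<lambda>_. R" ..
  define J where "J = I - {n}"
  have I: "I = insert n J" "n \<notin> J" "finite J" using n by (auto simp: J_def)
  have [measurable]: "(\<lambda>(x, w). x(n := w)) \<in> Pi\<^sub>M I (\<lambda>_. R) \<Otimes>\<^sub>M R \<rightarrow>\<^sub>M Pi\<^sub>M I (\<lambda>_. R)"
    unfolding case_prod_beta by (rule measurable_fun_upd[of _ I]) (use n in auto)
  have FI[measurable]: "F \<in> borel_measurable (Pi\<^sub>M (insert n J) (\<lambda>_. R))" using F by (simp add: I)
  have G: "(\<lambda>x. \<integral>\<^sup>+w. F (x(n := w)) \<partial>R) \<in> borel_measurable (Pi\<^sub>M (insert n J) (\<lambda>_. R))"
    unfolding I(1)[symmetric] by measurable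
  have "(\<integral>\<^sup>+x. \<integral>\<^sup>+w. F (x(n := w)) \<partial>R \<partial>Pi\<^sub>M (insert n J) (\<lambda>_. R))
      = (\<integral>\<^sup>+x. \<integral>\<^sup>+v. \<integral>\<^sup>+w. F (x(n := v, n := w)) \<partial>R \<partial>R \<partial>Pi\<^sub>M J (\<lambda>_. R))"
    by (rule product_nn_integral_insert[OF I(3,2) G])
  also have "\<dots> = (\<integral>\<^sup>+x. \<integral>\<^sup>+w. F (x(n := w)) \<partial>R \<partial>Pi\<^sub>M J (\<lambda>_. R))"
    by (simp add: emeasure_space_1)
  also have "\<dots> = (\<integral>\<^sup>+x. F x \<partial>Pi\<^sub>M (insert n J) (\<lambda>_. R))"
    by (rule product_nn_integral_insert[OF I(3,2) FI, symmetric])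
  finally show ?thesis by (simp add: I(1))
qed

section \<open>Scalar inequalities behind the transport bound\<close>

lemma half_square_le_entropy:
  fixes r :: real
  assumes r: "0 < r" "r \<le> 1"
  shows "(1 - r)\<^sup>2 / 2 \<le> r * ln r - r + 1"
proof -
  \<comment> \<open>The second derivative of \<open>r * ln r\<close> is at least 1 on (0, 1], which
    explains the quadratic bound. The claim amounts to \<open>0 \<le> r * g (1 / r)\<close>, and
    \<open>g\<close> increases from its value 0 at 1.\<close>
  define g where "g y = (y - 1 / y) / 2 - ln y" for y :: real
  have "g 1 \<le> g (1 / r)"
  proof (rule DERIV_nonneg_imp_nondecreasing[where f = g])
    show "1 \<le> 1 / r" using r by simp
    fix y :: real assume y: "1 \<le> y"
    have "(g has_real_derivative (1 + 1 / y\<^sup>2) / 2 - 1 / y) (at y)"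
      unfolding g_def using y
      by (auto intro!: derivative_eq_intros simp: power2_eq_square field_simps)
    moreover have "(1 + 1 / y\<^sup>2) / 2 - 1 / y = (1 - 1 / y)\<^sup>2 / 2"
      using y by (simp add: power2_eq_square field_simps)
    ultimately show "\<exists>D. DERIV g y :> D \<and> 0 \<le> D" by (intro exI[of _ "(1 - 1 / y)\<^sup>2 / 2"]) simp
  qed
  then have "0 \<le> (1 / r - r) / 2 + ln r" using r by (simp add: g_def ln_div)
  then have "0 \<le> r * ((1 / r - r) / 2 + ln r)" using r by simp
  also have "r * ((1 / r - r) / 2 + ln r) = (1 - r * r) / 2 + r * ln r"
    using r by (simp add: algebra_simps)
  finally show ?thesis by (simp add: power2_eq_square field_simps)
qed

text \<open>The bracket is the Bregman divergence of \<open>t ln t\<close>. Along a martingale its expectation telescopes,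
  which gives a transport inequality of Marton type.\<close>

lemma pos_part_diff_le_entropy_diff:
  fixes a b :: real
  assumes a: "0 < a" and b: "0 < b" and l: "0 < \<delta>"
  shows "max 0 (a - b) \<le> \<delta> / 2 * a + (b * ln b - a * ln a - (ln a + 1) * (b - a)) / \<delta>"
proof -
  define r where "r = b / a"
  have r: "0 < r" and br: "b = a * r" using a b by (auto simp: r_def)
  have eq: "b * ln b - a * ln a - (ln a + 1) * (b - a) = a * (r * ln r - r + 1)"
    using a r unfolding br by (simp add: ln_mult algebra_simps)
  \<comment> \<open>The claim is homogeneous in \<open>a\<close> and \<open>b\<close>, so only the
    ratio counts. For \<open>r \<le> 1\<close> the inequality of means with weight
    \<open>\<delta>\<close> turns the quadratic entropy bound into a linear one; for
    \<open>r > 1\<close> the left side is 0 and the entropy is nonnegative.\<close>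
  have "max 0 (1 - r) \<le> \<delta> / 2 + (r * ln r - r + 1) / \<delta>"
  proof (cases "r \<le> 1")
    case True
    have "0 \<le> (\<delta> - (1 - r))\<^sup>2" by simp
    then have "(1 - r) * \<delta> * 2 \<le> \<delta>\<^sup>2 + (1 - r)\<^sup>2" by (simp add: power2_eq_square algebra_simps)
    then have "(1 - r) \<le> \<delta> / 2 + (1 - r)\<^sup>2 / 2 / \<delta>" using l by (simp add: power2_eq_square field_simps)
    also have "\<dots> \<le> \<delta> / 2 + (r * ln r - r + 1) / \<delta>"
      using half_square_le_entropy[OF r True] l by (intro add_left_mono divide_right_mono) auto
    finally show ?thesis using True by simp
  next
    case False
    have "ln (1 / r) \<le> 1 / r - 1" using r by (intro ln_le_minus_one) simp
    then have "r * (1 - 1 / r) \<le> r * ln r" using r by (simp add: ln_div)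
    then have "0 \<le> r * ln r - r + 1" using r by (simp add: algebra_simps)
    then have "0 \<le> \<delta> / 2 + (r * ln r - r + 1) / \<delta>" using l by simp
    then show ?thesis using False by simp
  qed
  then have "a * max 0 (1 - r) \<le> a * (\<delta> / 2 + (r * ln r - r + 1) / \<delta>)" using a by simp
  moreover have "max 0 (a - b) = a * max 0 (1 - r)"
    using a unfolding br by (simp add: max_mult_distrib_left algebra_simps)
  ultimately show ?thesis unfolding eq by (simp add: algebra_simps)
qed

text \<open>Square integrability of the likelihood ratio thereby makes its entropy finite.\<close>

lemma abs_mult_ln_le:
  fixes t :: real
  assumes t: "0 < t"
  shows "\<bar>t * ln t\<bar> \<le> 1 + t\<^sup>2"
proof -
  have "t * ln t \<le> t * (t - 1)" using t ln_le_minus_one[OF t] by (intro mult_left_mono) auto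
  then have "t * ln t \<le> 1 + t\<^sup>2" using t by (simp add: power2_eq_square algebra_simps)
  moreover have "ln (1 / t) \<le> 1 / t - 1" using t by (intro ln_le_minus_one) simp
  then have "t * (- ln t) \<le> t * (1 / t - 1)" using t by (intro mult_left_mono) (auto simp: ln_div)
  then have "- (t * ln t) \<le> 1 - t" using t by (simp add: algebra_simps)
  then have "- (t * ln t) \<le> 1 + t\<^sup>2" using t zero_le_power2[of t] by linarith
  ultimately show ?thesis by (simp add: abs_le_iff)
qed

text \<open>\<open>L n\<close> is the likelihood ratio, with respect to \<open>N\<close> independent rows of law \<open>R\<close>, of the joint law of
  the first \<open>n\<close> rows; it does not depend on the later rows.\<close>

locale likelihood_martingale = prob_space R
  for R :: "'a measure" and N :: nat and L :: "nat \<Rightarrow> (nat \<Rightarrow> 'a) \<Rightarrow> real" +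
  assumes L_measurable: "\<And>n. n \<le> N \<Longrightarrow> L n \<in> borel_measurable (Pi\<^sub>M {..<N} (\<lambda>_. R))"
    and L_pos: "\<And>n x. n \<le> N \<Longrightarrow> x \<in> space (Pi\<^sub>M {..<N} (\<lambda>_. R)) \<Longrightarrow> 0 < L n x"
    and L_0: "\<And>x. x \<in> space (Pi\<^sub>M {..<N} (\<lambda>_. R)) \<Longrightarrow> L 0 x = 1"
    and L_upd: "\<And>n x w. n < N \<Longrightarrow> x \<in> space (Pi\<^sub>M {..<N} (\<lambda>_. R)) \<Longrightarrow> w \<in> space R \<Longrightarrow> L n (x(n := w)) = L n x"
    and L_step: "\<And>n x. n < N \<Longrightarrow> x \<in> space (Pi\<^sub>M {..<N} (\<lambda>_. R)) \<Longrightarrow>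
        (\<integral>\<^sup>+w. ennreal (L (Suc n) (x(n := w))) \<partial>R) = ennreal (L n x)"
    and L_square: "\<And>n. n \<le> N \<Longrightarrow> integrable (Pi\<^sub>M {..<N} (\<lambda>_. R)) (\<lambda>x. (L n x)\<^sup>2)"
    and diagonal: "{p \<in> space (R \<Otimes>\<^sub>M R). fst p = snd p} \<in> sets (R \<Otimes>\<^sub>M R)"
begin

definition \<Omega> where "\<Omega> = Pi\<^sub>M {..<N} (\<lambda>_. R)"

definition hamming :: "(nat \<Rightarrow> 'a) \<Rightarrow> (nat \<Rightarrow> 'a) \<Rightarrow> nat" where
  "hamming x y = card {i\<in>{..<N}. y i \<noteq> x i}"

lemma prob_space_\<Omega>: "prob_space \<Omega>"
  unfolding \<Omega>_def by (intro prob_space_PiM prob_space_axioms)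

lemma nn_integral_resample:
  "n < N \<Longrightarrow> F \<in> borel_measurable \<Omega> \<Longrightarrow> (\<integral>\<^sup>+x. F x \<partial>\<Omega>) = (\<integral>\<^sup>+x. \<integral>\<^sup>+w. F (x(n := w)) \<partial>R \<partial>\<Omega>)"
  unfolding \<Omega>_def by (rule nn_integral_PiM_resample[OF prob_space_axioms]) auto

lemma measurable_upd: "n < N \<Longrightarrow> (\<lambda>(x, w). x(n := w)) \<in> \<Omega> \<Otimes>\<^sub>M R \<rightarrow>\<^sub>M \<Omega>"
  unfolding case_prod_beta \<Omega>_def by (rule measurable_fun_upd[of _ "{..<N}"]) auto

lemma upd_in_space: "n < N \<Longrightarrow> x \<in> space \<Omega> \<Longrightarrow> w \<in> space R \<Longrightarrow> x(n := w) \<in> space \<Omega>"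
  using measurable_space[OF measurable_upd, of n "(x, w)"] by (simp add: space_pair_measure)

lemma hamming_triangle: "hamming x z \<le> hamming x y + hamming y z"
proof -
  have "hamming x z \<le> card ({i\<in>{..<N}. y i \<noteq> x i} \<union> {i\<in>{..<N}. z i \<noteq> y i})"
    unfolding hamming_def by (intro card_mono) auto
  also have "\<dots> \<le> hamming x y + hamming y z"
    unfolding hamming_def by (rule card_Un_le)
  finally show ?thesis .
qed

lemma hamming_self [simp]: "hamming x x = 0"
  by (simp add: hamming_def)

lemma hamming_upd_le: "hamming x (x(n := w)) \<le> 1"
proof -
  have "hamming x (x(n := w)) \<le> card {n}"
    unfolding hamming_def by (intro card_mono) auto
  then show ?thesis by simp
qed

text \<open>The distance is a finite sum of indicators. That two rows agree is a measurable event by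
  \<open>diagonal\<close>, a property that can fail for a general sigma-algebra.\<close>

lemma measurable_hamming: "(\<lambda>(x, y). hamming x y) \<in> \<Omega> \<Otimes>\<^sub>M \<Omega> \<rightarrow>\<^sub>M count_space UNIV"
proof -
  have "Measurable.pred (\<Omega> \<Otimes>\<^sub>M \<Omega>) (\<lambda>p. snd p i = fst p i)" if i: "i < N" for i
  proof -
    have [measurable]: "(\<lambda>p. (snd p i, fst p i)) \<in> \<Omega> \<Otimes>\<^sub>M \<Omega> \<rightarrow>\<^sub>M R \<Otimes>\<^sub>M R"
      using i unfolding \<Omega>_def
      by (intro measurable_Pair measurable_compose[OF measurable_snd measurable_component_singleton]
          measurable_compose[OF measurable_fst measurable_component_singleton]) auto
    have "{p \<in> space (\<Omega> \<Otimes>\<^sub>M \<Omega>). snd p i = fst p i}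
      = (\<lambda>p. (snd p i, fst p i)) -` {p \<in> space (R \<Otimes>\<^sub>M R). fst p = snd p} \<inter> space (\<Omega> \<Otimes>\<^sub>M \<Omega>)"
      using measurable_space[OF \<open>(\<lambda>p. (snd p i, fst p i)) \<in> \<Omega> \<Otimes>\<^sub>M \<Omega> \<rightarrow>\<^sub>M R \<Otimes>\<^sub>M R\<close>] by auto
    then show ?thesis
      using measurable_sets[OF \<open>(\<lambda>p. (snd p i, fst p i)) \<in> \<Omega> \<Otimes>\<^sub>M \<Omega> \<rightarrow>\<^sub>M R \<Otimes>\<^sub>M R\<close> diagonal]
      by (simp only: pred_def)
  qed
  then have [measurable]: "Measurable.pred (\<Omega> \<Otimes>\<^sub>M \<Omega>) (\<lambda>p. snd p i \<noteq> fst p i)" if "i < N" for i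
    using that by measurable
  have "(\<lambda>p. \<Sum>i<N. if snd p i \<noteq> fst p i then 1 else (0::nat)) \<in> \<Omega> \<Otimes>\<^sub>M \<Omega> \<rightarrow>\<^sub>M count_space UNIV"
    by (intro measurable_sum_nat) measurable
  also have "(\<lambda>p. \<Sum>i<N. if snd p i \<noteq> fst p i then 1 else (0::nat)) = (\<lambda>(x, y). hamming x y)"
    by (auto simp: hamming_def sum.If_cases Int_def intro!: ext arg_cong[where f = card])
  finally show ?thesis .
qed


section \<open>Coupling the rows one at a time\<close>

lemma measurable_L [measurable]: "n \<le> N \<Longrightarrow> L n \<in> borel_measurable \<Omega>"
  unfolding \<Omega>_def by (rule L_measurable)

lemma measurable_upd_row: "n < N \<Longrightarrow> x \<in> space \<Omega> \<Longrightarrow> (\<lambda>w. x(n := w)) \<in> R \<rightarrow>\<^sub>M \<Omega>"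
  using measurable_compose[OF measurable_Pair1'[of x \<Omega> R] measurable_upd[of n]] by simp

text \<open>Resampling row \<open>n\<close> averages \<open>L (Suc n)\<close> to \<open>L n\<close>,
  while \<open>h\<close> does not notice the new row.\<close>

lemma nn_integral_L_Suc:
  assumes n: "n < N" and h[measurable]: "h \<in> borel_measurable \<Omega>"
    and inv: "\<And>x w. x \<in> space \<Omega> \<Longrightarrow> w \<in> space R \<Longrightarrow> h (x(n := w)) = h x"
  shows "(\<integral>\<^sup>+x. ennreal (L (Suc n) x) * h x \<partial>\<Omega>) = (\<integral>\<^sup>+x. ennreal (L n x) * h x \<partial>\<Omega>)"
proof -
  have [measurable]: "L (Suc n) \<in> borel_measurable \<Omega>" using n by simp
  have "(\<integral>\<^sup>+x. ennreal (L (Suc n) x) * h x \<partial>\<Omega>)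
      = (\<integral>\<^sup>+x. \<integral>\<^sup>+w. ennreal (L (Suc n) (x(n := w))) * h (x(n := w)) \<partial>R \<partial>\<Omega>)"
    by (rule nn_integral_resample[OF n]) measurable
  also have "\<dots> = (\<integral>\<^sup>+x. ennreal (L n x) * h x \<partial>\<Omega>)"
  proof (rule nn_integral_cong)
    fix x assume x: "x \<in> space \<Omega>"
    note [measurable] = measurable_upd_row[OF n x]
    have "(\<integral>\<^sup>+w. ennreal (L (Suc n) (x(n := w))) * h (x(n := w)) \<partial>R)
        = (\<integral>\<^sup>+w. ennreal (L (Suc n) (x(n := w))) * h x \<partial>R)"
      using inv[OF x] by (intro nn_integral_cong) simp
    also have "\<dots> = (\<integral>\<^sup>+w. ennreal (L (Suc n) (x(n := w))) \<partial>R) * h x"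
      by (rule nn_integral_multc) measurable
    finally show "(\<integral>\<^sup>+w. ennreal (L (Suc n) (x(n := w))) * h (x(n := w)) \<partial>R) = ennreal (L n x) * h x"
      using L_step[OF n, of x] x by (simp add: \<Omega>_def)
  qed
  finally show ?thesis .
qed

lemma one_row_coupling:
  assumes n: "n < N"
  shows "\<exists>A\<in>\<Omega> \<rightarrow>\<^sub>M prob_algebra \<Omega>.
    (\<forall>F\<in>borel_measurable \<Omega>. (\<integral>\<^sup>+x. ennreal (L n x) * (\<integral>\<^sup>+y. F y \<partial>A x) \<partial>\<Omega>) = (\<integral>\<^sup>+x. ennreal (L (Suc n) x) * F x \<partial>\<Omega>)) \<and>
    (\<forall>x\<in>space \<Omega>. (\<integral>\<^sup>+y. of_nat (hamming x y) \<partial>A x) \<le> ennreal (max 0 (1 - L (Suc n) x / L n x)))"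
proof -
  \<comment> \<open>Maximal coupling of row \<open>n\<close> given the earlier rows: keep it with probability \<open>min 1 r\<close>, else redraw
    it from the density proportional to the positive part of \<open>r - 1\<close>. The boolean component of \<open>M\<close> decides.\<close>
  define r where "r x = L (Suc n) x / L n x" for x
  define p where "p x = min 1 (r x)" for x
  define e where "e x = max 0 (r x - 1)" for x
  define T where "T x = (\<integral>\<^sup>+w. ennreal (e (x(n := w))) \<partial>R)" for x
  \<comment> \<open>The value 1 in the absence of excess mass keeps \<open>q x\<close> a density, so
    that \<open>A x\<close> is a probability measure for every \<open>x\<close>; the redraw then
    almost never happens.\<close>
  define q where "q x w = (if T x = 0 then 1 else ennreal (e (x(n := w))) / T x)" for x w
  define M where "M = count_space (UNIV :: bool set) \<Otimes>\<^sub>M R"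
  define f where "f x m = (if fst m then ennreal (p x) else ennreal (1 - p x) * q x (snd m))" for x m
  define G where "G x m = (if fst m then x else x(n := snd m))" for x and m :: "bool \<times> 'a"
  define A where "A x = distr (density M (f x)) \<Omega> (G x)" for x
  have [measurable]: "L (Suc n) \<in> borel_measurable \<Omega>" "L n \<in> borel_measurable \<Omega>" using n by simp_all
  note [measurable] = measurable_upd[OF n]
  have r_m[measurable]: "r \<in> borel_measurable \<Omega>" unfolding r_def by measurable
  have p_m[measurable]: "p \<in> borel_measurable \<Omega>" unfolding p_def by measurable
  have e_m[measurable]: "e \<in> borel_measurable \<Omega>" unfolding e_def by measurable
  have T_m[measurable]: "T \<in> borel_measurable \<Omega>" unfolding T_def by measurable
  have q_m[measurable]: "(\<lambda>(x, w). q x w) \<in> borel_measurable (\<Omega> \<Otimes>\<^sub>M R)" unfolding q_def by measurable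
  have f_m[measurable]: "(\<lambda>(x, m). f x m) \<in> borel_measurable (\<Omega> \<Otimes>\<^sub>M M)" unfolding f_def M_def by measurable
  have G_m[measurable]: "(\<lambda>(x, m). G x m) \<in> \<Omega> \<Otimes>\<^sub>M M \<rightarrow>\<^sub>M \<Omega>"
  proof -
    have "(\<lambda>z. (fst z)(n := snd (snd z))) \<in> \<Omega> \<Otimes>\<^sub>M M \<rightarrow>\<^sub>M \<Omega>"
      using n unfolding \<Omega>_def M_def by (intro measurable_fun_upd[of _ "{..<N}"]) (auto intro: measurable_compose)
    moreover have "Measurable.pred (\<Omega> \<Otimes>\<^sub>M M) (\<lambda>z. fst (snd z))" unfolding M_def by measurable
    ultimately show ?thesis unfolding G_def case_prod_beta by (intro measurable_If) (auto simp: pred_def)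
  qed
  have Lpos: "0 < L n x" "0 < L (Suc n) x" if "x \<in> space \<Omega>" for x
    using L_pos n that by (auto simp: \<Omega>_def)
  have r0: "0 < r x" if "x \<in> space \<Omega>" for x using Lpos[OF that] by (simp add: r_def)
  have p01: "0 \<le> p x" "p x \<le> 1" if "x \<in> space \<Omega>" for x using r0[OF that] by (auto simp: p_def)
  have e0: "0 \<le> e x" for x by (simp add: e_def)
  have pe: "p x + e x = r x" for x by (auto simp: p_def e_def)
  have upd: "x(n := w) \<in> space \<Omega>" if "x \<in> space \<Omega>" "w \<in> space R" for x w
    using upd_in_space[OF n that] .
  have Lupd: "L n (x(n := w)) = L n x" if "x \<in> space \<Omega>" "w \<in> space R" for x w
    using L_upd[OF n] that by (simp add: \<Omega>_def)
  have r1: "(\<integral>\<^sup>+w. ennreal (r (x(n := w))) \<partial>R) = 1" if x: "x \<in> space \<Omega>" for x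
  proof -
    note [measurable] = measurable_upd_row[OF n x]
    have "(\<integral>\<^sup>+w. ennreal (r (x(n := w))) \<partial>R) = (\<integral>\<^sup>+w. ennreal (L (Suc n) (x(n := w))) * ennreal (inverse (L n x)) \<partial>R)"
      using Lupd[OF x] Lpos(2)[OF upd[OF x]]
      by (intro nn_integral_cong) (simp add: r_def divide_inverse ennreal_mult' less_imp_le)
    also have "\<dots> = ennreal (L n x) * ennreal (inverse (L n x))"
      using L_step[OF n, of x] x by (subst nn_integral_multc) (auto simp: \<Omega>_def[symmetric])
    also have "\<dots> = 1" using Lpos[OF x] by (simp flip: ennreal_mult')
    finally show ?thesis .
  qed
  \<comment> \<open>Since \<open>p + e = r\<close> and \<open>r\<close> has conditional mean 1, the
    mass not kept equals the excess mass. Adding the integral of \<open>r\<close> to both sides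
    avoids subtraction in \<open>ennreal\<close>.\<close>
  have T_alt: "(\<integral>\<^sup>+w. ennreal (1 - p (x(n := w))) \<partial>R) = T x" if x: "x \<in> space \<Omega>" for x
  proof -
    note [measurable] = measurable_upd_row[OF n x]
    have "(\<integral>\<^sup>+w. ennreal (1 - p (x(n := w))) \<partial>R) + (\<integral>\<^sup>+w. ennreal (r (x(n := w))) \<partial>R)
        = (\<integral>\<^sup>+w. ennreal (1 - p (x(n := w))) + ennreal (r (x(n := w))) \<partial>R)"
      by (rule nn_integral_add[symmetric]) measurable
    also have "\<dots> = (\<integral>\<^sup>+w. 1 + ennreal (e (x(n := w))) \<partial>R)"
    proof (rule nn_integral_cong)
      fix w assume w: "w \<in> space R"
      have "ennreal (1 - p (x(n := w))) + ennreal (r (x(n := w))) = ennreal (1 - p (x(n := w)) + r (x(n := w)))"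
        using p01[OF upd[OF x w]] r0[OF upd[OF x w]] by (intro ennreal_plus[symmetric]) auto
      also have "1 - p (x(n := w)) + r (x(n := w)) = 1 + e (x(n := w))"
        using pe[of "x(n := w)"] by simp
      also have "ennreal (1 + e (x(n := w))) = 1 + ennreal (e (x(n := w)))"
        using e0 by (simp add: ennreal_plus)
      finally show "ennreal (1 - p (x(n := w))) + ennreal (r (x(n := w))) = 1 + ennreal (e (x(n := w)))" .
    qed
    also have "\<dots> = 1 + T x"
      by (subst nn_integral_add) (auto simp: T_def emeasure_space_1)
    finally show ?thesis
      using r1[OF x] by (simp add: add.commute ennreal_add_left_cancel)
  qed
  have T1: "T x \<le> 1" if x: "x \<in> space \<Omega>" for x
  proof -
    have "(\<integral>\<^sup>+w. ennreal (1 - p (x(n := w))) \<partial>R) \<le> (\<integral>\<^sup>+w. 1 \<partial>R)"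
      using p01[OF upd[OF x]] by (intro nn_integral_mono) simp
    then show ?thesis using T_alt[OF x] by (simp add: emeasure_space_1)
  qed
  then have Tfin: "T x < Orderings.top" if "x \<in> space \<Omega>" for x
    using that by (meson ennreal_one_less_top le_less_trans)
  define K where "K F x = (\<integral>\<^sup>+w. q x w * F (x(n := w)) \<partial>R)" for F x
  \<comment> \<open>Multiplying by \<open>T x\<close> removes the normalisation of \<open>q\<close>,
    and the identity holds even for \<open>T x = 0\<close>, where the excess vanishes almost
    everywhere.\<close>
  have TK: "T x * K F x = (\<integral>\<^sup>+w. ennreal (e (x(n := w))) * F (x(n := w)) \<partial>R)"
    if x: "x \<in> space \<Omega>" and F[measurable]: "F \<in> borel_measurable \<Omega>" for F x
  proof -
    note [measurable] = measurable_upd_row[OF n x]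
    have [measurable]: "q x \<in> borel_measurable R" unfolding q_def by measurable
    show ?thesis
    proof (cases "T x = 0")
      case True
      then have "AE w in R. ennreal (e (x(n := w))) = 0"
        unfolding T_def by (subst (asm) nn_integral_0_iff_AE) auto
      then have "(\<integral>\<^sup>+w. ennreal (e (x(n := w))) * F (x(n := w)) \<partial>R) = 0"
        by (subst nn_integral_0_iff_AE) auto
      then show ?thesis using True by simp
    next
      case False
      have "T x * K F x = (\<integral>\<^sup>+w. T x * (q x w * F (x(n := w))) \<partial>R)"
        unfolding K_def by (rule nn_integral_cmult[symmetric]) measurable
      also have "\<dots> = (\<integral>\<^sup>+w. ennreal (e (x(n := w))) * F (x(n := w)) \<partial>R)"
      proof (rule nn_integral_cong)
        fix w
        have "T x * q x w = ennreal (e (x(n := w)))"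
          using False Tfin[OF x]
          by (simp add: q_def ennreal_times_divide mult.commute[of "T x"] ennreal_mult_divide_eq)
        then show "T x * (q x w * F (x(n := w))) = ennreal (e (x(n := w))) * F (x(n := w))"
          by (simp add: mult.assoc[symmetric])
      qed
      finally show ?thesis .
    qed
  qed
  have q1: "(\<integral>\<^sup>+w. q x w \<partial>R) = 1" if x: "x \<in> space \<Omega>" for x
  proof (cases "T x = 0")
    case True
    then show ?thesis by (simp add: q_def emeasure_space_1)
  next
    case False
    have "T x * K (\<lambda>_. 1) x = T x"
      using TK[OF x, of "\<lambda>_. 1"] by (simp add: T_def)
    then have "K (\<lambda>_. 1) x = 1"
      using False Tfin[OF x] ennreal_mult_cancel_left[of "T x" "K (\<lambda>_. 1) x" 1] by auto
    then show ?thesis by (simp add: K_def)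
  qed
  have M_int: "(\<integral>\<^sup>+m. g m \<partial>M) = (\<integral>\<^sup>+w. g (True, w) \<partial>R) + (\<integral>\<^sup>+w. g (False, w) \<partial>R)"
    if g: "g \<in> borel_measurable M" for g
    using nn_integral_fst[of g "count_space UNIV"] g
    by (simp add: M_def nn_integral_count_space_finite UNIV_bool add.commute)
  have fx_m: "f x \<in> borel_measurable M" and Gx_m: "G x \<in> M \<rightarrow>\<^sub>M \<Omega>" if x: "x \<in> space \<Omega>" for x
    using measurable_compose[OF measurable_Pair1'[OF x] f_m] measurable_compose[OF measurable_Pair1'[OF x] G_m] by auto
  have M_f: "(\<integral>\<^sup>+m. f x m * F (G x m) \<partial>M) = ennreal (p x) * F x + ennreal (1 - p x) * K F x"
    if x: "x \<in> space \<Omega>" and F[measurable]: "F \<in> borel_measurable \<Omega>" for x F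
  proof -
    note [measurable] = measurable_upd_row[OF n x] fx_m[OF x] Gx_m[OF x]
    have [measurable]: "q x \<in> borel_measurable R" unfolding q_def by measurable
    have "(\<lambda>m. f x m * F (G x m)) \<in> borel_measurable M" by measurable
    from M_int[OF this] have "(\<integral>\<^sup>+m. f x m * F (G x m) \<partial>M)
      = (\<integral>\<^sup>+w. ennreal (p x) * F x \<partial>R) + (\<integral>\<^sup>+w. ennreal (1 - p x) * (q x w * F (x(n := w))) \<partial>R)"
      by (simp add: f_def G_def mult.assoc)
    then show ?thesis
      unfolding K_def by (simp add: nn_integral_cmult emeasure_space_1)
  qed
  have "(\<integral>\<^sup>+m. f x m \<partial>M) = 1" if x: "x \<in> space \<Omega>" for x
    using M_f[OF x, of "\<lambda>_. 1"] q1[OF x] p01[OF x]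
    by (simp add: K_def ennreal_plus[symmetric] del: ennreal_plus)
  moreover have "sigma_finite_measure M"
    unfolding M_def
    by (intro sigma_finite_pair_measure sigma_finite_measure_count_space sigma_finite_measure_axioms)
  ultimately have A_m: "A \<in> \<Omega> \<rightarrow>\<^sub>M prob_algebra \<Omega>"
    unfolding A_def using f_m G_m by (intro measurable_density_distr_kernel)
  have A_int: "(\<integral>\<^sup>+y. F y \<partial>A x) = ennreal (p x) * F x + ennreal (1 - p x) * K F x"
    if x: "x \<in> space \<Omega>" and F[measurable]: "F \<in> borel_measurable \<Omega>" for x F
  proof -
    note [measurable] = fx_m[OF x] Gx_m[OF x]
    have "(\<integral>\<^sup>+y. F y \<partial>A x) = (\<integral>\<^sup>+m. f x m * F (G x m) \<partial>M)"
      unfolding A_def by (simp add: nn_integral_distr nn_integral_density)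
    then show ?thesis using M_f[OF x F] by simp
  qed
  have "(\<integral>\<^sup>+x. ennreal (L n x) * (\<integral>\<^sup>+y. F y \<partial>A x) \<partial>\<Omega>) = (\<integral>\<^sup>+x. ennreal (L (Suc n) x) * F x \<partial>\<Omega>)"
    if F[measurable]: "F \<in> borel_measurable \<Omega>" for F
  proof -
    have K_m[measurable]: "K F \<in> borel_measurable \<Omega>" unfolding K_def by measurable
    \<comment> \<open>\<open>T\<close>, \<open>q\<close> and \<open>K F\<close> depend on
      \<open>x\<close> only through the rows other than \<open>n\<close>. Resampling that row
      therefore averages the redraw probability to \<open>T x\<close>, which cancels the
      normalisation and leaves the excess \<open>e\<close>.\<close>
    have T_upd: "T (x(n := w)) = T x" for x w by (simp add: T_def)
    have q_upd: "q (x(n := w)) v = q x v" for x w v unfolding q_def T_upd fun_upd_upd ..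
    have K_upd: "K F (x(n := w)) = K F x" for x w by (simp add: K_def q_upd)
    have "(\<integral>\<^sup>+x. ennreal (L n x) * (\<integral>\<^sup>+y. F y \<partial>A x) \<partial>\<Omega>)
      = (\<integral>\<^sup>+x. ennreal (L n x) * (ennreal (p x) * F x) + ennreal (L n x) * K F x * ennreal (1 - p x) \<partial>\<Omega>)"
      using A_int[OF _ F] by (intro nn_integral_cong) (simp add: algebra_simps)
    also have "\<dots> = (\<integral>\<^sup>+x. ennreal (L n x) * (ennreal (p x) * F x) \<partial>\<Omega>)
        + (\<integral>\<^sup>+x. ennreal (L n x) * K F x * ennreal (1 - p x) \<partial>\<Omega>)"
      by (rule nn_integral_add) measurable
    also have "(\<integral>\<^sup>+x. ennreal (L n x) * K F x * ennreal (1 - p x) \<partial>\<Omega>)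
        = (\<integral>\<^sup>+x. \<integral>\<^sup>+w. ennreal (L n (x(n := w))) * K F (x(n := w)) * ennreal (1 - p (x(n := w))) \<partial>R \<partial>\<Omega>)"
      by (rule nn_integral_resample[OF n]) measurable
    also have "\<dots> = (\<integral>\<^sup>+x. \<integral>\<^sup>+w. ennreal (L n (x(n := w))) * (ennreal (e (x(n := w))) * F (x(n := w))) \<partial>R \<partial>\<Omega>)"
    proof (rule nn_integral_cong)
      fix x assume x: "x \<in> space \<Omega>"
      note [measurable] = measurable_upd_row[OF n x]
      have "(\<integral>\<^sup>+w. ennreal (L n (x(n := w))) * K F (x(n := w)) * ennreal (1 - p (x(n := w))) \<partial>R)
        = (\<integral>\<^sup>+w. ennreal (L n x) * K F x * ennreal (1 - p (x(n := w))) \<partial>R)"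
        using Lupd[OF x] K_upd by (intro nn_integral_cong) simp
      also have "\<dots> = ennreal (L n x) * K F x * T x"
        unfolding T_alt[OF x, symmetric] by (rule nn_integral_cmult) measurable
      also have "\<dots> = ennreal (L n x) * (\<integral>\<^sup>+w. ennreal (e (x(n := w))) * F (x(n := w)) \<partial>R)"
        unfolding TK[OF x F, symmetric] by (simp add: mult_ac)
      also have "\<dots> = (\<integral>\<^sup>+w. ennreal (L n x) * (ennreal (e (x(n := w))) * F (x(n := w))) \<partial>R)"
        by (rule nn_integral_cmult[symmetric]) measurable
      also have "\<dots> = (\<integral>\<^sup>+w. ennreal (L n (x(n := w))) * (ennreal (e (x(n := w))) * F (x(n := w))) \<partial>R)"
        using Lupd[OF x] by (intro nn_integral_cong) simp
      finally show "(\<integral>\<^sup>+w. ennreal (L n (x(n := w))) * K F (x(n := w)) * ennreal (1 - p (x(n := w))) \<partial>R)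
        = (\<integral>\<^sup>+w. ennreal (L n (x(n := w))) * (ennreal (e (x(n := w))) * F (x(n := w))) \<partial>R)" .
    qed
    also have "\<dots> = (\<integral>\<^sup>+x. ennreal (L n x) * (ennreal (e x) * F x) \<partial>\<Omega>)"
      by (rule nn_integral_resample[OF n, symmetric]) measurable
    also have "(\<integral>\<^sup>+x. ennreal (L n x) * (ennreal (p x) * F x) \<partial>\<Omega>) + \<dots>
        = (\<integral>\<^sup>+x. ennreal (L n x) * (ennreal (p x) * F x) + ennreal (L n x) * (ennreal (e x) * F x) \<partial>\<Omega>)"
      by (rule nn_integral_add[symmetric]) measurable
    also have "\<dots> = (\<integral>\<^sup>+x. ennreal (L (Suc n) x) * F x \<partial>\<Omega>)"
    proof (rule nn_integral_cong)
      fix x assume x: "x \<in> space \<Omega>"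
      have "ennreal (L n x) * (ennreal (p x) * F x) + ennreal (L n x) * (ennreal (e x) * F x)
          = ennreal (L n x) * (ennreal (p x) + ennreal (e x)) * F x"
        by (simp add: algebra_simps)
      also have "ennreal (p x) + ennreal (e x) = ennreal (r x)"
        using p01[OF x] e0[of x] pe[of x] by (simp flip: ennreal_plus)
      also have "ennreal (L n x) * ennreal (r x) = ennreal (L (Suc n) x)"
        using Lpos[OF x] by (simp add: r_def flip: ennreal_mult')
      finally show "ennreal (L n x) * (ennreal (p x) * F x) + ennreal (L n x) * (ennreal (e x) * F x)
          = ennreal (L (Suc n) x) * F x" .
    qed
    finally show ?thesis .
  qed
  \<comment> \<open>At most row \<open>n\<close> changes, and only on a redraw, which has
    probability \<open>1 - p x\<close>.\<close>
  moreover have "(\<integral>\<^sup>+y. of_nat (hamming x y) \<partial>A x) \<le> ennreal (max 0 (1 - L (Suc n) x / L n x))"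
    if x: "x \<in> space \<Omega>" for x
  proof -
    have [measurable]: "(\<lambda>y. of_nat (hamming x y) :: ennreal) \<in> borel_measurable \<Omega>"
      using measurable_compose[OF measurable_Pair1'[OF x] measurable_hamming] by simp
    have "K (\<lambda>y. of_nat (hamming x y)) x \<le> (\<integral>\<^sup>+w. q x w \<partial>R)"
      unfolding K_def
    proof (rule nn_integral_mono)
      fix w
      have "(of_nat (hamming x (x(n := w))) :: ennreal) \<le> of_nat 1"
        using hamming_upd_le by (intro of_nat_mono)
      then show "q x w * of_nat (hamming x (x(n := w))) \<le> q x w"
        using mult_left_mono[of _ 1 "q x w"] by fastforce
    qed
    then have "ennreal (1 - p x) * K (\<lambda>y. of_nat (hamming x y)) x \<le> ennreal (1 - p x) * 1"
      unfolding q1[OF x] by (intro mult_left_mono) auto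
    moreover have "max 0 (1 - L (Suc n) x / L n x) = 1 - p x" by (auto simp: p_def r_def)
    ultimately show ?thesis
      using A_int[OF x, of "\<lambda>y. of_nat (hamming x y)"] by simp
  qed
  ultimately show ?thesis using A_m by blast
qed

lemma nn_integral_bind_kernel:
  assumes x: "x \<in> space X" and C: "C \<in> X \<rightarrow>\<^sub>M prob_algebra \<Omega>" and A: "A \<in> \<Omega> \<rightarrow>\<^sub>M prob_algebra \<Omega>"
    and F: "F \<in> borel_measurable \<Omega>"
  shows "(\<integral>\<^sup>+y. F y \<partial>(C x \<bind> A)) = (\<integral>\<^sup>+y. \<integral>\<^sup>+y'. F y' \<partial>A y \<partial>C x)"
proof -
  have "sets (C x) = sets \<Omega>"
    using measurable_space[OF C x] by (simp add: space_prob_algebra)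
  then have "A \<in> C x \<rightarrow>\<^sub>M subprob_algebra \<Omega>"
    using measurable_prob_algebraD[OF A] by (simp cong: measurable_cong_sets)
  from nn_integral_bind[OF F this] show ?thesis .
qed

text \<open>Composing the one-row kernels moves the law of density \<open>L n\<close> to that of
  density \<open>L (Suc n)\<close>. Costs add by the triangle inequality, and since the intermediate
  data carry the weight \<open>L n\<close>, the relative cost of a row becomes a difference.\<close>

lemma iterated_coupling:
  assumes "n \<le> N"
  shows "\<exists>C\<in>\<Omega> \<rightarrow>\<^sub>M prob_algebra \<Omega>.
    (\<forall>F\<in>borel_measurable \<Omega>. (\<integral>\<^sup>+z. \<integral>\<^sup>+y. F y \<partial>C z \<partial>\<Omega>) = (\<integral>\<^sup>+x. ennreal (L n x) * F x \<partial>\<Omega>)) \<and>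
    (\<integral>\<^sup>+z. \<integral>\<^sup>+y. of_nat (hamming z y) \<partial>C z \<partial>\<Omega>) \<le> (\<Sum>m<n. \<integral>\<^sup>+x. ennreal (max 0 (L m x - L (Suc m) x)) \<partial>\<Omega>)"
  using assms
proof (induction n)
  case 0
  have "(\<integral>\<^sup>+z. \<integral>\<^sup>+y. F y \<partial>return \<Omega> z \<partial>\<Omega>) = (\<integral>\<^sup>+x. ennreal (L 0 x) * F x \<partial>\<Omega>)"
    if "F \<in> borel_measurable \<Omega>" for F
    using that L_0 by (intro nn_integral_cong) (simp add: nn_integral_return \<Omega>_def)
  moreover have "(\<integral>\<^sup>+z. \<integral>\<^sup>+y. of_nat (hamming z y) \<partial>return \<Omega> z \<partial>\<Omega>) = (\<integral>\<^sup>+z. 0 \<partial>\<Omega>)"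
  proof (rule nn_integral_cong)
    fix z assume z: "z \<in> space \<Omega>"
    have "(\<lambda>y. of_nat (hamming z y) :: ennreal) \<in> borel_measurable \<Omega>"
      using measurable_compose[OF measurable_Pair1'[OF z] measurable_hamming] by simp
    then show "(\<integral>\<^sup>+y. of_nat (hamming z y) \<partial>return \<Omega> z) = 0"
      using z by (simp add: nn_integral_return)
  qed
  ultimately show ?case
    by (intro bexI[of _ "return \<Omega>"]) auto
next
  case (Suc n)
  then have n: "n < N" by simp
  from Suc obtain C where C_m: "C \<in> \<Omega> \<rightarrow>\<^sub>M prob_algebra \<Omega>"
    and C_int: "\<And>F. F \<in> borel_measurable \<Omega> \<Longrightarrow> (\<integral>\<^sup>+z. \<integral>\<^sup>+y. F y \<partial>C z \<partial>\<Omega>) = (\<integral>\<^sup>+x. ennreal (L n x) * F x \<partial>\<Omega>)"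
    and C_ham: "(\<integral>\<^sup>+z. \<integral>\<^sup>+y. of_nat (hamming z y) \<partial>C z \<partial>\<Omega>) \<le> (\<Sum>m<n. \<integral>\<^sup>+x. ennreal (max 0 (L m x - L (Suc m) x)) \<partial>\<Omega>)"
    using Suc.IH[OF less_imp_le[OF n]] by blast
  from one_row_coupling[OF n] obtain A where A_m: "A \<in> \<Omega> \<rightarrow>\<^sub>M prob_algebra \<Omega>"
    and A_int: "\<And>F. F \<in> borel_measurable \<Omega> \<Longrightarrow> (\<integral>\<^sup>+x. ennreal (L n x) * (\<integral>\<^sup>+y. F y \<partial>A x) \<partial>\<Omega>) = (\<integral>\<^sup>+x. ennreal (L (Suc n) x) * F x \<partial>\<Omega>)"
    and A_ham: "\<And>x. x \<in> space \<Omega> \<Longrightarrow> (\<integral>\<^sup>+y. of_nat (hamming x y) \<partial>A x) \<le> ennreal (max 0 (1 - L (Suc n) x / L n x))"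
    by blast
  note [measurable] = measurable_prob_algebraD[OF C_m] measurable_prob_algebraD[OF A_m]
  have A_sub: "A \<in> \<Omega> \<rightarrow>\<^sub>M subprob_algebra \<Omega>" and C_sub: "C \<in> \<Omega> \<rightarrow>\<^sub>M subprob_algebra \<Omega>" by measurable
  have sets_C: "sets (C x) = sets \<Omega>" "prob_space (C x)" if "x \<in> space \<Omega>" for x
    using measurable_space[OF C_m that] by (simp_all add: space_prob_algebra)
  have sets_A: "sets (A x) = sets \<Omega>" "prob_space (A x)" if "x \<in> space \<Omega>" for x
    using measurable_space[OF A_m that] by (simp_all add: space_prob_algebra)
  have int_A[measurable]: "(\<lambda>x. \<integral>\<^sup>+y. F y \<partial>A x) \<in> borel_measurable \<Omega>" if [measurable]: "F \<in> borel_measurable \<Omega>" for F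
    using nn_integral_measurable_subprob_algebra2[OF _ A_sub, of "\<lambda>_. F"] by simp
  have ham[measurable]: "(\<lambda>(x, y). of_nat (hamming x y) :: ennreal) \<in> borel_measurable (\<Omega> \<Otimes>\<^sub>M \<Omega>)"
    using measurable_compose[OF measurable_hamming, of of_nat "borel :: ennreal measure"] by (simp add: case_prod_beta)
  have ham1: "(\<lambda>y. of_nat (hamming x y) :: ennreal) \<in> borel_measurable \<Omega>" if "x \<in> space \<Omega>" for x
    using measurable_compose[OF measurable_Pair1'[OF that] ham] by simp
  define h where "h x = (\<integral>\<^sup>+y. of_nat (hamming x y) \<partial>A x)" for x
  have h_m[measurable]: "h \<in> borel_measurable \<Omega>"
    unfolding h_def by (rule nn_integral_measurable_subprob_algebra2[OF ham A_sub])
  have hC_m[measurable]: "(\<lambda>z. \<integral>\<^sup>+y. of_nat (hamming z y) \<partial>C z) \<in> borel_measurable \<Omega>"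
    by (rule nn_integral_measurable_subprob_algebra2[OF ham C_sub])
  have hC2_m[measurable]: "(\<lambda>z. \<integral>\<^sup>+y. h y \<partial>C z) \<in> borel_measurable \<Omega>"
    using nn_integral_measurable_subprob_algebra2[OF _ C_sub, of "\<lambda>_. h"] by simp
  have "(\<integral>\<^sup>+z. \<integral>\<^sup>+y. F y \<partial>(C z \<bind> A) \<partial>\<Omega>) = (\<integral>\<^sup>+x. ennreal (L (Suc n) x) * F x \<partial>\<Omega>)"
    if F[measurable]: "F \<in> borel_measurable \<Omega>" for F
  proof -
    have "(\<integral>\<^sup>+z. \<integral>\<^sup>+y. F y \<partial>(C z \<bind> A) \<partial>\<Omega>) = (\<integral>\<^sup>+z. \<integral>\<^sup>+y. \<integral>\<^sup>+y'. F y' \<partial>A y \<partial>C z \<partial>\<Omega>)"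
      by (intro nn_integral_cong nn_integral_bind_kernel[OF _ C_m A_m F])
    also have "\<dots> = (\<integral>\<^sup>+x. ennreal (L n x) * (\<integral>\<^sup>+y. F y \<partial>A x) \<partial>\<Omega>)"
      by (rule C_int) measurable
    finally show ?thesis using A_int[OF F] by simp
  qed
  moreover have "(\<integral>\<^sup>+z. \<integral>\<^sup>+y. of_nat (hamming z y) \<partial>(C z \<bind> A) \<partial>\<Omega>)
      \<le> (\<Sum>m<Suc n. \<integral>\<^sup>+x. ennreal (max 0 (L m x - L (Suc m) x)) \<partial>\<Omega>)"
  proof -
    have "(\<integral>\<^sup>+z. \<integral>\<^sup>+y. of_nat (hamming z y) \<partial>(C z \<bind> A) \<partial>\<Omega>)
      \<le> (\<integral>\<^sup>+z. (\<integral>\<^sup>+y. of_nat (hamming z y) \<partial>C z) + (\<integral>\<^sup>+y. h y \<partial>C z) \<partial>\<Omega>)"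
    proof (rule nn_integral_mono)
      fix z assume z: "z \<in> space \<Omega>"
      have [measurable]: "(\<lambda>y. of_nat (hamming z y) :: ennreal) \<in> borel_measurable (C z)" "h \<in> borel_measurable (C z)"
        using ham1[OF z] h_m by (simp_all add: measurable_cong_sets[OF sets_C(1)[OF z] refl])
      have spC: "space (C z) = space \<Omega>" using sets_C(1)[OF z] by (rule sets_eq_imp_space_eq)
      have "(\<integral>\<^sup>+y. of_nat (hamming z y) \<partial>(C z \<bind> A)) = (\<integral>\<^sup>+y. \<integral>\<^sup>+y'. of_nat (hamming z y') \<partial>A y \<partial>C z)"
        by (rule nn_integral_bind_kernel[OF z C_m A_m ham1[OF z]])
      also have "\<dots> \<le> (\<integral>\<^sup>+y. of_nat (hamming z y) + h y \<partial>C z)"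
      proof (rule nn_integral_mono)
        fix y assume "y \<in> space (C z)"
        then have y: "y \<in> space \<Omega>" by (simp add: spC)
        interpret Ay: prob_space "A y" by (rule sets_A(2)[OF y])
        have [measurable]: "(\<lambda>y'. of_nat (hamming y y') :: ennreal) \<in> borel_measurable (A y)"
          using ham1[OF y] by (simp add: measurable_cong_sets[OF sets_A(1)[OF y] refl])
        have "(\<integral>\<^sup>+y'. of_nat (hamming z y') \<partial>A y) \<le> (\<integral>\<^sup>+y'. of_nat (hamming z y) + of_nat (hamming y y') \<partial>A y)"
          using hamming_triangle by (intro nn_integral_mono) (simp flip: of_nat_add)
        also have "\<dots> = of_nat (hamming z y) + h y"
          by (subst nn_integral_add) (auto simp: h_def Ay.emeasure_space_1)
        finally show "(\<integral>\<^sup>+y'. of_nat (hamming z y') \<partial>A y) \<le> of_nat (hamming z y) + h y" .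
      qed
      also have "\<dots> = (\<integral>\<^sup>+y. of_nat (hamming z y) \<partial>C z) + (\<integral>\<^sup>+y. h y \<partial>C z)"
        by (rule nn_integral_add) measurable
      finally show "(\<integral>\<^sup>+y. of_nat (hamming z y) \<partial>(C z \<bind> A)) \<le> (\<integral>\<^sup>+y. of_nat (hamming z y) \<partial>C z) + (\<integral>\<^sup>+y. h y \<partial>C z)" .
    qed
    also have "\<dots> = (\<integral>\<^sup>+z. \<integral>\<^sup>+y. of_nat (hamming z y) \<partial>C z \<partial>\<Omega>) + (\<integral>\<^sup>+z. \<integral>\<^sup>+y. h y \<partial>C z \<partial>\<Omega>)"
      by (rule nn_integral_add) measurable
    also have "(\<integral>\<^sup>+z. \<integral>\<^sup>+y. h y \<partial>C z \<partial>\<Omega>) = (\<integral>\<^sup>+x. ennreal (L n x) * h x \<partial>\<Omega>)"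
      by (rule C_int) measurable
    also have "\<dots> \<le> (\<integral>\<^sup>+x. ennreal (max 0 (L n x - L (Suc n) x)) \<partial>\<Omega>)"
    proof (rule nn_integral_mono)
      fix x assume x: "x \<in> space \<Omega>"
      then have p: "0 < L n x" using L_pos[of n x] n by (simp add: \<Omega>_def)
      have "ennreal (L n x) * h x \<le> ennreal (L n x) * ennreal (max 0 (1 - L (Suc n) x / L n x))"
        unfolding h_def by (intro mult_left_mono A_ham x) simp
      also have "\<dots> = ennreal (L n x * max 0 (1 - L (Suc n) x / L n x))"
        using p by (simp add: ennreal_mult')
      also have "L n x * max 0 (1 - L (Suc n) x / L n x) = max 0 (L n x - L (Suc n) x)"
        using p by (simp add: max_mult_distrib_left right_diff_distrib)
      finally show "ennreal (L n x) * h x \<le> ennreal (max 0 (L n x - L (Suc n) x))" .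
    qed
    also have "(\<integral>\<^sup>+z. \<integral>\<^sup>+y. of_nat (hamming z y) \<partial>C z \<partial>\<Omega>) + (\<integral>\<^sup>+x. ennreal (max 0 (L n x - L (Suc n) x)) \<partial>\<Omega>)
      \<le> (\<Sum>m<n. \<integral>\<^sup>+x. ennreal (max 0 (L m x - L (Suc m) x)) \<partial>\<Omega>) + (\<integral>\<^sup>+x. ennreal (max 0 (L n x - L (Suc n) x)) \<partial>\<Omega>)"
      by (intro add_right_mono C_ham)
    finally show ?thesis by simp
  qed
  ultimately show ?case
    using measurable_bind_prob_space[OF C_m A_m] by (intro bexI[of _ "\<lambda>z. C z \<bind> A"]) auto
qed

section \<open>Entropy along the martingale\<close>

lemma nn_integral_L: "n \<le> N \<Longrightarrow> (\<integral>\<^sup>+x. ennreal (L n x) \<partial>\<Omega>) = 1"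
proof (induction n)
  case 0
  interpret \<Omega>: prob_space \<Omega> by (rule prob_space_\<Omega>)
  have "(\<integral>\<^sup>+x. ennreal (L 0 x) \<partial>\<Omega>) = (\<integral>\<^sup>+x. 1 \<partial>\<Omega>)"
    using L_0 by (intro nn_integral_cong) (simp add: \<Omega>_def)
  then show ?case by (simp add: \<Omega>.emeasure_space_1)
next
  case (Suc n)
  then show ?case using nn_integral_L_Suc[of n "\<lambda>_. 1"] by simp
qed

lemma AE_L_pos: "n \<le> N \<Longrightarrow> AE x in \<Omega>. 0 < L n x"
  using L_pos by (intro AE_I2) (simp add: \<Omega>_def)

lemma integral_L:
  assumes "n \<le> N"
  shows "integrable \<Omega> (L n)" "(\<integral>x. L n x \<partial>\<Omega>) = 1"
proof -
  have "AE x in \<Omega>. 0 \<le> L n x" using AE_L_pos[OF assms] by eventually_elim simp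
  then show "integrable \<Omega> (L n)" "(\<integral>x. L n x \<partial>\<Omega>) = 1"
    using nn_integral_L[OF assms] assms
    by (auto intro!: integrableI_nonneg simp: integral_eq_nn_integral)
qed

lemma integral_L_square: "n \<le> N \<Longrightarrow> integrable \<Omega> (\<lambda>x. (L n x)\<^sup>2)"
  unfolding \<Omega>_def by (rule L_square)

lemma integrable_L_ln_L:
  assumes n: "n \<le> N"
  shows "integrable \<Omega> (\<lambda>x. L n x * ln (L n x))"
proof (rule Bochner_Integration.integrable_bound)
  interpret \<Omega>: prob_space \<Omega> by (rule prob_space_\<Omega>)
  show "integrable \<Omega> (\<lambda>x. 1 + (L n x)\<^sup>2)" using integral_L_square[OF n] by simp
  show "AE x in \<Omega>. norm (L n x * ln (L n x)) \<le> norm (1 + (L n x)\<^sup>2)"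
    using AE_L_pos[OF n] by eventually_elim (use abs_mult_ln_le in auto)
qed (use n in measurable)

text \<open>This is the martingale property against \<open>ln (L n)\<close>, which does not depend
  on row \<open>n\<close>. As the logarithm changes sign, positive and negative parts are treated
  separately.\<close>

lemma L_Suc_ln_L:
  assumes n: "n < N"
  shows "integrable \<Omega> (\<lambda>x. L (Suc n) x * ln (L n x))"
    and "(\<integral>x. L (Suc n) x * ln (L n x) \<partial>\<Omega>) = (\<integral>x. L n x * ln (L n x) \<partial>\<Omega>)"
proof -
  have [measurable]: "L (Suc n) \<in> borel_measurable \<Omega>" "L n \<in> borel_measurable \<Omega>" using n by auto
  have inv: "L n (x(n := w)) = L n x" if "x \<in> space \<Omega>" "w \<in> space R" for x w
    using L_upd[OF n] that by (simp add: \<Omega>_def)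
  have pos: "0 < L n x" "0 < L (Suc n) x" if "x \<in> space \<Omega>" for x
    using L_pos n that by (auto simp: \<Omega>_def)
  \<comment> \<open>\<open>ennreal\<close> truncates negative reals to 0, so \<open>g = ln\<close>
    and its negative yield exactly the two parts in the definition of the Lebesgue integral.\<close>
  have eq: "(\<integral>\<^sup>+x. ennreal (L (Suc n) x * g (L n x)) \<partial>\<Omega>) = (\<integral>\<^sup>+x. ennreal (L n x * g (L n x)) \<partial>\<Omega>)"
    if [measurable]: "g \<in> borel_measurable borel" for g :: "real \<Rightarrow> real"
  proof -
    have "(\<integral>\<^sup>+x. ennreal (L (Suc n) x * g (L n x)) \<partial>\<Omega>) = (\<integral>\<^sup>+x. ennreal (L (Suc n) x) * ennreal (g (L n x)) \<partial>\<Omega>)"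
      using pos by (intro nn_integral_cong) (simp add: ennreal_mult' less_imp_le)
    also have "\<dots> = (\<integral>\<^sup>+x. ennreal (L n x) * ennreal (g (L n x)) \<partial>\<Omega>)"
      using inv by (intro nn_integral_L_Suc[OF n]) auto
    also have "\<dots> = (\<integral>\<^sup>+x. ennreal (L n x * g (L n x)) \<partial>\<Omega>)"
      using pos by (intro nn_integral_cong) (simp add: ennreal_mult' less_imp_le)
    finally show ?thesis .
  qed
  have int: "integrable \<Omega> (\<lambda>x. L n x * ln (L n x))" using integrable_L_ln_L[of n] n by simp
  show int_Suc: "integrable \<Omega> (\<lambda>x. L (Suc n) x * ln (L n x))"
  proof (rule integrableI_bounded)
    have "(\<integral>\<^sup>+x. ennreal (norm (L (Suc n) x * ln (L n x))) \<partial>\<Omega>) = (\<integral>\<^sup>+x. ennreal (L (Suc n) x * \<bar>ln (L n x)\<bar>) \<partial>\<Omega>)"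
      using pos by (intro nn_integral_cong) (simp add: abs_mult abs_of_pos)
    also have "\<dots> = (\<integral>\<^sup>+x. ennreal (L n x * \<bar>ln (L n x)\<bar>) \<partial>\<Omega>)"
      by (rule eq) measurable
    also have "\<dots> = (\<integral>\<^sup>+x. ennreal (norm (L n x * ln (L n x))) \<partial>\<Omega>)"
      using pos by (intro nn_integral_cong) (simp add: abs_mult abs_of_pos)
    also have "\<dots> < \<infinity>" using int by (simp add: integrable_iff_bounded)
    finally show "(\<integral>\<^sup>+x. ennreal (norm (L (Suc n) x * ln (L n x))) \<partial>\<Omega>) < \<infinity>" .
  qed measurable
  show "(\<integral>x. L (Suc n) x * ln (L n x) \<partial>\<Omega>) = (\<integral>x. L n x * ln (L n x) \<partial>\<Omega>)"
    unfolding real_lebesgue_integral_def[OF int_Suc] real_lebesgue_integral_def[OF int]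
    using eq[of ln] eq[of "\<lambda>t. - ln t"] by simp
qed

text \<open>The scalar inequality is integrated with \<open>a = L n x\<close> and
  \<open>b = L (Suc n) x\<close>. The cross term and the difference of means vanish by the
  martingale property, so only the increment of the entropy remains.\<close>

lemma expected_decrease_le:
  assumes n: "n < N" and \<delta>: "0 < \<delta>"
  shows "(\<integral>x. max 0 (L n x - L (Suc n) x) \<partial>\<Omega>)
    \<le> \<delta> / 2 + ((\<integral>x. L (Suc n) x * ln (L (Suc n) x) \<partial>\<Omega>) - (\<integral>x. L n x * ln (L n x) \<partial>\<Omega>)) / \<delta>"
proof -
  have [measurable]: "L (Suc n) \<in> borel_measurable \<Omega>" "L n \<in> borel_measurable \<Omega>" using n by auto
  have int [simp]: "integrable \<Omega> (L n)" "integrable \<Omega> (L (Suc n))"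
    "integrable \<Omega> (\<lambda>x. L n x * ln (L n x))" "integrable \<Omega> (\<lambda>x. L (Suc n) x * ln (L (Suc n) x))"
    "integrable \<Omega> (\<lambda>x. L (Suc n) x * ln (L n x))"
    using n integral_L integrable_L_ln_L L_Suc_ln_L by auto
  have "(\<integral>x. max 0 (L n x - L (Suc n) x) \<partial>\<Omega>)
    \<le> (\<integral>x. \<delta> / 2 * L n x + ((L (Suc n) x * ln (L (Suc n) x) - L n x * ln (L n x))
          - (L (Suc n) x * ln (L n x) - L n x * ln (L n x)) - (L (Suc n) x - L n x)) / \<delta> \<partial>\<Omega>)"
  proof (rule integral_mono_AE)
    show "AE x in \<Omega>. max 0 (L n x - L (Suc n) x) \<le> \<delta> / 2 * L n x + ((L (Suc n) x * ln (L (Suc n) x) - L n x * ln (L n x))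
          - (L (Suc n) x * ln (L n x) - L n x * ln (L n x)) - (L (Suc n) x - L n x)) / \<delta>"
      using AE_L_pos[OF less_imp_le[OF n]] AE_L_pos[OF Suc_leI[OF n]]
    proof eventually_elim
      case (elim x)
      have "(L (Suc n) x * ln (L (Suc n) x) - L n x * ln (L n x))
          - (L (Suc n) x * ln (L n x) - L n x * ln (L n x)) - (L (Suc n) x - L n x)
        = L (Suc n) x * ln (L (Suc n) x) - L n x * ln (L n x) - (ln (L n x) + 1) * (L (Suc n) x - L n x)"
        by (simp add: algebra_simps)
      with pos_part_diff_le_entropy_diff[OF elim \<delta>] show ?case by (simp only:)
    qed
  qed auto
  also have "\<dots> = \<delta> / 2 + ((\<integral>x. L (Suc n) x * ln (L (Suc n) x) \<partial>\<Omega>) - (\<integral>x. L n x * ln (L n x) \<partial>\<Omega>)) / \<delta>"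
    using integral_L(2)[of n] integral_L(2)[of "Suc n"] L_Suc_ln_L(2)[OF n] n by simp
  finally show ?thesis .
qed

text \<open>Jensen's inequality for the logarithm under the law of density \<open>L N\<close>,
  proved by the tangent of \<open>ln\<close> at \<open>V\<close>.\<close>

lemma entropy_le:
  assumes V: "0 < V" "(\<integral>x. (L N x)\<^sup>2 \<partial>\<Omega>) \<le> V"
  shows "(\<integral>x. L N x * ln (L N x) \<partial>\<Omega>) \<le> ln V"
proof -
  have int [simp]: "integrable \<Omega> (L N)" "integrable \<Omega> (\<lambda>x. (L N x)\<^sup>2)" "integrable \<Omega> (\<lambda>x. L N x * ln (L N x))"
    using integral_L integral_L_square integrable_L_ln_L by auto
  have "(\<integral>x. L N x * ln (L N x) \<partial>\<Omega>) \<le> (\<integral>x. (L N x)\<^sup>2 / V - L N x + L N x * ln V \<partial>\<Omega>)"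
  proof (rule integral_mono_AE)
    have "t * ln t \<le> t\<^sup>2 / V - t + t * ln V" if t: "0 < t" for t
    proof -
      have "ln (t / V) \<le> t / V - 1" using t V by (intro ln_le_minus_one) simp
      then have "t * ln (t / V) \<le> t * (t / V - 1)" using t by (intro mult_left_mono) auto
      then show ?thesis using t V by (simp add: ln_div power2_eq_square algebra_simps)
    qed
    then show "AE x in \<Omega>. L N x * ln (L N x) \<le> (L N x)\<^sup>2 / V - L N x + L N x * ln V"
      using AE_L_pos[of N] by (auto elim!: eventually_mono)
  qed auto
  also have "\<dots> = (\<integral>x. (L N x)\<^sup>2 \<partial>\<Omega>) / V - 1 + ln V"
    using integral_L(2)[of N] by simp
  also have "\<dots> \<le> ln V" using V by (simp add: divide_le_eq_1)
  finally show ?thesis .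
qed

text \<open>The entropy increments telescope from \<open>L 0 = 1\<close>. For \<open>V > 1\<close>,
  the best \<open>\<delta>\<close> would turn the bound into the square root of
  \<open>2 * real N * ln V\<close>; it is left free.\<close>

lemma hamming_coupling:
  assumes \<delta>: "0 < \<delta>" and V: "0 < V" "(\<integral>x. (L N x)\<^sup>2 \<partial>\<Omega>) \<le> V"
  shows "\<exists>C\<in>\<Omega> \<rightarrow>\<^sub>M prob_algebra \<Omega>.
    (\<forall>F\<in>borel_measurable \<Omega>. (\<integral>\<^sup>+z. \<integral>\<^sup>+y. F y \<partial>C z \<partial>\<Omega>) = (\<integral>\<^sup>+x. ennreal (L N x) * F x \<partial>\<Omega>)) \<and>
    (\<integral>\<^sup>+z. \<integral>\<^sup>+y. of_nat (hamming z y) \<partial>C z \<partial>\<Omega>) \<le> ennreal (real N * \<delta> / 2 + ln V / \<delta>)"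
proof -
  define D where "D n = (\<integral>x. L n x * ln (L n x) \<partial>\<Omega>)" for n
  have le: "(\<integral>x. max 0 (L m x - L (Suc m) x) \<partial>\<Omega>) \<le> \<delta> / 2 + (D (Suc m) - D m) / \<delta>" if "m < N" for m
    using expected_decrease_le[OF that \<delta>] by (simp add: D_def)
  have nonneg: "0 \<le> \<delta> / 2 + (D (Suc m) - D m) / \<delta>" if "m < N" for m
    by (rule order_trans[OF _ le[OF that]]) simp
  have D0: "D 0 = 0"
  proof -
    have "D 0 = (\<integral>x. 0 \<partial>\<Omega>)"
      unfolding D_def using L_0 by (intro Bochner_Integration.integral_cong) (auto simp: \<Omega>_def)
    then show ?thesis by simp
  qed
  have "(\<Sum>m<N. \<integral>\<^sup>+x. ennreal (max 0 (L m x - L (Suc m) x)) \<partial>\<Omega>)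
    \<le> (\<Sum>m<N. ennreal (\<delta> / 2 + (D (Suc m) - D m) / \<delta>))"
  proof (rule sum_mono)
    fix m assume "m \<in> {..<N}"
    then have m: "m < N" by simp
    have "(\<integral>\<^sup>+x. ennreal (max 0 (L m x - L (Suc m) x)) \<partial>\<Omega>) = ennreal (\<integral>x. max 0 (L m x - L (Suc m) x) \<partial>\<Omega>)"
      using m integral_L(1) by (intro nn_integral_eq_integral) auto
    then show "(\<integral>\<^sup>+x. ennreal (max 0 (L m x - L (Suc m) x)) \<partial>\<Omega>) \<le> ennreal (\<delta> / 2 + (D (Suc m) - D m) / \<delta>)"
      using le[OF m] by (simp add: ennreal_leI)
  qed
  also have "\<dots> = ennreal (\<Sum>m<N. \<delta> / 2 + (D (Suc m) - D m) / \<delta>)"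
    using nonneg by (intro sum_ennreal) auto
  also have "(\<Sum>m<N. \<delta> / 2 + (D (Suc m) - D m) / \<delta>) = real N * \<delta> / 2 + D N / \<delta>"
    using sum_lessThan_telescope[of D N] by (simp add: sum.distrib sum_divide_distrib[symmetric] D0)
  also have "ennreal (real N * \<delta> / 2 + D N / \<delta>) \<le> ennreal (real N * \<delta> / 2 + ln V / \<delta>)"
    using entropy_le[OF V] \<delta> by (intro ennreal_leI add_left_mono divide_right_mono) (auto simp: D_def)
  finally have le_N: "(\<Sum>m<N. \<integral>\<^sup>+x. ennreal (max 0 (L m x - L (Suc m) x)) \<partial>\<Omega>) \<le> ennreal (real N * \<delta> / 2 + ln V / \<delta>)" .
  from iterated_coupling[OF order_refl] obtain C where C: "C \<in> \<Omega> \<rightarrow>\<^sub>M prob_algebra \<Omega>"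
    "\<forall>F\<in>borel_measurable \<Omega>. (\<integral>\<^sup>+z. \<integral>\<^sup>+y. F y \<partial>C z \<partial>\<Omega>) = (\<integral>\<^sup>+x. ennreal (L N x) * F x \<partial>\<Omega>)"
    and ham: "(\<integral>\<^sup>+z. \<integral>\<^sup>+y. of_nat (hamming z y) \<partial>C z \<partial>\<Omega>) \<le> (\<Sum>m<N. \<integral>\<^sup>+x. ennreal (max 0 (L m x - L (Suc m) x)) \<partial>\<Omega>)"
    by blast
  from order_trans[OF ham le_N] C show ?thesis by blast
qed


section \<open>Enforcing the corruption budget\<close>

lemma budgeted_coupling:
  assumes \<delta>: "0 < \<delta>" and V: "1 \<le> V" "(\<integral>x. (L N x)\<^sup>2 \<partial>\<Omega>) \<le> V" and b: "0 < b"
  shows "\<exists>C\<in>\<Omega> \<rightarrow>\<^sub>M prob_algebra \<Omega>.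
    (\<forall>x\<in>space \<Omega>. AE y in C x. real (hamming x y) \<le> b) \<and>
    (\<forall>E\<in>sets \<Omega>. emeasure (density \<Omega> (\<lambda>x. ennreal (L N x))) E
        \<le> emeasure (\<Omega> \<bind> C) E + ennreal ((real N * \<delta> / 2 + ln V / \<delta>) / b))"
proof -
  define B where "B = real N * \<delta> / 2 + ln V / \<delta>"
  have B: "0 \<le> B" using \<delta> V by (simp add: B_def)
  have V0: "0 < V" using V by simp
  from hamming_coupling[OF \<delta> V0 V(2)] obtain C where C_m: "C \<in> \<Omega> \<rightarrow>\<^sub>M prob_algebra \<Omega>"
    and C_int: "\<And>F. F \<in> borel_measurable \<Omega> \<Longrightarrow> (\<integral>\<^sup>+z. \<integral>\<^sup>+y. F y \<partial>C z \<partial>\<Omega>) = (\<integral>\<^sup>+x. ennreal (L N x) * F x \<partial>\<Omega>)"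
    and C_ham: "(\<integral>\<^sup>+z. \<integral>\<^sup>+y. of_nat (hamming z y) \<partial>C z \<partial>\<Omega>) \<le> ennreal B"
    unfolding B_def by blast
  \<comment> \<open>The adversary gives up whenever the coupling exceeds its budget, a rare event by Markov's inequality.\<close>
  define g where "g x y = (if real (hamming x y) \<le> b then y else x)" for x y
  define C' where "C' x = distr (C x) \<Omega> (g x)" for x
  note hm[measurable] = measurable_hamming
  have g_m: "(\<lambda>(x, y). g x y) \<in> \<Omega> \<Otimes>\<^sub>M \<Omega> \<rightarrow>\<^sub>M \<Omega>"
    unfolding g_def by measurable
  have C'_m: "C' \<in> \<Omega> \<rightarrow>\<^sub>M prob_algebra \<Omega>"
    unfolding C'_def by (rule measurable_distr_prob_space2[OF C_m g_m])
  have C_sub: "C \<in> \<Omega> \<rightarrow>\<^sub>M subprob_algebra \<Omega>" and C'_sub: "C' \<in> \<Omega> \<rightarrow>\<^sub>M subprob_algebra \<Omega>"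
    using C_m C'_m by (auto intro: measurable_prob_algebraD)
  have sets_C: "sets (C x) = sets \<Omega>" if "x \<in> space \<Omega>" for x
    using measurable_space[OF C_m that] by (simp add: space_prob_algebra)
  have g_x: "g x \<in> C x \<rightarrow>\<^sub>M \<Omega>" if x: "x \<in> space \<Omega>" for x
    using measurable_compose[OF measurable_Pair1'[OF x] g_m]
    by (simp add: measurable_cong_sets[OF sets_C[OF x] refl])
  have ham[measurable]: "(\<lambda>(x, y). of_nat (hamming x y) :: ennreal) \<in> borel_measurable (\<Omega> \<Otimes>\<^sub>M \<Omega>)"
    using measurable_compose[OF measurable_hamming, of of_nat "borel :: ennreal measure"] by (simp add: case_prod_beta)
  have ham1: "(\<lambda>y. of_nat (hamming x y) :: ennreal) \<in> borel_measurable (C x)" if x: "x \<in> space \<Omega>" for x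
    using measurable_compose[OF measurable_Pair1'[OF x] ham] by (simp add: measurable_cong_sets[OF sets_C[OF x] refl])
  have hC_m[measurable]: "(\<lambda>z. \<integral>\<^sup>+y. of_nat (hamming z y) \<partial>C z) \<in> borel_measurable \<Omega>"
    by (rule nn_integral_measurable_subprob_algebra2[OF ham C_sub])
  have "AE y in C' x. real (hamming x y) \<le> b" if x: "x \<in> space \<Omega>" for x
  proof -
    have "{y \<in> space \<Omega>. real (hamming x y) \<le> b} \<in> sets \<Omega>"
    proof -
      have [measurable]: "hamming x \<in> \<Omega> \<rightarrow>\<^sub>M count_space UNIV"
        using measurable_compose[OF measurable_Pair1'[OF x] measurable_hamming] by simp
      show ?thesis by measurable
    qed
    then show ?thesis
      unfolding C'_def using b by (subst AE_distr_iff[OF g_x[OF x]]) (auto simp: g_def)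
  qed
  moreover have "emeasure (density \<Omega> (\<lambda>x. ennreal (L N x))) E \<le> emeasure (\<Omega> \<bind> C') E + ennreal (B / b)"
    if E[measurable]: "E \<in> sets \<Omega>" for E
  proof -
    interpret \<Omega>: prob_space \<Omega> by (rule prob_space_\<Omega>)
    have "emeasure (density \<Omega> (\<lambda>x. ennreal (L N x))) E = (\<integral>\<^sup>+x. ennreal (L N x) * indicator E x \<partial>\<Omega>)"
      by (rule emeasure_density) auto
    also have "\<dots> = (\<integral>\<^sup>+z. \<integral>\<^sup>+y. indicator E y \<partial>C z \<partial>\<Omega>)"
      by (rule C_int[symmetric]) measurable
    also have "\<dots> \<le> (\<integral>\<^sup>+z. emeasure (C' z) E + ennreal (1 / b) * (\<integral>\<^sup>+y. of_nat (hamming z y) \<partial>C z) \<partial>\<Omega>)"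
    proof (rule nn_integral_mono)
      fix z assume z: "z \<in> space \<Omega>"
      note [measurable] = ham1[OF z] g_x[OF z]
      \<comment> \<open>Markov's inequality pointwise: within the budget \<open>g z y = y\<close>,
        and beyond it the Hamming term alone is at least 1.\<close>
      have "(\<integral>\<^sup>+y. indicator E y \<partial>C z) \<le> (\<integral>\<^sup>+y. indicator E (g z y) + ennreal (1 / b) * of_nat (hamming z y) \<partial>C z)"
      proof (rule nn_integral_mono)
        fix y
        show "indicator E y \<le> indicator E (g z y) + ennreal (1 / b) * of_nat (hamming z y)"
        proof (cases "real (hamming z y) \<le> b")
          case True
          then show ?thesis by (simp add: g_def)
        next
          case False
          then have "ennreal 1 \<le> ennreal (1 / b * real (hamming z y))"
            using b by (intro ennreal_leI) (simp add: field_simps)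
          also have "\<dots> = ennreal (1 / b) * of_nat (hamming z y)"
            using b by (subst ennreal_mult) (auto simp: ennreal_of_nat_eq_real_of_nat)
          finally show ?thesis
            by (simp add: indicator_def add_increasing)
        qed
      qed
      also have "\<dots> = (\<integral>\<^sup>+y. indicator E (g z y) \<partial>C z) + ennreal (1 / b) * (\<integral>\<^sup>+y. of_nat (hamming z y) \<partial>C z)"
        by (subst nn_integral_add) (auto simp: nn_integral_cmult)
      also have "(\<integral>\<^sup>+y. indicator E (g z y) \<partial>C z) = emeasure (C' z) E"
        unfolding C'_def by (simp add: nn_integral_distr flip: nn_integral_indicator)
      finally show "(\<integral>\<^sup>+y. indicator E y \<partial>C z) \<le> emeasure (C' z) E + ennreal (1 / b) * (\<integral>\<^sup>+y. of_nat (hamming z y) \<partial>C z)" .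
    qed
    also have "\<dots> = (\<integral>\<^sup>+z. emeasure (C' z) E \<partial>\<Omega>) + ennreal (1 / b) * (\<integral>\<^sup>+z. \<integral>\<^sup>+y. of_nat (hamming z y) \<partial>C z \<partial>\<Omega>)"
    proof (subst nn_integral_add)
      show "(\<lambda>z. emeasure (C' z) E) \<in> borel_measurable \<Omega>"
        using measurable_compose[OF C'_sub measurable_emeasure_subprob_algebra[OF E]] .
    qed (auto simp: nn_integral_cmult)
    also have "\<dots> \<le> (\<integral>\<^sup>+z. emeasure (C' z) E \<partial>\<Omega>) + ennreal (1 / b) * ennreal B"
      by (intro add_left_mono mult_left_mono C_ham) simp
    also have "ennreal (1 / b) * ennreal B = ennreal (B / b)"
      using b B by (simp flip: ennreal_mult)
    also have "(\<integral>\<^sup>+z. emeasure (C' z) E \<partial>\<Omega>) = emeasure (\<Omega> \<bind> C') E"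
      by (rule emeasure_bind[OF \<Omega>.not_empty C'_sub E, symmetric])
    finally show ?thesis .
  qed
  ultimately show ?thesis
    using C'_m unfolding B_def by blast
qed

end

section \<open>Gaussian sign mixtures\<close>

lemma cosh_le_exp: "0 \<le> t \<Longrightarrow> cosh t \<le> exp t" for t :: real
  by (simp add: cosh_field_def)

text \<open>The sharp factor 1/2 in the exponent is given up for elementary estimates: up to 1 both
  exponentials are bounded by quadratics, and beyond 1 the square exceeds the argument.\<close>

lemma cosh_le_exp_square: "cosh t \<le> exp (t\<^sup>2)" for t :: real
proof -
  have "cosh s \<le> exp (s\<^sup>2)" if s: "0 \<le> s" for s :: real
  proof (cases "s \<le> 1")
    case True
    have "exp (- s) = 1 / exp s" by (simp add: exp_minus inverse_eq_divide)
    also have "\<dots> \<le> 1 / (1 + s)"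
      using s by (intro divide_left_mono) auto
    also have "\<dots> \<le> 1 - s + s\<^sup>2"
    proof -
      have "0 \<le> s ^ 3" using s by simp
      then have "1 \<le> (1 - s + s\<^sup>2) * (1 + s)" by (simp add: power2_eq_square power3_eq_cube algebra_simps)
      then show ?thesis using s by (simp add: divide_le_eq)
    qed
    finally have "exp (- s) \<le> 1 - s + s\<^sup>2" .
    moreover have "exp s \<le> 1 + s + s\<^sup>2" using exp_bound[OF s True] .
    ultimately have "cosh s \<le> 1 + s\<^sup>2" by (simp add: cosh_field_def)
    also have "\<dots> \<le> exp (s\<^sup>2)" by (rule exp_ge_add_one_self)
    finally show ?thesis .
  next
    case False
    then have "s * 1 \<le> s * s" using s by (intro mult_left_mono) auto
    then have "exp s \<le> exp (s\<^sup>2)" by (simp add: power2_eq_square)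
    with cosh_le_exp[OF s] show ?thesis by (rule order_trans)
  qed
  from this[of "\<bar>t\<bar>"] show ?thesis by simp
qed

lemma borel_measurable_cosh [measurable (raw)]:
  fixes f :: "'a \<Rightarrow> real"
  assumes [measurable]: "f \<in> borel_measurable M"
  shows "(\<lambda>x. cosh (f x)) \<in> borel_measurable M"
  unfolding cosh_field_def by measurable

lemma PiM_density:
  assumes I: "finite I" and M: "\<And>i. prob_space (M i)"
    and f[measurable]: "\<And>i. f i \<in> borel_measurable (M i)"
    and D: "\<And>i. prob_space (density (M i) (f i))"
  shows "Pi\<^sub>M I (\<lambda>i. density (M i) (f i)) = density (Pi\<^sub>M I M) (\<lambda>x. \<Prod>i\<in>I. f i (x i))"
proof -
  interpret M: product_prob_space M I
    using M by (intro product_prob_spaceI) auto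
  interpret D: product_prob_space "\<lambda>i. density (M i) (f i)" I
    using D by (intro product_prob_spaceI) auto
  have [measurable]: "(\<lambda>x. \<Prod>i\<in>I. f i (x i)) \<in> borel_measurable (Pi\<^sub>M I M)" by measurable
  have "density (Pi\<^sub>M I M) (\<lambda>x. \<Prod>i\<in>I. f i (x i)) = Pi\<^sub>M I (\<lambda>i. density (M i) (f i))"
  proof (rule D.PiM_eqI[OF I])
    show "sets (density (Pi\<^sub>M I M) (\<lambda>x. \<Prod>i\<in>I. f i (x i))) = sets (Pi\<^sub>M I (\<lambda>i. density (M i) (f i)))"
      unfolding sets_density by (rule sets_PiM_cong) auto
    fix A assume "\<And>i. i \<in> I \<Longrightarrow> A i \<in> sets (density (M i) (f i))"
    then have A: "\<And>i. i \<in> I \<Longrightarrow> A i \<in> sets (M i)" by simp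
    have PA: "Pi\<^sub>E I A \<in> sets (Pi\<^sub>M I M)" using A I by (intro sets_PiM_I_finite) auto
    have "emeasure (density (Pi\<^sub>M I M) (\<lambda>x. \<Prod>i\<in>I. f i (x i))) (Pi\<^sub>E I A)
        = (\<integral>\<^sup>+x. (\<Prod>i\<in>I. f i (x i)) * indicator (Pi\<^sub>E I A) x \<partial>Pi\<^sub>M I M)"
      by (rule emeasure_density[OF _ PA]) measurable
    also have "\<dots> = (\<integral>\<^sup>+x. (\<Prod>i\<in>I. f i (x i) * indicator (A i) (x i)) \<partial>Pi\<^sub>M I M)"
    proof (rule nn_integral_cong)
      fix x assume x: "x \<in> space (Pi\<^sub>M I M)"
      have "indicator (Pi\<^sub>E I A) x = (\<Prod>i\<in>I. indicator (A i) (x i) :: ennreal)"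
      proof (cases "x \<in> Pi\<^sub>E I A")
        case True
        then have "(\<Prod>i\<in>I. indicator (A i) (x i) :: ennreal) = (\<Prod>i\<in>I. 1)"
          by (intro prod.cong) (auto simp: PiE_iff)
        then show ?thesis using True by simp
      next
        case False
        then obtain i where "i \<in> I" "x i \<notin> A i" using x by (auto simp: space_PiM PiE_iff)
        then have "(\<Prod>i\<in>I. indicator (A i) (x i) :: ennreal) = 0"
          using I by (intro prod_zero bexI[of _ i]) auto
        then show ?thesis using False by simp
      qed
      then show "(\<Prod>i\<in>I. f i (x i)) * indicator (Pi\<^sub>E I A) x = (\<Prod>i\<in>I. f i (x i) * indicator (A i) (x i))"
        by (simp add: prod.distrib)
    qed
    also have "\<dots> = (\<Prod>i\<in>I. \<integral>\<^sup>+w. f i w * indicator (A i) w \<partial>M i)"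
      using A by (intro M.product_nn_integral_prod I) auto
    also have "\<dots> = (\<Prod>i\<in>I. emeasure (density (M i) (f i)) (A i))"
      using A by (intro prod.cong) (auto simp: emeasure_density)
    finally show "emeasure (density (Pi\<^sub>M I M) (\<lambda>x. \<Prod>i\<in>I. f i (x i))) (Pi\<^sub>E I A)
      = (\<Prod>i\<in>I. emeasure (density (M i) (f i)) (A i))" .
  qed
  then show ?thesis by simp
qed

text \<open>Kernels see a measure only through its sigma-algebra, so a coupling built over the
  Gaussian noise can serve as an adversary.\<close>

lemma data_space_kernels:
  assumes "sets \<Omega> = sets (data_space d N)"
  shows "data_space d N \<rightarrow>\<^sub>M prob_algebra (data_space d N) = \<Omega> \<rightarrow>\<^sub>M prob_algebra \<Omega>"
proof -
  have "prob_algebra (data_space d N) = prob_algebra \<Omega>"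
    unfolding prob_algebra_def using subprob_algebra_cong[OF assms] by simp
  then show ?thesis using measurable_cong_sets[OF assms[symmetric] refl] by simp
qed

section \<open>Moments of the Gaussian noise\<close>

locale centered_normal =
  fixes \<sigma> :: real
  assumes \<sigma>: "0 < \<sigma>"
begin

definition "\<N> = density lborel (\<lambda>w. ennreal (normal_density 0 \<sigma> w))"

lemma prob_space_N: "prob_space \<N>"
  unfolding \<N>_def by (rule prob_space_normal_density[OF \<sigma>])

lemma sets_N [measurable_cong, simp]: "sets \<N> = sets borel"
  by (simp add: \<N>_def)

lemma space_N [simp]: "space \<N> = UNIV"
  by (simp add: \<N>_def)

lemma normal_density_shift:
  "normal_density \<mu> \<sigma> w = normal_density 0 \<sigma> w * exp (\<mu> * w / \<sigma>\<^sup>2 - \<mu>\<^sup>2 / (2 * \<sigma>\<^sup>2))"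
proof -
  have "- (w - \<mu>)\<^sup>2 / (2 * \<sigma>\<^sup>2) = - w\<^sup>2 / (2 * \<sigma>\<^sup>2) + (\<mu> * w / \<sigma>\<^sup>2 - \<mu>\<^sup>2 / (2 * \<sigma>\<^sup>2))"
    using \<sigma> by (simp add: field_simps power2_eq_square)
  then have "exp (- (w - \<mu>)\<^sup>2 / (2 * \<sigma>\<^sup>2)) = exp (- w\<^sup>2 / (2 * \<sigma>\<^sup>2)) * exp (\<mu> * w / \<sigma>\<^sup>2 - \<mu>\<^sup>2 / (2 * \<sigma>\<^sup>2))"
    by (simp only: exp_add)
  then show ?thesis by (simp add: normal_density_def)
qed

lemma density_N:
  "density \<N> (\<lambda>w. ennreal (exp (\<mu> * w / \<sigma>\<^sup>2 - \<mu>\<^sup>2 / (2 * \<sigma>\<^sup>2)))) = density lborel (\<lambda>w. ennreal (normal_density \<mu> \<sigma> w))"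
  unfolding \<N>_def normal_density_shift[of \<mu>]
  by (subst density_density_eq) (auto simp: ennreal_mult')

text \<open>Exponential tilting turns the centred law into the normal law with mean
  \<open>b * \<sigma>\<^sup>2\<close>, of total mass 1; the exponential moment is the normalising
  factor.\<close>

lemma nn_integral_exp_N: "(\<integral>\<^sup>+w. ennreal (exp (b * w)) \<partial>\<N>) = ennreal (exp (b\<^sup>2 * \<sigma>\<^sup>2 / 2))"
proof -
  interpret P: prob_space "density lborel (\<lambda>w. ennreal (normal_density (b * \<sigma>\<^sup>2) \<sigma> w))"
    by (rule prob_space_normal_density[OF \<sigma>])
  have eq: "exp (b * w) = exp (b\<^sup>2 * \<sigma>\<^sup>2 / 2) * exp ((b * \<sigma>\<^sup>2) * w / \<sigma>\<^sup>2 - (b * \<sigma>\<^sup>2)\<^sup>2 / (2 * \<sigma>\<^sup>2))" for w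
    using \<sigma> by (simp add: exp_add[symmetric] field_simps power2_eq_square)
  have "(\<integral>\<^sup>+w. ennreal (exp ((b * \<sigma>\<^sup>2) * w / \<sigma>\<^sup>2 - (b * \<sigma>\<^sup>2)\<^sup>2 / (2 * \<sigma>\<^sup>2))) \<partial>\<N>)
    = emeasure (density \<N> (\<lambda>w. ennreal (exp ((b * \<sigma>\<^sup>2) * w / \<sigma>\<^sup>2 - (b * \<sigma>\<^sup>2)\<^sup>2 / (2 * \<sigma>\<^sup>2))))) UNIV"
    by (subst emeasure_density) auto
  also have "\<dots> = 1"
    unfolding density_N using P.emeasure_space_1 by simp
  finally show ?thesis
    unfolding eq by (subst ennreal_mult') (auto simp: nn_integral_cmult)
qed

text \<open>The constant \<open>A\<close> lets one formula serve both for the likelihood ratio,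
  where it is 0, and for its square, where the double-angle formula produces a constant
  term.\<close>

lemma nn_integral_cosh_N:
  assumes "0 \<le> A" "0 \<le> B"
  shows "(\<integral>\<^sup>+w. ennreal (A + B * cosh (b * (s + w))) \<partial>\<N>) = ennreal (A + B * exp (b\<^sup>2 * \<sigma>\<^sup>2 / 2) * cosh (b * s))"
proof -
  interpret prob_space \<N> by (rule prob_space_N)
  define m where "m = exp (b\<^sup>2 * \<sigma>\<^sup>2 / 2)"
  define P Q where "P = B * exp (b * s) / 2" and "Q = B * exp (- (b * s)) / 2"
  have PQ: "0 \<le> P" "0 \<le> Q" "0 \<le> m" using assms by (auto simp: P_def Q_def m_def)
  have eq: "A + B * cosh (b * (s + w)) = A + (P * exp (b * w) + Q * exp (- b * w))" for w
    by (simp add: P_def Q_def cosh_field_def exp_add[symmetric] field_simps)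
  have "(\<integral>\<^sup>+w. ennreal (A + B * cosh (b * (s + w))) \<partial>\<N>)
    = (\<integral>\<^sup>+w. ennreal A + (ennreal P * ennreal (exp (b * w)) + ennreal Q * ennreal (exp (- b * w))) \<partial>\<N>)"
    unfolding eq using assms PQ by (intro nn_integral_cong) (simp add: ennreal_plus ennreal_mult')
  also have "\<dots> = ennreal A + (ennreal P * ennreal m + ennreal Q * ennreal m)"
    using nn_integral_exp_N[of b] nn_integral_exp_N[of "-b"] emeasure_space_1
    by (simp add: nn_integral_add nn_integral_cmult m_def)
  also have "\<dots> = ennreal (A + (P * m + Q * m))"
    using assms PQ by (simp add: ennreal_plus ennreal_mult')
  also have "A + (P * m + Q * m) = A + B * m * cosh (b * s)"
    by (simp add: P_def Q_def cosh_field_def field_simps)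
  also have "m = exp (b\<^sup>2 * \<sigma>\<^sup>2 / 2)" by (simp add: m_def)
  finally show ?thesis .
qed

section \<open>The likelihood ratio of the sign mixture\<close>

definition "noise d = Pi\<^sub>M {..<d} (\<lambda>_::nat. \<N>)"

text \<open>The likelihood ratio of the first \<open>n\<close> samples when the mean is drawn uniformly among the
  vectors with entries \<open>\<plusminus> \<theta> l\<close>.\<close>

definition sign_lr :: "nat \<Rightarrow> (nat \<Rightarrow> real) \<Rightarrow> nat \<Rightarrow> (nat \<Rightarrow> nat \<Rightarrow> real) \<Rightarrow> real" where
  "sign_lr d \<theta> n x = (\<Prod>l<d. exp (- (real n * (\<theta> l)\<^sup>2 / (2 * \<sigma>\<^sup>2))) * cosh (\<theta> l / \<sigma>\<^sup>2 * (\<Sum>i<n. x i l)))"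

lemma prob_space_noise: "prob_space (noise d)"
  unfolding noise_def by (intro prob_space_PiM prob_space_N)

lemma entry_measurable [measurable (raw)]:
  fixes i N :: nat
  assumes "i < N" "l < d"
  shows "(\<lambda>x. x i l) \<in> borel_measurable (Pi\<^sub>M {..<N} (\<lambda>_. noise d))"
proof -
  have "(\<lambda>w. w l) \<in> noise d \<rightarrow>\<^sub>M \<N>"
    unfolding noise_def using assms by (intro measurable_component_singleton) simp
  then have "(\<lambda>w. w l) \<in> borel_measurable (noise d)"
    by (simp add: measurable_cong_sets[OF refl sets_N])
  moreover have "(\<lambda>x. x i) \<in> Pi\<^sub>M {..<N} (\<lambda>_. noise d) \<rightarrow>\<^sub>M noise d"
    using assms by (intro measurable_component_singleton) simp
  ultimately show ?thesis by (rule measurable_compose[rotated])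
qed

lemma sum_entries_measurable:
  "(n::nat) \<le> N \<Longrightarrow> l < d \<Longrightarrow> (\<lambda>x. \<Sum>i<n. x i l) \<in> borel_measurable (Pi\<^sub>M {..<N} (\<lambda>_. noise d))"
  by (intro borel_measurable_sum entry_measurable) auto

lemma sign_lr_measurable: "n \<le> N \<Longrightarrow> sign_lr d \<theta> n \<in> borel_measurable (Pi\<^sub>M {..<N} (\<lambda>_. noise d))"
  unfolding sign_lr_def
  by (intro borel_measurable_prod borel_measurable_times borel_measurable_const borel_measurable_cosh
      sum_entries_measurable) auto

lemma sign_lr_pos: "0 < sign_lr d \<theta> n x"
  unfolding sign_lr_def by (intro prod_pos) simp

lemma nn_integral_prod_cosh_noise:
  assumes AB: "\<And>l. l < d \<Longrightarrow> 0 \<le> A l" "\<And>l. l < d \<Longrightarrow> 0 \<le> B l"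
  shows "(\<integral>\<^sup>+w. ennreal (\<Prod>l<d. A l + B l * cosh (c l * (s l + w l))) \<partial>noise d)
    = ennreal (\<Prod>l<d. A l + B l * exp ((c l)\<^sup>2 * \<sigma>\<^sup>2 / 2) * cosh (c l * s l))"
proof -
  interpret prob_space \<N> by (rule prob_space_N)
  interpret product_sigma_finite "\<lambda>_::nat. \<N>" ..
  have "(\<integral>\<^sup>+w. ennreal (\<Prod>l<d. A l + B l * cosh (c l * (s l + w l))) \<partial>noise d)
    = (\<integral>\<^sup>+w. (\<Prod>l<d. ennreal (A l + B l * cosh (c l * (s l + w l)))) \<partial>noise d)"
    using AB by (intro nn_integral_cong prod_ennreal[symmetric]) auto
  also have "\<dots> = (\<Prod>l<d. \<integral>\<^sup>+w. ennreal (A l + B l * cosh (c l * (s l + w))) \<partial>\<N>)"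
    unfolding noise_def by (rule product_nn_integral_prod) measurable
  also have "\<dots> = (\<Prod>l<d. ennreal (A l + B l * exp ((c l)\<^sup>2 * \<sigma>\<^sup>2 / 2) * cosh (c l * s l)))"
    using AB by (intro prod.cong nn_integral_cosh_N) auto
  also have "\<dots> = ennreal (\<Prod>l<d. A l + B l * exp ((c l)\<^sup>2 * \<sigma>\<^sup>2 / 2) * cosh (c l * s l))"
    using AB by (intro prod_ennreal) auto
  finally show ?thesis .
qed

lemma sum_upd: "(\<Sum>i<Suc n. (x(n := w)) i l) = (\<Sum>i<n. x i l) + w l" for x :: "nat \<Rightarrow> nat \<Rightarrow> real"
  by simp

text \<open>Averaging over a new sample multiplies the cosh of coordinate \<open>l\<close> by the
  exponential of \<open>(\<theta> l)\<^sup>2 / (2 * \<sigma>\<^sup>2)\<close>, exactly what the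
  normalisation for one more sample removes.\<close>

lemma nn_integral_sign_lr_Suc:
  "(\<integral>\<^sup>+w. ennreal (sign_lr d \<theta> (Suc n) (x(n := w))) \<partial>noise d) = ennreal (sign_lr d \<theta> n x)"
proof -
  define B where "B l = exp (- (real (Suc n) * (\<theta> l)\<^sup>2 / (2 * \<sigma>\<^sup>2)))" for l
  have "exp ((\<theta> l / \<sigma>\<^sup>2)\<^sup>2 * \<sigma>\<^sup>2 / 2) * B l = exp (- (real n * (\<theta> l)\<^sup>2 / (2 * \<sigma>\<^sup>2)))" for l
    using \<sigma> unfolding B_def exp_add[symmetric] by (simp add: field_simps power2_eq_square)
  moreover have "0 \<le> B l" for l by (simp add: B_def)
  ultimately show ?thesis
    using nn_integral_prod_cosh_noise[of d "\<lambda>_. 0" B "\<lambda>l. \<theta> l / \<sigma>\<^sup>2" "\<lambda>l. \<Sum>i<n. x i l"]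
    unfolding sign_lr_def sum_upd B_def[symmetric] by (simp add: mult.commute)
qed

lemma nn_integral_sign_lr_square:
  assumes n: "n \<le> N"
  shows "(\<integral>\<^sup>+x. ennreal ((sign_lr d \<theta> n x)\<^sup>2) \<partial>Pi\<^sub>M {..<N} (\<lambda>_. noise d)) = ennreal (\<Prod>l<d. cosh (real n * (\<theta> l)\<^sup>2 / \<sigma>\<^sup>2))"
proof -
  let ?\<Omega> = "Pi\<^sub>M {..<N} (\<lambda>_. noise d)"
  interpret prob_space ?\<Omega> by (intro prob_space_PiM prob_space_noise)
  define u where "u l = (\<theta> l)\<^sup>2 / \<sigma>\<^sup>2" for l
  define A where "A l = exp (- (real n * u l)) / 2" for l
  \<comment> \<open>The conditional expectation of the square of the likelihood ratio given the first \<open>m\<close> samples.\<close>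
  define Q where "Q m x = (\<Prod>l<d. A l + A l * exp (2 * u l * real (n - m)) * cosh (2 * \<theta> l / \<sigma>\<^sup>2 * (\<Sum>i<m. x i l)))"
    for m and x :: "nat \<Rightarrow> nat \<Rightarrow> real"
  have A: "0 \<le> A l" for l by (simp add: A_def)
  have Q_m: "Q m \<in> borel_measurable ?\<Omega>" if "m \<le> N" for m
    using that unfolding Q_def
    by (intro borel_measurable_prod borel_measurable_times borel_measurable_add borel_measurable_const
        borel_measurable_cosh sum_entries_measurable) auto
  \<comment> \<open>Each averaged sample contributes the factor \<open>exp (2 * u l)\<close> to the
    cosh term, so the expectation is the same for all \<open>m\<close>. \<open>Q 0\<close> involves
    no data, and \<open>undefined\<close> merely stands for an arbitrary data set.\<close>
  have "(\<integral>\<^sup>+x. ennreal (Q m x) \<partial>?\<Omega>) = ennreal (Q 0 undefined)" if "m \<le> n" for m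
    using that
  proof (induction m)
    case 0
    have "Q 0 x = Q 0 undefined" for x by (simp add: Q_def)
    then have "(\<integral>\<^sup>+x. ennreal (Q 0 x) \<partial>?\<Omega>) = (\<integral>\<^sup>+x. ennreal (Q 0 undefined) \<partial>?\<Omega>)" by (intro nn_integral_cong arg_cong[where f = ennreal])
    then show ?case by (simp add: emeasure_space_1)
  next
    case (Suc m)
    have m: "m \<in> {..<N}" using Suc n by simp
    note [measurable] = Q_m[of "Suc m"]
    have "(\<integral>\<^sup>+x. ennreal (Q (Suc m) x) \<partial>?\<Omega>) = (\<integral>\<^sup>+x. \<integral>\<^sup>+w. ennreal (Q (Suc m) (x(m := w))) \<partial>noise d \<partial>?\<Omega>)"
      using m by (intro nn_integral_PiM_resample[OF prob_space_noise]) auto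
    also have "\<dots> = (\<integral>\<^sup>+x. ennreal (Q m x) \<partial>?\<Omega>)"
    proof (rule nn_integral_cong)
      fix x
      have "exp (2 * u l * real (n - Suc m)) * exp ((2 * \<theta> l / \<sigma>\<^sup>2)\<^sup>2 * \<sigma>\<^sup>2 / 2) = exp (2 * u l * real (n - m))" for l
      proof -
        have "real (n - m) = real (n - Suc m) + 1" using Suc by (simp add: of_nat_diff)
        then show ?thesis
          using \<sigma> unfolding exp_add[symmetric] by (simp add: u_def field_simps power2_eq_square)
      qed
      then show "(\<integral>\<^sup>+w. ennreal (Q (Suc m) (x(m := w))) \<partial>noise d) = ennreal (Q m x)"
        using nn_integral_prod_cosh_noise[of d A "\<lambda>l. A l * exp (2 * u l * real (n - Suc m))"
            "\<lambda>l. 2 * \<theta> l / \<sigma>\<^sup>2" "\<lambda>l. \<Sum>i<m. x i l"] A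
        unfolding Q_def sum_upd by (simp add: mult.assoc)
    qed
    finally show ?case using Suc by simp
  qed
  from this[OF order_refl] have "(\<integral>\<^sup>+x. ennreal (Q n x) \<partial>?\<Omega>) = ennreal (Q 0 undefined)" .
  \<comment> \<open>By the double-angle formula a squared cosh is a constant plus a cosh, the shape
    that \<open>Q\<close> has at \<open>m = n\<close>.\<close>
  moreover have "Q n x = (sign_lr d \<theta> n x)\<^sup>2" for x
  proof -
    have "A l + A l * cosh (2 * \<theta> l / \<sigma>\<^sup>2 * s) = (exp (- (real n * (\<theta> l)\<^sup>2 / (2 * \<sigma>\<^sup>2))) * cosh (\<theta> l / \<sigma>\<^sup>2 * s))\<^sup>2" for l s
    proof -
      have "(exp (- (real n * (\<theta> l)\<^sup>2 / (2 * \<sigma>\<^sup>2))))\<^sup>2 = 2 * A l"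
        using \<sigma> by (simp add: A_def u_def power2_eq_square exp_add[symmetric])
      then have "(exp (- (real n * (\<theta> l)\<^sup>2 / (2 * \<sigma>\<^sup>2))) * cosh (\<theta> l / \<sigma>\<^sup>2 * s))\<^sup>2 = 2 * A l * (cosh (\<theta> l / \<sigma>\<^sup>2 * s))\<^sup>2"
        by (simp only: power_mult_distrib)
      moreover have "cosh (2 * \<theta> l / \<sigma>\<^sup>2 * s) = 2 * (cosh (\<theta> l / \<sigma>\<^sup>2 * s))\<^sup>2 - 1"
        using cosh_double_cosh[of "\<theta> l / \<sigma>\<^sup>2 * s"] by (simp add: mult.assoc)
      ultimately show ?thesis by (simp only:) (simp add: right_diff_distrib)
    qed
    then have "(\<Prod>l<d. A l + A l * cosh (2 * \<theta> l / \<sigma>\<^sup>2 * (\<Sum>i<n. x i l)))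
      = (\<Prod>l<d. (exp (- (real n * (\<theta> l)\<^sup>2 / (2 * \<sigma>\<^sup>2))) * cosh (\<theta> l / \<sigma>\<^sup>2 * (\<Sum>i<n. x i l)))\<^sup>2)"
      by (intro prod.cong refl)
    also have "\<dots> = (sign_lr d \<theta> n x)\<^sup>2" by (simp only: sign_lr_def prod_power_distrib)
    finally show ?thesis by (simp add: Q_def)
  qed
  \<comment> \<open>The constant part and the part amplified \<open>n\<close> times are the two
    exponential halves of the cosh of \<open>real n * u l\<close>.\<close>
  moreover have "Q 0 undefined = (\<Prod>l<d. cosh (real n * (\<theta> l)\<^sup>2 / \<sigma>\<^sup>2))"
  proof -
    have "A l + A l * exp (2 * u l * real n) = cosh (real n * (\<theta> l)\<^sup>2 / \<sigma>\<^sup>2)" for l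
    proof -
      have "A l * exp (2 * u l * real n) = exp (real n * u l) / 2"
        by (simp add: A_def exp_add[symmetric] algebra_simps)
      then show ?thesis by (simp add: A_def u_def cosh_field_def field_simps)
    qed
    then show ?thesis by (simp add: Q_def)
  qed
  ultimately show ?thesis by simp
qed

lemma integral_sign_lr_square:
  assumes n: "n \<le> N"
  shows "(\<integral>x. (sign_lr d \<theta> n x)\<^sup>2 \<partial>Pi\<^sub>M {..<N} (\<lambda>_. noise d)) = (\<Prod>l<d. cosh (real n * (\<theta> l)\<^sup>2 / \<sigma>\<^sup>2))"
proof -
  have "(\<lambda>x. (sign_lr d \<theta> n x)\<^sup>2) \<in> borel_measurable (Pi\<^sub>M {..<N} (\<lambda>_. noise d))"
    using sign_lr_measurable[OF n] by (rule borel_measurable_power)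
  then show ?thesis
    by (subst integral_eq_nn_integral) (simp_all add: nn_integral_sign_lr_square[OF n] prod_nonneg)
qed

lemma noise_coordinate_measurable: "l < d \<Longrightarrow> (\<lambda>w. w l) \<in> borel_measurable (noise d)"
  using measurable_component_singleton[of l "{..<d}" "\<lambda>_. \<N>"]
  by (simp add: noise_def measurable_cong_sets[OF refl sets_N])

text \<open>Rows are extensional functions, so finitely many real equations decide whether two of
  them agree.\<close>

lemma diagonal_noise: "{p \<in> space (noise d \<Otimes>\<^sub>M noise d). fst p = snd p} \<in> sets (noise d \<Otimes>\<^sub>M noise d)"
proof -
  have m1: "(\<lambda>p. fst p l) \<in> borel_measurable (noise d \<Otimes>\<^sub>M noise d)" if "l < d" for l
    by (rule measurable_compose[OF measurable_fst noise_coordinate_measurable[OF that]])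
  have m2: "(\<lambda>p. snd p l) \<in> borel_measurable (noise d \<Otimes>\<^sub>M noise d)" if "l < d" for l
    by (rule measurable_compose[OF measurable_snd noise_coordinate_measurable[OF that]])
  have "fst p = snd p \<longleftrightarrow> (\<forall>l\<in>{..<d}. fst p l = snd p l)" if "p \<in> space (noise d \<Otimes>\<^sub>M noise d)" for p
  proof
    have "fst p \<in> space (noise d)" "snd p \<in> space (noise d)"
      using that by (simp_all add: space_pair_measure mem_Times_iff)
    then have PiE: "fst p \<in> ({..<d} \<rightarrow>\<^sub>E space \<N>)" "snd p \<in> ({..<d} \<rightarrow>\<^sub>E space \<N>)"
      by (simp_all only: noise_def space_PiM)
    assume "\<forall>l\<in>{..<d}. fst p l = snd p l"
    then show "fst p = snd p" by (intro PiE_ext[OF PiE]) blast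
  qed simp
  then have eq: "{p \<in> space (noise d \<Otimes>\<^sub>M noise d). fst p = snd p} = {p \<in> space (noise d \<Otimes>\<^sub>M noise d). \<forall>l\<in>{..<d}. fst p l = snd p l}"
    by blast
  show ?thesis
    unfolding eq
  proof (rule sets.sets_Collect_finite_All)
    fix l assume "l \<in> {..<d}"
    then have "l < d" by simp
    then show "{p \<in> space (noise d \<Otimes>\<^sub>M noise d). fst p l = snd p l} \<in> sets (noise d \<Otimes>\<^sub>M noise d)"
      by (intro borel_measurable_eq m1 m2)
  qed simp
qed

lemma likelihood_martingale_sign_lr: "likelihood_martingale (noise d) N (sign_lr d \<theta>)"
proof (intro likelihood_martingale.intro likelihood_martingale_axioms.intro prob_space_noise)
  fix n assume n: "n \<le> N"
  show m: "sign_lr d \<theta> n \<in> borel_measurable (Pi\<^sub>M {..<N} (\<lambda>_. noise d))"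
    by (rule sign_lr_measurable[OF n])
  show "integrable (Pi\<^sub>M {..<N} (\<lambda>_. noise d)) (\<lambda>x. (sign_lr d \<theta> n x)\<^sup>2)"
    using m by (intro integrableI_nonneg) (simp_all add: nn_integral_sign_lr_square[OF n])
next
  fix n :: nat and x :: "nat \<Rightarrow> nat \<Rightarrow> real" and w
  have "(\<Sum>i<n. (x(n := w)) i l) = (\<Sum>i<n. x i l)" for l by (intro sum.cong) auto
  then show "sign_lr d \<theta> n (x(n := w)) = sign_lr d \<theta> n x" by (simp only: sign_lr_def)
next
  show "sign_lr d \<theta> 0 x = 1" for x by (simp add: sign_lr_def)
qed (rule sign_lr_pos nn_integral_sign_lr_Suc diagonal_noise)+

section \<open>The mixture as an average of model laws\<close>

lemma isotropic_normal_eq_density: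
  "isotropic_normal d \<mu> \<sigma> = density (noise d) (\<lambda>w. \<Prod>l<d. ennreal (exp (\<mu> l * w l / \<sigma>\<^sup>2 - (\<mu> l)\<^sup>2 / (2 * \<sigma>\<^sup>2))))"
  unfolding isotropic_normal_def noise_def density_N[symmetric]
  by (rule PiM_density) (auto simp: density_N prob_space_N prob_space_normal_density[OF \<sigma>])

lemma clean_law_eq_density:
  "clean_law d N \<sigma> \<mu> = density (Pi\<^sub>M {..<N} (\<lambda>_. noise d))
    (\<lambda>x. \<Prod>i<N. \<Prod>l<d. ennreal (exp (\<mu> l * x i l / \<sigma>\<^sup>2 - (\<mu> l)\<^sup>2 / (2 * \<sigma>\<^sup>2))))"
proof -
  have "(\<lambda>w. \<Prod>l<d. ennreal (exp (\<mu> l * w l / \<sigma>\<^sup>2 - (\<mu> l)\<^sup>2 / (2 * \<sigma>\<^sup>2)))) \<in> borel_measurable (noise d)"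
    unfolding noise_def by measurable
  moreover have "prob_space (isotropic_normal d \<mu> \<sigma>)"
    unfolding isotropic_normal_def by (intro prob_space_PiM prob_space_normal_density[OF \<sigma>])
  ultimately show ?thesis
    unfolding clean_law_def isotropic_normal_eq_density
    by (intro PiM_density[where f = "\<lambda>_ w. \<Prod>l<d. ennreal (exp (\<mu> l * w l / \<sigma>\<^sup>2 - (\<mu> l)\<^sup>2 / (2 * \<sigma>\<^sup>2)))"])
      (auto simp: prob_space_noise isotropic_normal_eq_density)
qed

lemma clean_law_0: "clean_law d N \<sigma> (\<lambda>i\<in>{..<d}. 0) = Pi\<^sub>M {..<N} (\<lambda>_. noise d)"
proof -
  have "isotropic_normal d (\<lambda>i\<in>{..<d}. 0) \<sigma> = noise d"
    unfolding isotropic_normal_def noise_def by (intro PiM_cong) (auto simp: \<N>_def)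
  then show ?thesis by (simp add: clean_law_def)
qed

lemma sets_noise: "sets (noise d) = sets (Pi\<^sub>M {..<d} (\<lambda>_. borel))"
  unfolding noise_def by (intro sets_PiM_cong) auto

lemma sets_data_space: "sets (data_space d N) = sets (Pi\<^sub>M {..<N} (\<lambda>_. noise d))"
  unfolding data_space_def by (intro sets_PiM_cong) (auto simp: sets_noise)

text \<open>Writing each cosh as a sum of two exponentials and expanding the product over the
  coordinates gives one term per sign vector. The factor \<open>2 ^ d\<close> replaces division by
  the number of sign vectors.\<close>

lemma sign_mixture:
  "ennreal (2 ^ d) * ennreal (sign_lr d \<theta> N x)
    = (\<Sum>s\<in>{..<d} \<rightarrow>\<^sub>E {-1, 1}. \<Prod>i<N. \<Prod>l<d. ennreal (exp (s l * \<theta> l * x i l / \<sigma>\<^sup>2 - (s l * \<theta> l)\<^sup>2 / (2 * \<sigma>\<^sup>2))))"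
proof -
  define e where "e l s = exp (- (real N * (\<theta> l)\<^sup>2 / (2 * \<sigma>\<^sup>2))) * exp (s * (\<theta> l / \<sigma>\<^sup>2 * (\<Sum>i<N. x i l)))" for l s
  have "2 ^ d * sign_lr d \<theta> N x = (\<Prod>l<d. 2 * (exp (- (real N * (\<theta> l)\<^sup>2 / (2 * \<sigma>\<^sup>2))) * cosh (\<theta> l / \<sigma>\<^sup>2 * (\<Sum>i<N. x i l))))"
    by (simp add: sign_lr_def prod.distrib)
  also have "\<dots> = (\<Prod>l<d. \<Sum>s\<in>{-1, 1}. e l s)"
    by (intro prod.cong) (auto simp: e_def cosh_field_def algebra_simps)
  also have "\<dots> = (\<Sum>s\<in>{..<d} \<rightarrow>\<^sub>E {-1, 1}. \<Prod>l<d. e l (s l))"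
    by (rule prod_sum_PiE) auto
  finally have *: "2 ^ d * sign_lr d \<theta> N x = (\<Sum>s\<in>{..<d} \<rightarrow>\<^sub>E {-1, 1}. \<Prod>l<d. e l (s l))" .
  have e: "ennreal (\<Prod>l<d. e l (s l)) = (\<Prod>i<N. \<Prod>l<d. ennreal (exp (s l * \<theta> l * x i l / \<sigma>\<^sup>2 - (s l * \<theta> l)\<^sup>2 / (2 * \<sigma>\<^sup>2))))"
    if s: "s \<in> {..<d} \<rightarrow>\<^sub>E {-1, 1}" for s
  proof -
    have "e l (s l) = (\<Prod>i<N. exp (s l * \<theta> l * x i l / \<sigma>\<^sup>2 - (s l * \<theta> l)\<^sup>2 / (2 * \<sigma>\<^sup>2)))" if l: "l < d" for l
    proof -
      have "s l \<in> {-1, 1}" using PiE_mem[OF s, of l] l by simp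
      then have "(s l * \<theta> l)\<^sup>2 = (\<theta> l)\<^sup>2" by auto
      then show ?thesis
        unfolding e_def exp_sum[symmetric, OF finite_lessThan] exp_add[symmetric]
        by (simp add: sum_subtractf sum_divide_distrib[symmetric] sum_distrib_left[symmetric] algebra_simps)
    qed
    then have "(\<Prod>l<d. e l (s l)) = (\<Prod>l<d. \<Prod>i<N. exp (s l * \<theta> l * x i l / \<sigma>\<^sup>2 - (s l * \<theta> l)\<^sup>2 / (2 * \<sigma>\<^sup>2)))"
      by (intro prod.cong) auto
    also have "\<dots> = (\<Prod>i<N. \<Prod>l<d. exp (s l * \<theta> l * x i l / \<sigma>\<^sup>2 - (s l * \<theta> l)\<^sup>2 / (2 * \<sigma>\<^sup>2)))"
      by (rule prod.swap)
    finally show ?thesis by (simp add: prod_ennreal prod_nonneg)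
  qed
  have e_nonneg: "0 \<le> (\<Prod>l<d. e l (s l))" for s by (intro prod_nonneg) (simp add: e_def)
  have "ennreal (2 ^ d) * ennreal (sign_lr d \<theta> N x) = ennreal (2 ^ d * sign_lr d \<theta> N x)"
    by (simp add: ennreal_mult')
  also have "\<dots> = (\<Sum>s\<in>{..<d} \<rightarrow>\<^sub>E {-1, 1}. ennreal (\<Prod>l<d. e l (s l)))"
    unfolding * using e_nonneg by (intro sum_ennreal[symmetric]) auto
  also have "\<dots> = (\<Sum>s\<in>{..<d} \<rightarrow>\<^sub>E {-1, 1}. \<Prod>i<N. \<Prod>l<d. ennreal (exp (s l * \<theta> l * x i l / \<sigma>\<^sup>2 - (s l * \<theta> l)\<^sup>2 / (2 * \<sigma>\<^sup>2))))"
    by (intro sum.cong e) auto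
  finally show ?thesis .
qed

text \<open>An average over the sign vectors is at most its largest term; this is the passage from a
  worst-case error to the error under the mixture.\<close>

lemma emeasure_sign_mixture_le:
  assumes E: "E \<in> sets (Pi\<^sub>M {..<N} (\<lambda>_. noise d))"
    and le: "\<And>s. s \<in> {..<d} \<rightarrow>\<^sub>E {-1, 1} \<Longrightarrow> emeasure (clean_law d N \<sigma> (\<lambda>l\<in>{..<d}. s l * \<theta> l)) E \<le> a"
  shows "emeasure (density (Pi\<^sub>M {..<N} (\<lambda>_. noise d)) (\<lambda>x. ennreal (sign_lr d \<theta> N x))) E \<le> a"
proof -
  let ?\<Omega> = "Pi\<^sub>M {..<N} (\<lambda>_. noise d)"
  define f where "f s x = (\<Prod>i<N. \<Prod>l<d. ennreal (exp (s l * \<theta> l * x i l / \<sigma>\<^sup>2 - (s l * \<theta> l)\<^sup>2 / (2 * \<sigma>\<^sup>2))))"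
    for s and x :: "nat \<Rightarrow> nat \<Rightarrow> real"
  note [measurable] = E sign_lr_measurable[OF order_refl]
  have f[measurable]: "f s \<in> borel_measurable ?\<Omega>" for s
    unfolding f_def
    by (intro borel_measurable_prod_ennreal measurable_compose[OF _ measurable_ennreal] measurable_compose[OF _ borel_measurable_exp]
        borel_measurable_diff borel_measurable_divide borel_measurable_times borel_measurable_const entry_measurable) auto
  have pow2: "ennreal (2 ^ d) = 2 ^ d"
    using ennreal_power[of 2 d] by simp
  have clean: "clean_law d N \<sigma> (\<lambda>l\<in>{..<d}. s l * \<theta> l) = density ?\<Omega> (f s)" for s
    unfolding clean_law_eq_density f_def by (intro arg_cong2[where f = density] ext prod.cong) auto
  have "ennreal (2 ^ d) * emeasure (density ?\<Omega> (\<lambda>x. ennreal (sign_lr d \<theta> N x))) E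
    = (\<integral>\<^sup>+x. ennreal (2 ^ d) * (ennreal (sign_lr d \<theta> N x) * indicator E x) \<partial>?\<Omega>)"
    by (simp add: emeasure_density nn_integral_cmult)
  also have "\<dots> = (\<integral>\<^sup>+x. (\<Sum>s\<in>{..<d} \<rightarrow>\<^sub>E {-1, 1}. f s x * indicator E x) \<partial>?\<Omega>)"
    unfolding mult.assoc[symmetric] sign_mixture f_def[symmetric] by (simp add: sum_distrib_right)
  also have "\<dots> = (\<Sum>s\<in>{..<d} \<rightarrow>\<^sub>E {-1, 1}. emeasure (density ?\<Omega> (f s)) E)"
    by (subst nn_integral_sum) (auto simp: emeasure_density)
  also have "\<dots> \<le> (\<Sum>s\<in>{..<d} \<rightarrow>\<^sub>E {-1, 1 :: real}. a)"
    using le by (intro sum_mono) (simp add: clean)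
  also have "\<dots> = ennreal (2 ^ d) * a"
    using pow2 by (simp add: card_PiE numeral_2_eq_2[symmetric])
  finally show ?thesis
    by (subst (asm) ennreal_mult_le_mult_iff) auto
qed

section \<open>From a test to second-moment conditions\<close>

lemma clean_adversary: 
  assumes "0 \<le> \<epsilon>"
  shows "return (data_space d N) \<in> adversaries d N \<epsilon>"
proof -
  have "AE y in return (data_space d N) x. real (card {i\<in>{..<N}. y i \<noteq> x i}) \<le> \<epsilon> * real N"
    if x: "x \<in> space (data_space d N)" for x
  proof -
    \<comment> \<open>Instantiated only to obtain the measurability of the Hamming distance; the
      zero vector is an arbitrary choice.\<close>
    interpret likelihood_martingale "noise d" N "sign_lr d (\<lambda>_. 0)" by (rule likelihood_martingale_sign_lr)
    have sets: "sets (data_space d N) = sets \<Omega>" by (simp add: sets_data_space \<Omega>_def)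
    have x': "x \<in> space \<Omega>" using x sets_eq_imp_space_eq[OF sets] by simp
    have [measurable]: "hamming x \<in> data_space d N \<rightarrow>\<^sub>M count_space UNIV"
      using measurable_compose[OF measurable_Pair1'[OF x'] measurable_hamming]
      by (simp add: measurable_cong_sets[OF sets refl])
    have "Measurable.pred (data_space d N) (\<lambda>y. real (hamming x y) \<le> \<epsilon> * real N)" by measurable
    from AE_return[OF x this] have "AE y in return (data_space d N) x. real (hamming x y) \<le> \<epsilon> * real N"
      using assms by simp
    then show ?thesis by (simp only: hamming_def)
  qed
  then show ?thesis
    unfolding adversaries_def using measurable_return_prob_space by blast
qed

text \<open>Every sign change of \<open>\<theta>\<close> is an alternative, where the adversary that
  changes nothing is already allowed. Hence the rejection region \<open>E\<close> has little mass
  under each corrupted null law but much under the mixture.\<close>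

lemma errors_imp_mixture_bounds:
  assumes \<epsilon>: "0 \<le> \<epsilon>" and \<alpha>: "0 < \<alpha>" "\<alpha> < 1 / 2"
    and K: "QCO d K" "\<theta> \<in> K" "\<rho> \<le> L2_set \<theta> {..<d}"
    and \<phi>: "\<phi> \<in> tests d N"
    and err: "type1_error d N \<sigma> \<epsilon> \<phi> \<le> ennreal \<alpha>" "type2_error d N K \<sigma> \<epsilon> \<rho> \<phi> \<le> ennreal \<alpha>"
  shows "\<exists>E\<in>sets (Pi\<^sub>M {..<N} (\<lambda>_. noise d)).
    (\<forall>C\<in>adversaries d N \<epsilon>. emeasure (Pi\<^sub>M {..<N} (\<lambda>_. noise d) \<bind> C) E \<le> ennreal \<alpha>) \<and>
    emeasure (Pi\<^sub>M {..<N} (\<lambda>_. noise d)) E \<le> ennreal \<alpha> \<and>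
    ennreal (1 - \<alpha>) \<le> emeasure (density (Pi\<^sub>M {..<N} (\<lambda>_. noise d)) (\<lambda>x. ennreal (sign_lr d \<theta> N x))) E"
proof -
  interpret likelihood_martingale "noise d" N "sign_lr d \<theta>" by (rule likelihood_martingale_sign_lr)
  have sets: "sets \<Omega> = sets (data_space d N)" by (simp add: sets_data_space \<Omega>_def)
  have space: "space \<Omega> = space (data_space d N)" by (rule sets_eq_imp_space_eq[OF sets])
  define E where "E = {x \<in> space (data_space d N). \<phi> x = 1}"
  define E0 where "E0 = {x \<in> space (data_space d N). \<phi> x = 0}"
  have \<phi>': "\<phi> \<in> data_space d N \<rightarrow>\<^sub>M count_space {0, 1}" using \<phi> by (simp add: tests_def)
  have "\<phi> -` {1} \<inter> space (data_space d N) \<in> sets (data_space d N)" "\<phi> -` {0} \<inter> space (data_space d N) \<in> sets (data_space d N)"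
    by (rule measurable_sets[OF \<phi>'], simp)+
  moreover have "\<phi> -` {1} \<inter> space (data_space d N) = E" "\<phi> -` {0} \<inter> space (data_space d N) = E0"
    by (auto simp: E_def E0_def)
  ultimately have E: "E \<in> sets \<Omega>" "E0 \<in> sets \<Omega>" by (simp_all add: sets)
  have E0: "E = space \<Omega> - E0"
  proof -
    have "\<phi> x = 0 \<or> \<phi> x = 1" if "x \<in> space (data_space d N)" for x
      using measurable_space[OF \<phi>' that] by simp
    then show ?thesis unfolding E_def E0_def space by force
  qed
  have clean0: "clean_law d N \<sigma> (\<lambda>i\<in>{..<d}. 0) = \<Omega>" by (simp add: clean_law_0 \<Omega>_def)
  have null: "emeasure (\<Omega> \<bind> C) E \<le> ennreal \<alpha>" if "C \<in> adversaries d N \<epsilon>" for C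
  proof -
    have "emeasure (observed_law d N \<sigma> (\<lambda>i\<in>{..<d}. 0) C) E \<le> type1_error d N \<sigma> \<epsilon> \<phi>"
      unfolding type1_error_def E_def by (rule SUP_upper[OF that])
    then show ?thesis using err(1) by (simp add: observed_law_def clean0)
  qed
  have ret: "M \<bind> return (data_space d N) = M" if "sets M = sets (data_space d N)" for M
    using that by (rule bind_return'')
  have null_clean: "emeasure \<Omega> E \<le> ennreal \<alpha>"
    using null[OF clean_adversary[OF \<epsilon>]] by (simp add: ret sets)
  have "emeasure (clean_law d N \<sigma> (\<lambda>l\<in>{..<d}. s l * \<theta> l)) E0 \<le> ennreal \<alpha>"
    if s: "s \<in> {..<d} \<rightarrow>\<^sub>E {-1, 1}" for s
  proof -
    define \<mu> where "\<mu> = (\<lambda>l\<in>{..<d}. s l * \<theta> l)"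
    have s1: "s l \<in> {-1, 1}" if "l < d" for l using PiE_mem[OF s, of l] that by simp
    then have "\<mu> \<in> K" using K unfolding QCO_def \<mu>_def by blast
    moreover have "L2_set \<mu> {..<d} = L2_set \<theta> {..<d}"
    proof -
      have "(\<mu> l)\<^sup>2 = (\<theta> l)\<^sup>2" if "l < d" for l using s1[OF that] that by (auto simp: \<mu>_def)
      then show ?thesis by (simp add: L2_set_def)
    qed
    ultimately have \<mu>: "\<mu> \<in> alternative d K \<rho>" using K by (simp add: alternative_def)
    have "emeasure (observed_law d N \<sigma> \<mu> (return (data_space d N))) E0 \<le> type2_error d N K \<sigma> \<epsilon> \<rho> \<phi>"
      unfolding type2_error_def E0_def
      by (rule SUP_upper2[OF \<mu>], rule SUP_upper[OF clean_adversary[OF \<epsilon>]])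
    also have "\<dots> \<le> ennreal \<alpha>" by (rule err(2))
    finally show ?thesis
      unfolding observed_law_def \<mu>_def[symmetric]
      by (subst (asm) ret) (simp_all add: clean_law_eq_density sets_data_space)
  qed
  then have miss: "emeasure (density \<Omega> (\<lambda>x. ennreal (sign_lr d \<theta> N x))) E0 \<le> ennreal \<alpha>"
    using E unfolding \<Omega>_def by (intro emeasure_sign_mixture_le) auto
  have "emeasure (density \<Omega> (\<lambda>x. ennreal (sign_lr d \<theta> N x))) (space \<Omega>) = 1"
    using nn_integral_L[OF order_refl] by (simp add: emeasure_density cong: nn_integral_cong)
  then interpret Q: prob_space "density \<Omega> (\<lambda>x. ennreal (sign_lr d \<theta> N x))"
    by (intro prob_spaceI) simp
  have "Q.prob E0 \<le> \<alpha>"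
    using miss \<alpha> by (simp add: Q.emeasure_eq_measure)
  then have "1 - \<alpha> \<le> Q.prob E"
    using Q.prob_compl[of E0] E by (simp add: E0)
  then have alt: "ennreal (1 - \<alpha>) \<le> emeasure (density \<Omega> (\<lambda>x. ennreal (sign_lr d \<theta> N x))) E"
    by (simp add: Q.emeasure_eq_measure ennreal_leI)
  show ?thesis
    unfolding \<Omega>_def[symmetric] using E(1) null null_clean alt by (intro bexI[of _ E] conjI ballI)
qed

text \<open>The gap \<open>1 - 2 * \<alpha>\<close> between mixture and null mass of the rejection
  region is at most the integral over it of the likelihood ratio minus 1, whose second moment is
  \<open>V - 1\<close>. The inequality of means with weight \<open>\<eta>\<close> replaces
  Cauchy-Schwarz.\<close>

lemma clean_testing_bound:
  assumes \<epsilon>: "0 \<le> \<epsilon>" and \<alpha>: "0 < \<alpha>" "\<alpha> < 1 / 2"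
    and K: "QCO d K" "\<theta> \<in> K" "\<rho> \<le> L2_set \<theta> {..<d}"
    and \<phi>: "\<phi> \<in> tests d N"
    and err: "type1_error d N \<sigma> \<epsilon> \<phi> \<le> ennreal \<alpha>" "type2_error d N K \<sigma> \<epsilon> \<rho> \<phi> \<le> ennreal \<alpha>"
  shows "(1 - 2 * \<alpha>)\<^sup>2 \<le> (\<Prod>l<d. cosh (real N * (\<theta> l)\<^sup>2 / \<sigma>\<^sup>2)) - 1"
proof -
  interpret likelihood_martingale "noise d" N "sign_lr d \<theta>" by (rule likelihood_martingale_sign_lr)
  interpret \<Omega>: prob_space \<Omega> by (rule prob_space_\<Omega>)
  define L where "L = sign_lr d \<theta> N"
  define V where "V = (\<Prod>l<d. cosh (real N * (\<theta> l)\<^sup>2 / \<sigma>\<^sup>2))"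
  define \<eta> where "\<eta> = 1 - 2 * \<alpha>"
  have \<eta>: "0 < \<eta>" using \<alpha> by (simp add: \<eta>_def)
  have L_m[measurable]: "L \<in> borel_measurable \<Omega>" unfolding L_def by simp
  have L0: "0 \<le> L x" for x
    using sign_lr_pos[of d \<theta> N x] by (simp add: L_def)
  have L_int [simp]: "integrable \<Omega> L" "(\<integral>x. L x \<partial>\<Omega>) = 1" "integrable \<Omega> (\<lambda>x. (L x)\<^sup>2)"
    using integral_L[OF order_refl] integral_L_square[OF order_refl] by (auto simp: L_def)
  have L2: "(\<integral>x. (L x)\<^sup>2 \<partial>\<Omega>) = V"
    unfolding \<Omega>_def L_def V_def by (rule integral_sign_lr_square) simp
  from errors_imp_mixture_bounds[OF \<epsilon> \<alpha> K \<phi> err, folded \<Omega>_def L_def]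
  obtain E where E[measurable]: "E \<in> sets \<Omega>" and null: "emeasure \<Omega> E \<le> ennreal \<alpha>"
    and alt: "ennreal (1 - \<alpha>) \<le> emeasure (density \<Omega> (\<lambda>x. ennreal (L x))) E"
    by (elim bexE conjE) (rule that)
  have int_LE [simp]: "integrable \<Omega> (\<lambda>x. L x * indicator E x)"
    by (rule integrable_real_mult_indicator[OF E L_int(1)])
  have int_E [simp]: "integrable \<Omega> (indicator E :: _ \<Rightarrow> real)"
    by (simp add: \<Omega>.emeasure_eq_measure)
  have "emeasure (density \<Omega> (\<lambda>x. ennreal (L x))) E = (\<integral>\<^sup>+x. ennreal (L x * indicator E x) \<partial>\<Omega>)"
    by (subst emeasure_density) (auto intro!: nn_integral_cong simp: indicator_def)
  also have "\<dots> = ennreal (\<integral>x. L x * indicator E x \<partial>\<Omega>)"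
    using L0 by (intro nn_integral_eq_integral) simp_all
  finally have "ennreal (1 - \<alpha>) \<le> ennreal (\<integral>x. L x * indicator E x \<partial>\<Omega>)" using alt by simp
  moreover have "0 \<le> (\<integral>x. L x * indicator E x \<partial>\<Omega>)"
    using L0 by (intro integral_nonneg_AE) simp_all
  ultimately have "1 - \<alpha> \<le> (\<integral>x. L x * indicator E x \<partial>\<Omega>)" by (simp add: ennreal_le_iff)
  moreover have "(\<integral>x. indicator E x \<partial>\<Omega>) \<le> \<alpha>"
    using null \<alpha> by (simp add: \<Omega>.emeasure_eq_measure)
  ultimately have "\<eta> \<le> (\<integral>x. L x * indicator E x - indicator E x \<partial>\<Omega>)"
    by (simp add: \<eta>_def)
  also have "\<dots> \<le> (\<integral>x. \<eta> / 2 + ((L x)\<^sup>2 - 2 * L x + 1) / (2 * \<eta>) \<partial>\<Omega>)"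
  proof (rule integral_mono)
    fix x
    have sq: "t \<le> \<eta> / 2 + t\<^sup>2 / (2 * \<eta>)" for t
    proof -
      have "0 \<le> (\<eta> - t)\<^sup>2" by simp
      then show ?thesis using \<eta> by (simp add: power2_eq_square field_simps)
    qed
    have "(L x)\<^sup>2 - 2 * L x + 1 = (L x - 1)\<^sup>2" by (simp add: power2_eq_square algebra_simps)
    then have "L x - 1 \<le> \<eta> / 2 + ((L x)\<^sup>2 - 2 * L x + 1) / (2 * \<eta>)" "0 \<le> \<eta> / 2 + ((L x)\<^sup>2 - 2 * L x + 1) / (2 * \<eta>)"
      using sq[of "L x - 1"] \<eta> by simp_all
    then show "L x * indicator E x - indicator E x \<le> \<eta> / 2 + ((L x)\<^sup>2 - 2 * L x + 1) / (2 * \<eta>)"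
      by (simp add: indicator_def)
  qed simp_all
  also have "\<dots> = \<eta> / 2 + (V - 1) / (2 * \<eta>)"
    by (simp add: L2 \<Omega>.prob_space)
  finally have "\<eta> * \<eta> \<le> V - 1" using \<eta> by (simp add: field_simps)
  then show ?thesis by (simp add: \<eta>_def V_def power2_eq_square)
qed

text \<open>The corrupted null law dominates the mixture on every event up to the Markov error, so
  that error must fill the gap between the two masses of the rejection region. The second moment
  enters through a bound \<open>exp v\<close> since only its logarithm matters.\<close>

lemma contaminated_testing_bound:
  assumes \<epsilon>: "0 < \<epsilon>" and N: "1 \<le> N" and \<alpha>: "0 < \<alpha>" "\<alpha> < 1 / 2"
    and K: "QCO d K" "\<theta> \<in> K" "\<rho> \<le> L2_set \<theta> {..<d}"
    and \<phi>: "\<phi> \<in> tests d N"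
    and err: "type1_error d N \<sigma> \<epsilon> \<phi> \<le> ennreal \<alpha>" "type2_error d N K \<sigma> \<epsilon> \<rho> \<phi> \<le> ennreal \<alpha>"
    and \<delta>: "0 < \<delta>" and v: "0 \<le> v" "(\<Prod>l<d. cosh (real N * (\<theta> l)\<^sup>2 / \<sigma>\<^sup>2)) \<le> exp v"
  shows "1 - 2 * \<alpha> \<le> (real N * \<delta> / 2 + v / \<delta>) / (\<epsilon> * real N)"
proof -
  interpret likelihood_martingale "noise d" N "sign_lr d \<theta>" by (rule likelihood_martingale_sign_lr)
  have sets: "sets \<Omega> = sets (data_space d N)" by (simp add: sets_data_space \<Omega>_def)
  have space: "space \<Omega> = space (data_space d N)" by (rule sets_eq_imp_space_eq[OF sets])
  have b: "0 < \<epsilon> * real N" using \<epsilon> N by simp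
  have L2: "(\<integral>x. (sign_lr d \<theta> N x)\<^sup>2 \<partial>\<Omega>) \<le> exp v"
    using v(2) unfolding \<Omega>_def by (subst integral_sign_lr_square) simp_all
  have "1 \<le> exp v" using v(1) by simp
  from budgeted_coupling[OF \<delta> this L2 b] obtain C where C: "C \<in> \<Omega> \<rightarrow>\<^sub>M prob_algebra \<Omega>"
    and bud: "\<And>x. x \<in> space \<Omega> \<Longrightarrow> AE y in C x. real (hamming x y) \<le> \<epsilon> * real N"
    and le: "\<And>E. E \<in> sets \<Omega> \<Longrightarrow> emeasure (density \<Omega> (\<lambda>x. ennreal (sign_lr d \<theta> N x))) E
        \<le> emeasure (\<Omega> \<bind> C) E + ennreal ((real N * \<delta> / 2 + ln (exp v) / \<delta>) / (\<epsilon> * real N))"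
    by blast
  have adv: "C \<in> adversaries d N \<epsilon>"
    using C bud unfolding adversaries_def data_space_kernels[OF sets] space[symmetric] hamming_def by blast
  from errors_imp_mixture_bounds[OF less_imp_le[OF \<epsilon>] \<alpha> K \<phi> err, folded \<Omega>_def]
  obtain E where E: "E \<in> sets \<Omega>" and null: "\<forall>C\<in>adversaries d N \<epsilon>. emeasure (\<Omega> \<bind> C) E \<le> ennreal \<alpha>"
    and alt: "ennreal (1 - \<alpha>) \<le> emeasure (density \<Omega> (\<lambda>x. ennreal (sign_lr d \<theta> N x))) E"
    by (elim bexE conjE) (rule that)
  note alt
  also note le[OF E]
  also have "emeasure (\<Omega> \<bind> C) E + ennreal ((real N * \<delta> / 2 + ln (exp v) / \<delta>) / (\<epsilon> * real N))
      \<le> ennreal \<alpha> + ennreal ((real N * \<delta> / 2 + v / \<delta>) / (\<epsilon> * real N))"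
    unfolding ln_exp by (rule add_right_mono[OF bspec[OF null adv]])
  also have "\<dots> = ennreal (\<alpha> + (real N * \<delta> / 2 + v / \<delta>) / (\<epsilon> * real N))"
    using \<alpha> \<delta> v b by (intro ennreal_plus[symmetric]) auto
  finally have "1 - \<alpha> \<le> \<alpha> + (real N * \<delta> / 2 + v / \<delta>) / (\<epsilon> * real N)"
    using \<alpha> \<delta> v b by (subst (asm) ennreal_le_iff) auto
  then show ?thesis by simp
qed

end

section \<open>Bounds for the second moment\<close>

lemma prod_cosh_le_exp_square:
  fixes d :: nat
  assumes M: "0 \<le> M" and "\<And>l. l < d \<Longrightarrow> (\<theta> l)\<^sup>2 \<le> M" and "(\<Sum>l<d. (\<theta> l)\<^sup>2) \<le> S"
  shows "(\<Prod>l<d. cosh (real N * (\<theta> l)\<^sup>2 / \<sigma>\<^sup>2)) \<le> exp ((real N)\<^sup>2 * (M * S) / (\<sigma>\<^sup>2)\<^sup>2)"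
proof -
  have "(\<Prod>l<d. cosh (real N * (\<theta> l)\<^sup>2 / \<sigma>\<^sup>2)) \<le> (\<Prod>l<d. exp ((real N * (\<theta> l)\<^sup>2 / \<sigma>\<^sup>2)\<^sup>2))"
    by (intro prod_mono conjI cosh_le_exp_square) simp
  also have "\<dots> = exp (\<Sum>l<d. (real N * (\<theta> l)\<^sup>2 / \<sigma>\<^sup>2)\<^sup>2)"
    by (rule exp_sum[symmetric]) simp
  also have "(\<Sum>l<d. (real N * (\<theta> l)\<^sup>2 / \<sigma>\<^sup>2)\<^sup>2) = (real N)\<^sup>2 * (\<Sum>l<d. (\<theta> l)\<^sup>2 * (\<theta> l)\<^sup>2) / (\<sigma>\<^sup>2)\<^sup>2"
    unfolding sum_distrib_left sum_divide_distrib
    by (intro sum.cong) (simp_all add: power_divide power_mult_distrib power2_eq_square mult_ac)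
  also have "exp \<dots> \<le> exp ((real N)\<^sup>2 * (M * S) / (\<sigma>\<^sup>2)\<^sup>2)"
  proof -
    \<comment> \<open>One factor of each fourth power is replaced by the entry bound, the other
      keeps the squared norm; here the spread of the vector pays off.\<close>
    have "(\<Sum>l<d. (\<theta> l)\<^sup>2 * (\<theta> l)\<^sup>2) \<le> (\<Sum>l<d. M * (\<theta> l)\<^sup>2)"
      using assms(2) by (intro sum_mono mult_right_mono) auto
    also have "\<dots> \<le> M * S"
      unfolding sum_distrib_left[symmetric] using assms(3) M by (rule mult_left_mono)
    finally show ?thesis by (auto intro!: divide_right_mono mult_left_mono)
  qed
  finally show ?thesis .
qed

lemma prod_cosh_le_exp:
  fixes d :: nat
  shows "(\<Prod>l<d. cosh (real N * (\<theta> l)\<^sup>2 / \<sigma>\<^sup>2)) \<le> exp (real N * (\<Sum>l<d. (\<theta> l)\<^sup>2) / \<sigma>\<^sup>2)"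
proof -
  have "(\<Prod>l<d. cosh (real N * (\<theta> l)\<^sup>2 / \<sigma>\<^sup>2)) \<le> (\<Prod>l<d. exp (real N * (\<theta> l)\<^sup>2 / \<sigma>\<^sup>2))"
    by (intro prod_mono conjI cosh_le_exp) simp_all
  also have "\<dots> = exp (\<Sum>l<d. real N * (\<theta> l)\<^sup>2 / \<sigma>\<^sup>2)"
    by (rule exp_sum[symmetric]) simp
  also have "(\<Sum>l<d. real N * (\<theta> l)\<^sup>2 / \<sigma>\<^sup>2) = real N * (\<Sum>l<d. (\<theta> l)\<^sup>2) / \<sigma>\<^sup>2"
    by (simp add: sum_distrib_left sum_divide_distrib)
  finally show ?thesis .
qed

section \<open>The lower bound\<close>

lemma powr_quarter_square: "0 \<le> x \<Longrightarrow> (x powr (1 / 4))\<^sup>2 = sqrt x" for x :: real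
  by (simp add: power2_eq_square powr_add[symmetric] powr_half_sqrt)

lemma exists_vector_norm:
  assumes K: "QCO d K" and \<rho>: "0 \<le> \<rho>" and ne: "alternative d K \<rho> \<noteq> {}"
  shows "\<exists>\<theta>\<in>K. (\<Sum>l<d. (\<theta> l)\<^sup>2) = \<rho>\<^sup>2"
proof -
  from ne obtain \<mu> where \<mu>: "\<mu> \<in> K" "\<rho> \<le> L2_set \<mu> {..<d}" by (auto simp: alternative_def)
  define F where "F = L2_set \<mu> {..<d}"
  \<comment> \<open>If \<open>F = 0\<close> then \<open>\<rho> = 0\<close>, and division by zero
    gives \<open>t = 0\<close>, which still satisfies \<open>t * F = \<rho>\<close>.\<close>
  define t where "t = \<rho> / F"
  have F: "0 \<le> F" "F\<^sup>2 = (\<Sum>l<d. (\<mu> l)\<^sup>2)"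
    by (simp_all add: F_def L2_set_def sum_nonneg)
  have t: "0 \<le> t" "t \<le> 1" "t * F = \<rho>"
    using \<rho> \<mu>(2) F by (auto simp: t_def F_def[symmetric] divide_le_eq_1)
  define \<theta> where "\<theta> = (\<lambda>l\<in>{..<d}. t * \<mu> l)"
  have "\<theta> \<in> K"
  proof (rule QCO_solid[OF K \<mu>(1)])
    show "\<bar>\<theta> l\<bar> \<le> \<bar>\<mu> l\<bar>" if "l < d" for l
      using that t by (simp add: \<theta>_def abs_mult mult_left_le_one_le)
  qed (auto simp: \<theta>_def rvectors_def)
  moreover have "(\<Sum>l<d. (\<theta> l)\<^sup>2) = (t * F)\<^sup>2"
    by (simp add: \<theta>_def power_mult_distrib F(2) sum_distrib_left)
  ultimately show ?thesis using t(3) by blast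
qed

text \<open>\<open>\<tau>\<close> will be \<open>1 / N\<close> for the first optimal dimension and
  \<open>\<epsilon> / sqrt N\<close> for the second. The two factors sqrt j from
  \<open>B\<^sup>2\<close> cancel the 1 / j of the entry bound, so the estimate is free of
  \<open>j\<close>.\<close>

lemma prod_cosh_spread_le:
  fixes d :: nat
  assumes j: "1 \<le> j" and c: "0 < c" and \<sigma>: "0 < \<sigma>"
    and \<theta>: "(\<Sum>l<d. (\<theta> l)\<^sup>2) \<le> c * B\<^sup>2" "\<forall>l<d. (\<theta> l)\<^sup>2 \<le> c * B\<^sup>2 / real j"
    and B: "B\<^sup>2 = sqrt (real j) * \<tau> * \<sigma>\<^sup>2"
  shows "(\<Prod>l<d. cosh (real N * (\<theta> l)\<^sup>2 / \<sigma>\<^sup>2)) \<le> exp ((c * real N * \<tau>)\<^sup>2)"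
proof -
  have "(\<Prod>l<d. cosh (real N * (\<theta> l)\<^sup>2 / \<sigma>\<^sup>2))
    \<le> exp ((real N)\<^sup>2 * (c * B\<^sup>2 / real j * (c * B\<^sup>2)) / (\<sigma>\<^sup>2)\<^sup>2)"
    using \<theta> c by (intro prod_cosh_le_exp_square) auto
  also have "(real N)\<^sup>2 * (c * B\<^sup>2 / real j * (c * B\<^sup>2)) / (\<sigma>\<^sup>2)\<^sup>2 = (c * real N * \<tau>)\<^sup>2 * ((sqrt (real j))\<^sup>2 / real j) * ((\<sigma>\<^sup>2)\<^sup>2 / (\<sigma>\<^sup>2)\<^sup>2)"
    unfolding B by (simp add: power2_eq_square mult_ac)
  also have "\<dots> = (c * real N * \<tau>)\<^sup>2" using j \<sigma> by simp
  finally show ?thesis .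
qed

lemma k1_star_properties:
  assumes \<sigma>: "0 < \<sigma>" and N: "1 \<le> N" and width: "kolmogorov_width d K 0 > ereal (\<sigma> / sqrt (real N))"
  defines "k \<equiv> k1_star d K \<sigma> N"
  shows "1 \<le> k" "k \<le> d" "kolmogorov_width d K (int k - 1) > ereal (real k powr (1/4) / sqrt (real N) * \<sigma>)"
proof -
  define S where "S = {j. j \<le> d \<and> kolmogorov_width d K (int j - 1) > ereal (real j powr (1/4) / sqrt (real N) * \<sigma>)}"
  \<comment> \<open>In dimension 0 the width vanishes, contrary to the standing assumption; so index
    1 is admissible and the maximum is at least 1.\<close>
  have d: "d \<noteq> 0"
  proof
    assume "d = 0"
    then have "kolmogorov_width d K 0 \<le> 0"
      using kolmogorov_width_le_coordinate[of "{}" d K 0] by (simp add: zero_ereal_def)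
    also have "0 \<le> ereal (\<sigma> / sqrt (real N))" using \<sigma> by simp
    finally show False using width by simp
  qed
  have fin: "finite S" unfolding S_def by (rule finite_subset[of _ "{..d}"]) auto
  have S1: "1 \<in> S" using width d \<sigma> by (simp add: S_def)
  have k: "k = Max S" by (simp add: k_def k1_star_def S_def)
  have "k \<in> S" unfolding k using fin S1 by (intro Max_in) auto
  then show "k \<le> d" "kolmogorov_width d K (int k - 1) > ereal (real k powr (1/4) / sqrt (real N) * \<sigma>)"
    by (simp_all add: S_def)
  show "1 \<le> k" unfolding k using fin S1 by (intro Max_ge) auto
qed

text \<open>The maximum exists because 0 always qualifies, the width of index -1 being infinite.
  Unlike the first dimension, this one may be 0.\<close>

lemma k2_star_properties:
  fixes d N :: nat and K :: "(nat \<Rightarrow> real) set" and \<sigma> \<epsilon> :: real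
  defines "k \<equiv> k2_star d K \<sigma> N \<epsilon>"
  shows "k \<le> d" "kolmogorov_width d K (int k - 1) > ereal (real k powr (1/4) * sqrt \<epsilon> / real N powr (1/4) * \<sigma>)"
proof -
  define S where "S = {j. j \<le> d \<and> kolmogorov_width d K (int j - 1) >
               ereal (real j powr (1/4) * sqrt \<epsilon> / real N powr (1/4) * \<sigma>)}"
  have fin: "finite S" unfolding S_def by (rule finite_subset[of _ "{..d}"]) auto
  have S0: "0 \<in> S" by (simp add: S_def kolmogorov_width_def)
  have k: "k = Max S" by (simp add: k_def k2_star_def S_def)
  have "k \<in> S" unfolding k using fin S0 by (intro Max_in) auto
  then show "k \<le> d" "kolmogorov_width d K (int k - 1) > ereal (real k powr (1/4) * sqrt \<epsilon> / real N powr (1/4) * \<sigma>)"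
    by (simp_all add: S_def)
qed

theorem theorem3p13:
  fixes \<alpha> :: real
  assumes "0 < \<alpha>" "\<alpha> < 1/2"
  shows "\<exists>c::real. c > 0 \<and>
    (\<forall>(d::nat) (N::nat) (K::(nat \<Rightarrow> real) set) (\<sigma>::real) (c\<^sub>0::real) (\<epsilon>::real) (\<rho>::real).
       N \<ge> 1 \<longrightarrow> \<sigma> > 0 \<longrightarrow> c\<^sub>0 < 1/2 \<longrightarrow> 0 \<le> \<epsilon> \<longrightarrow> \<epsilon> < c\<^sub>0 \<longrightarrow> \<rho> \<ge> 0 \<longrightarrow>
       QCO d K \<longrightarrow>
       kolmogorov_width d K 0 > ereal (\<sigma> / sqrt (real N)) \<longrightarrow>
       alternative d K \<rho> \<noteq> {} \<longrightarrow>
       (\<exists>\<phi>\<in>tests d N. type1_error d N \<sigma> \<epsilon> \<phi> \<le> ennreal \<alpha> \<and> type2_error d N K \<sigma> \<epsilon> \<rho> \<phi> \<le> ennreal \<alpha>) \<longrightarrow>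
       \<rho>\<^sup>2 \<ge> c * \<sigma>\<^sup>2 * Max {sqrt (real (k1_star d K \<sigma> N)) / real N,
                           \<epsilon> * sqrt (real (k2_star d K \<sigma> N \<epsilon>) / real N),
                           \<epsilon>\<^sup>2})"
proof -
  define \<eta> where "\<eta> = 1 - 2 * \<alpha>"
  \<comment> \<open>One constant serves three contradictions: the first needs
    \<open>2 * c < \<eta>\<^sup>2\<close>, the second \<open>3 * c / 2 < \<eta>\<close>, the third
    \<open>\<eta> / 2 + c / \<eta> < \<eta>\<close>.\<close>
  define c where "c = \<eta>\<^sup>2 / 3"
  have \<eta>: "0 < \<eta>" "\<eta> < 1" using assms by (auto simp: \<eta>_def)
  have \<eta>2: "\<eta>\<^sup>2 < \<eta>" using mult_strict_left_mono[OF \<eta>(2,1)] by (simp add: power2_eq_square)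
  have c: "0 < c" "c \<le> 1" "3 * c < \<eta>" using \<eta> \<eta>2 by (auto simp: c_def)
  have main: "c * \<sigma>\<^sup>2 * Max {sqrt (real (k1_star d K \<sigma> N)) / real N,
      \<epsilon> * sqrt (real (k2_star d K \<sigma> N \<epsilon>) / real N), \<epsilon>\<^sup>2} \<le> \<rho>\<^sup>2"
    if N: "N \<ge> 1" and \<sigma>: "\<sigma> > 0" and \<epsilon>: "0 \<le> \<epsilon>" and \<rho>: "\<rho> \<ge> 0" and K: "QCO d K"
      and width: "kolmogorov_width d K 0 > ereal (\<sigma> / sqrt (real N))"
      and ne: "alternative d K \<rho> \<noteq> {}" and \<phi>: "\<phi> \<in> tests d N"
      and err: "type1_error d N \<sigma> \<epsilon> \<phi> \<le> ennreal \<alpha>" "type2_error d N K \<sigma> \<epsilon> \<rho> \<phi> \<le> ennreal \<alpha>"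
    for d N K \<sigma> \<epsilon> \<rho> \<phi>
  proof -
    interpret centered_normal \<sigma> by unfold_locales (rule \<sigma>)
    define k1 where "k1 = k1_star d K \<sigma> N"
    define k2 where "k2 = k2_star d K \<sigma> N \<epsilon>"
    have Kne: "K \<noteq> {}" using ne by (auto simp: alternative_def)
    have L2: "\<rho> \<le> L2_set \<theta> {..<d}" if "(\<Sum>l<d. (\<theta> l)\<^sup>2) = \<rho>\<^sup>2" for \<theta>
      using that \<rho> by (simp add: L2_set_def)
    have contaminated: "\<eta> \<le> (real N * \<delta> / 2 + v / \<delta>) / (\<epsilon> * real N)"
      if "0 < \<epsilon>" "\<theta> \<in> K" "(\<Sum>l<d. (\<theta> l)\<^sup>2) = \<rho>\<^sup>2" "0 < \<delta>" "0 \<le> v"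
        "(\<Prod>l<d. cosh (real N * (\<theta> l)\<^sup>2 / \<sigma>\<^sup>2)) \<le> exp v" for \<theta> \<delta> v
      unfolding \<eta>_def
      by (rule contaminated_testing_bound[OF that(1) N assms K that(2) L2[OF that(3)] \<phi> err that(4-6)])
    have term1: "c * \<sigma>\<^sup>2 * (sqrt (real k1) / real N) \<le> \<rho>\<^sup>2"
    proof (rule ccontr)
      assume neg: "\<not> ?thesis"
      note k1 = k1_star_properties[OF \<sigma> N width, folded k1_def]
      define B where "B = real k1 powr (1/4) / sqrt (real N) * \<sigma>"
      have B: "B\<^sup>2 = sqrt (real k1) * (1 / real N) * \<sigma>\<^sup>2"
        by (simp add: B_def power_mult_distrib power_divide powr_quarter_square)
      have B0: "0 \<le> B" using \<sigma> by (simp add: B_def)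
      have "\<rho>\<^sup>2 < c * B\<^sup>2" using neg by (simp add: B mult_ac)
      from exists_spread_vector_norm[OF K Kne k1(1,2) B0 k1(3)[folded B_def] c(1,2) this]
      obtain \<theta> where \<theta>: "\<theta> \<in> K" "(\<Sum>l<d. (\<theta> l)\<^sup>2) = \<rho>\<^sup>2" "\<forall>l<d. (\<theta> l)\<^sup>2 \<le> c * B\<^sup>2 / real k1"
        by blast
      have "(\<Prod>l<d. cosh (real N * (\<theta> l)\<^sup>2 / \<sigma>\<^sup>2)) \<le> exp ((c * real N * (1 / real N))\<^sup>2)"
        using \<theta> \<open>\<rho>\<^sup>2 < c * B\<^sup>2\<close> by (intro prod_cosh_spread_le[OF k1(1) c(1) \<sigma> _ _ B]) simp_all
      also have "\<dots> = exp (c\<^sup>2)" using N by simp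
      also have "\<dots> \<le> 1 + c\<^sup>2 + (c\<^sup>2)\<^sup>2" using c by (intro exp_bound) (simp_all add: power_le_one)
      also have "\<dots> \<le> 1 + c + c"
      proof -
        have "c\<^sup>2 \<le> c" using c by (simp add: power2_eq_square mult_left_le_one_le)
        moreover have "c\<^sup>2 * c\<^sup>2 \<le> c\<^sup>2" using c by (intro mult_left_le_one_le) (simp_all add: power_le_one)
        then have "(c\<^sup>2)\<^sup>2 \<le> c\<^sup>2" by (simp only: power2_eq_square[of "c\<^sup>2"])
        ultimately show ?thesis by simp
      qed
      also have "\<dots> < 1 + \<eta>\<^sup>2" using c by (simp add: c_def)
      finally have "(\<Prod>l<d. cosh (real N * (\<theta> l)\<^sup>2 / \<sigma>\<^sup>2)) - 1 < \<eta>\<^sup>2" by simp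
      moreover have "\<eta>\<^sup>2 \<le> (\<Prod>l<d. cosh (real N * (\<theta> l)\<^sup>2 / \<sigma>\<^sup>2)) - 1"
        unfolding \<eta>_def by (rule clean_testing_bound[OF \<epsilon> assms K \<theta>(1) L2[OF \<theta>(2)] \<phi> err])
      ultimately show False by simp
    qed
    have term2: "c * \<sigma>\<^sup>2 * (\<epsilon> * sqrt (real k2 / real N)) \<le> \<rho>\<^sup>2"
    proof (cases "\<epsilon> = 0 \<or> k2 = 0")
      case True
      then show ?thesis by auto
    next
      case False
      then have \<epsilon>0: "0 < \<epsilon>" and k2_1: "1 \<le> k2" using \<epsilon> by auto
      show ?thesis
      proof (rule ccontr)
        assume neg: "\<not> ?thesis"
        note k2 = k2_star_properties[of d K \<sigma> N \<epsilon>, folded k2_def]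
        define B where "B = real k2 powr (1/4) * sqrt \<epsilon> / real N powr (1/4) * \<sigma>"
        have B: "B\<^sup>2 = sqrt (real k2) * (\<epsilon> / sqrt (real N)) * \<sigma>\<^sup>2"
          using \<epsilon> by (simp add: B_def power_mult_distrib power_divide powr_quarter_square)
        have B0: "0 \<le> B" using \<sigma> \<epsilon> by (simp add: B_def)
        have "\<rho>\<^sup>2 < c * B\<^sup>2" using neg by (simp add: B real_sqrt_divide mult_ac)
        from exists_spread_vector_norm[OF K Kne k2_1 k2(1) B0 k2(2)[folded B_def] c(1,2) this]
        obtain \<theta> where \<theta>: "\<theta> \<in> K" "(\<Sum>l<d. (\<theta> l)\<^sup>2) = \<rho>\<^sup>2" "\<forall>l<d. (\<theta> l)\<^sup>2 \<le> c * B\<^sup>2 / real k2"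
          by blast
        have "(\<Prod>l<d. cosh (real N * (\<theta> l)\<^sup>2 / \<sigma>\<^sup>2)) \<le> exp ((c * real N * (\<epsilon> / sqrt (real N)))\<^sup>2)"
          using \<theta> \<open>\<rho>\<^sup>2 < c * B\<^sup>2\<close> by (intro prod_cosh_spread_le[OF k2_1 c(1) \<sigma> _ _ B]) simp_all
        also have "(c * real N * (\<epsilon> / sqrt (real N)))\<^sup>2 = real N * (c * \<epsilon>)\<^sup>2"
          using N by (simp add: power_mult_distrib power_divide power2_eq_square)
        \<comment> \<open>The choice is \<open>\<delta> = c * \<epsilon>\<close> with
          \<open>v = real N * (c * \<epsilon>)\<^sup>2\<close>, making both terms of the coupling
          bound of order \<open>c * \<epsilon> * real N\<close>.\<close>
        finally have "\<eta> \<le> (real N * (c * \<epsilon>) / 2 + real N * (c * \<epsilon>)\<^sup>2 / (c * \<epsilon>)) / (\<epsilon> * real N)"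
          using c \<epsilon>0 by (intro contaminated[OF \<epsilon>0 \<theta>(1,2)]) simp_all
        also have "\<dots> = 3 * c / 2" using c \<epsilon>0 N by (simp add: power2_eq_square field_simps)
        finally show False using c by simp
      qed
    qed
    have term3: "c * \<sigma>\<^sup>2 * \<epsilon>\<^sup>2 \<le> \<rho>\<^sup>2"
    proof (cases "\<epsilon> = 0")
      case True
      then show ?thesis by simp
    next
      case False
      then have \<epsilon>0: "0 < \<epsilon>" using \<epsilon> by simp
      show ?thesis
      proof (rule ccontr)
        assume neg: "\<not> ?thesis"
        \<comment> \<open>Any vector of \<open>K\<close> of norm exactly \<open>\<rho>\<close>
          serves here, since the linear bound on \<open>ln V\<close> sees only the norm.\<close>
        from exists_vector_norm[OF K \<rho> ne] obtain \<theta> where \<theta>: "\<theta> \<in> K" "(\<Sum>l<d. (\<theta> l)\<^sup>2) = \<rho>\<^sup>2" by blast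
        have "(\<Prod>l<d. cosh (real N * (\<theta> l)\<^sup>2 / \<sigma>\<^sup>2)) \<le> exp (real N * \<rho>\<^sup>2 / \<sigma>\<^sup>2)"
          using prod_cosh_le_exp[of N \<theta> \<sigma> d] \<theta>(2) by simp
        also have "\<dots> \<le> exp (real N * (c * \<sigma>\<^sup>2 * \<epsilon>\<^sup>2) / \<sigma>\<^sup>2)"
        proof -
          have "real N * \<rho>\<^sup>2 / \<sigma>\<^sup>2 \<le> real N * (c * \<sigma>\<^sup>2 * \<epsilon>\<^sup>2) / \<sigma>\<^sup>2"
            using neg by (intro divide_right_mono mult_left_mono) simp_all
          then show ?thesis by (simp only: exp_le_cancel_iff)
        qed
        also have "real N * (c * \<sigma>\<^sup>2 * \<epsilon>\<^sup>2) / \<sigma>\<^sup>2 = real N * c * \<epsilon>\<^sup>2" using \<sigma> by simp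
        \<comment> \<open>With \<open>\<delta> = \<eta> * \<epsilon>\<close> the first term amounts
          to half of \<open>\<eta>\<close> and the second to a third, so the sum stays below
          \<open>\<eta>\<close>.\<close>
        finally have "\<eta> \<le> (real N * (\<eta> * \<epsilon>) / 2 + real N * c * \<epsilon>\<^sup>2 / (\<eta> * \<epsilon>)) / (\<epsilon> * real N)"
          using c \<epsilon>0 \<eta> by (intro contaminated[OF \<epsilon>0 \<theta>(1,2)]) simp_all
        also have "\<dots> = \<eta> / 2 + c / \<eta>" using \<eta> \<epsilon>0 N by (simp add: power2_eq_square field_simps)
        also have "c / \<eta> = \<eta> / 3" using \<eta> by (simp add: c_def power2_eq_square)
        finally show False using \<eta> by simp
      qed
    qed
    have "Max {sqrt (real k1) / real N, \<epsilon> * sqrt (real k2 / real N), \<epsilon>\<^sup>2}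
      \<in> {sqrt (real k1) / real N, \<epsilon> * sqrt (real k2 / real N), \<epsilon>\<^sup>2}"
      by (intro Max_in) auto
    then show ?thesis
      using term1 term2 term3 unfolding k1_def k2_def by auto
  qed
  show ?thesis
  proof (intro exI[of _ c] conjI allI impI, rule c(1))
    fix d N :: nat and K :: "(nat \<Rightarrow> real) set" and \<sigma> c\<^sub>0 \<epsilon> \<rho> :: real
    assume *: "N \<ge> 1" "\<sigma> > 0" "0 \<le> \<epsilon>" "\<rho> \<ge> 0" "QCO d K" "kolmogorov_width d K 0 > ereal (\<sigma> / sqrt (real N))"
      "alternative d K \<rho> \<noteq> {}"
      and "\<exists>\<phi>\<in>tests d N. type1_error d N \<sigma> \<epsilon> \<phi> \<le> ennreal \<alpha> \<and> type2_error d N K \<sigma> \<epsilon> \<rho> \<phi> \<le> ennreal \<alpha>"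
    then obtain \<phi> where "\<phi> \<in> tests d N" "type1_error d N \<sigma> \<epsilon> \<phi> \<le> ennreal \<alpha>" "type2_error d N K \<sigma> \<epsilon> \<rho> \<phi> \<le> ennreal \<alpha>"
      by blast
    from main[OF * this] show "\<rho>\<^sup>2 \<ge> c * \<sigma>\<^sup>2 * Max {sqrt (real (k1_star d K \<sigma> N)) / real N,
        \<epsilon> * sqrt (real (k2_star d K \<sigma> N \<epsilon>) / real N), \<epsilon>\<^sup>2}" .
  qed
qed

end
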